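(* Let $\mathcal T$ be a regular linear tessellation with activities $\pi_l\in(0,1)$, let $D$ be a window, $k\ge2$ the number of colours and $\alpha_V\in[0,1]$. Let $\hat{\mathcal A}_{\Phi_D}$ be the consistent polygonal field in $D$, and let $\hat{\mathcal D}_D$ be the random coloured polygonal configuration generated by the particle dynamics (births and rules (E1)–(E4)) described in the context. Then $\hat{\mathcal A}_{\Phi_D}$ and $\hat{\mathcal D}_D$ coincide in distribution.
   Context: Regular linear tessellation: a countable family $\mathcal T$ of straight lines in $\mathbb R^2$ such that no three lines of $\mathcal T$ meet at one point and every bounded set is hit by finitely many lines of $\mathcal T$. Each $l\in\mathcal T$ carries a fixed activity $\pi_l\in(0,1)$. Windows: bounded open convex sets $D\subseteq\mathbb R^2$ such that $\partial D$ contains no intersection point of two lines of $\mathcal T$ and every line of $\mathcal T$ hitting $\overline D$ meets $\partial D$ in exactly two points. $\mathcal T$ partitions $D$ into finitely many convex cells. Nodes are the intersection points $n(l_1,l_2)$ of two lines of $\mathcal T$; segments are the pieces of lines of $\mathcal T$ between consecutive nodes (possibly truncated by $\partial D$). Admissible configurations: assigning each cell a colour in $\{1,\dots,k\}$ gives a coloured planar graph $\hat\gamma$ in $\overline D$, whose underlying uncoloured graph $\gamma$ consists of all segments separating cells of different colours. The set $\hat\Gamma_D(\mathcal T)$ of admissible coloured polygonal configurations is the set of all coloured planar graphs with edges on lines of $\mathcal T$, interior vertices (in $D$) of degree 2, 3 or 4, boundary vertices (on $\partial D$) of degree 1, and no two adjacent faces (faces sharing an edge) of the same colour. It is in bijection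 with the colourings of the cells. A node lying inside a straight piece of $\gamma$ at which no other segment of $\gamma$ ends or passes is not a vertex. V-, T- and X-vertices are the interior vertices of degree 2, 3 and 4, and $N_V(\gamma),N_T(\gamma),N_X(\gamma)$ are their numbers. $E(\gamma)$ is the set of edges: maximal unions of connected collinear segments of $\gamma$ not broken by a vertex; edges are taken open. $E^*(\gamma)$ is the set of primary edges: maximal unions of connected collinear segments of $\gamma$ (possibly containing several edges because of T- or X-vertices). $l[e]$ is the line of $\mathcal T$ containing $e$. Polygonal field: for $\mathcal H_D:\hat\Gamma_D(\mathcal T)\to\mathbb R\cup\{+\infty\}$, $\hat{\mathcal A}_{\mathcal H_D}$ is the random element of $\hat\Gamma_D(\mathcal T)$ with $\mathbb P(\hat{\mathcal A}_{\mathcal H_D}=\hat\gamma)\propto e^{-\mathcal H_D(\hat\gamma)}\prod_{e\in E^*(\gamma)}\pi_{l[e]}$. Consistent polygonal field: given $\alpha_V\in[0,1]$ put $\alpha_X=1-\alpha_V$, $\alpha_T=\frac12\bigl(1-\frac{k-2}{k-1}\alpha_X\bigr)$, $\epsilon=\frac{\alpha_V}{k-1}+\frac{k-2}{k-1}\alpha_T$, and $$\Phi_D(\hat\gamma)=-N_V(\gamma)\log\alpha_V-N_T(\gamma)\log((k-1)\alpha_T)-N_X(\gamma)\log((k-1)\alpha_X)+\mathrm{card}(E(\gamma))\log(k-1)$$ $$-\sum_{e\in E(\gamma)}\ \sum_{l\in\mathcal T,\,l\nsim e}\log(1-\epsilon\pi_l)+\sum_{n(l_1,l_2)\in\gamma}\log\Bigl(1-\frac{\alpha_V}{k-1}\pi_{l_1}\pi_{l_2}\Bigr),$$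 with $0\times\infty=0$. Here $l\nsim e$ means that $l$ intersects the open edge $e$ but is not collinear with it, and $n(l_1,l_2)\in\gamma$ ranges over nodes lying on edges of $\gamma$ or coinciding with vertices of $\gamma$. Particle dynamics. View points of $D$ as time-space points $(t,y)$, time $t$ increasing from left to right; no line of $\mathcal T$ and no segment of $\partial D$ is parallel to the spatial ($y$) axis. For a line $l\in\mathcal T$ hitting $D$, $\mathrm{in}(l,D)$ is the point of $l\cap\partial D$ with the smaller time coordinate. The left-most point of $\overline D$ is given a colour chosen uniformly from the $k$ colours. Births are attempted independently of each other: with probability $\alpha_V\pi_{l_1}\pi_{l_2}/(k-1)$ at each node $n(l_1,l_2)\in D$ (interior birth site) and with probability $\pi_l/(1+\pi_l)$ at each entry point $\mathrm{in}(l,D)$ (boundary birth site). An interior birth site emits two particles, moving forward in time along $l_1$ and $l_2$ respectively, unless the node is hit by a previously born particle (or by two colliding ones), in which case the birth does not occur. A boundary birth site emits one particle moving forward in time along $l$. The trajectory (trajectories) of a birth event bound a new polygonal region, whose colour is chosen uniformly from the $k-1$ colours different from that of the region just prior to (to the left of) the birth site. Particles evolve independently as follows. (E1) Between the critical moments below each particle moves freely with constant velocity (along its line). (E2) A particle hitting $\partial D$ dies. (E3) If two particles collide at a node $(t,y)=n(l_i,l_j)\in D$: [a] if the colours above and below $(t,y)$ (i.e. on the outer sides of the two incoming trajectories) are identical, say $i$, then with probability $\alpha_V$ both particles die, and with probability $\alpha_X$ both survive, continuing along their lines, and create a new polygon whose colour is uniform on the $k-1$ colours different from $i$; [b] if the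 colours above and below are different, say $i\ne j$, then for each of the two particles, with probability $\alpha_T$ that particle survives while the other dies, and with probability $(k-2)\alpha_X/(k-1)=1-2\alpha_T$ both survive and create a new polygon whose colour is uniform on the $k-2$ colours different from $i$ and $j$. (E4) When a particle moving along $l_i$ reaches a node $n(l_i,l_j)$ without collision: with probability $\alpha_V\pi_{l_j}/(k-1)$ it turns so as to move along $l_j$; with probability $(k-2)\alpha_T\pi_{l_j}/(k-1)$ it splits into two particles moving along $l_i$ and $l_j$, creating a new polygon whose colour is uniform on the $k-2$ colours different from those on the two sides of the incoming trajectory; otherwise (probability $1-\epsilon\pi_{l_j}$) it keeps moving along $l_i$. All random choices are independent given the past. $\hat{\mathcal D}_D\in\hat\Gamma_D(\mathcal T)$ is the resulting coloured configuration, whose edges are traced by the particle trajectories. *)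

theory Defs
  imports "HOL-Probability.Probability"
begin

section \<open>Tessellation and window\<close>

text \<open>Points of the plane are time-space pairs \<open>(t, y)\<close>.\<close>

type_synonym point = "real \<times> real"

definition regular_tessellation :: "point set set \<Rightarrow> bool" where
  "regular_tessellation T \<longleftrightarrow>
     countable T \<and>
     (\<forall>l\<in>T. affine l \<and> aff_dim l = 1) \<and>
     (\<forall>l1\<in>T. \<forall>l2\<in>T. \<forall>l3\<in>T. l1 \<noteq> l2 \<and> l1 \<noteq> l3 \<and> l2 \<noteq> l3 \<longrightarrow> l1 \<inter> l2 \<inter> l3 = {}) \<and>
     (\<forall>B. bounded B \<longrightarrow> finite {l\<in>T. l \<inter> B \<noteq> {}})"

definition nodes :: "point set set \<Rightarrow> point set" where
  "nodes T = {v. \<exists>l1\<in>T. \<exists>l2\<in>T. l1 \<noteq> l2 \<and> v \<in> l1 \<and> v \<in> l2}"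

definition window :: "point set set \<Rightarrow> point set \<Rightarrow> bool" where
  "window T D \<longleftrightarrow>
     bounded D \<and> open D \<and> convex D \<and> D \<noteq> {} \<and>
     nodes T \<inter> frontier D = {} \<and>
     (\<forall>l\<in>T. l \<inter> closure D \<noteq> {} \<longrightarrow> card (l \<inter> frontier D) = 2)"

definition no_spatial_direction :: "point set set \<Rightarrow> point set \<Rightarrow> bool" where
  "no_spatial_direction T D \<longleftrightarrow>
     (\<forall>l\<in>T. \<forall>p\<in>l. \<forall>q\<in>l. p \<noteq> q \<longrightarrow> fst p \<noteq> fst q) \<and>
     (\<forall>p q. p \<noteq> q \<and> closed_segment p q \<subseteq> frontier D \<longrightarrow> fst p \<noteq> fst q)"

definition cells :: "point set set \<Rightarrow> point set \<Rightarrow> point set set" where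
  "cells T D = components (D - \<Union>T)"

text \<open>Segments are open: they contain neither the nodes nor the boundary points at their ends.\<close>

definition segments :: "point set set \<Rightarrow> point set \<Rightarrow> point set set" where
  "segments T D = (\<Union>l\<in>T. components (l \<inter> D - nodes T))"


section \<open>Coloured polygonal configurations\<close>

text \<open>
  A coloured planar graph is a pair \<open>(G, c)\<close>. The uncoloured graph is given by the set \<open>G\<close> of the
  segments it consists of. The faces are unions of cells, so their colours are given by a
  function \<open>c\<close> on cells (\<open>undefined\<close> elsewhere) that is constant on faces.
\<close>

type_synonym config = "point set set \<times> (point set \<Rightarrow> nat)"

definition degree :: "point set set \<Rightarrow> point \<Rightarrow> nat" where
  "degree G v = card {s\<in>G. v \<in> closure s}"

text \<open>
  In the last condition, the direction from right to left says that \<open>c\<close> is constant on the faces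
  of \<open>G\<close>, and the direction from left to right that faces sharing an edge have different colours.
  Degree 0 is that of the points that do not lie on the graph.
\<close>

definition configs :: "point set set \<Rightarrow> point set \<Rightarrow> nat \<Rightarrow> config set" where
  "configs T D k = {(G, c).
     G \<subseteq> segments T D \<and>
     (\<forall>v \<in> nodes T \<inter> D. degree G v \<in> {0, 2, 3, 4}) \<and>
     (\<forall>v \<in> frontier D. degree G v \<in> {0, 1}) \<and>
     c \<in> cells T D \<rightarrow>\<^sub>E {1..k} \<and>
     (\<forall>s \<in> segments T D. \<forall>C \<in> cells T D. \<forall>C' \<in> cells T D.
        C \<noteq> C' \<and> s \<subseteq> closure C \<inter> closure C' \<longrightarrow> (s \<in> G \<longleftrightarrow> c C \<noteq> c C'))}"

definition V_vertices :: "point set set \<Rightarrow> point set \<Rightarrow> point set set \<Rightarrow> point set" where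
  "V_vertices T D G = {v \<in> nodes T \<inter> D. degree G v = 2 \<and>
     \<not> (\<exists>l\<in>T. \<forall>s\<in>G. v \<in> closure s \<longrightarrow> s \<subseteq> l)}"

definition T_vertices :: "point set set \<Rightarrow> point set \<Rightarrow> point set set \<Rightarrow> point set" where
  "T_vertices T D G = {v \<in> nodes T \<inter> D. degree G v = 3}"

definition X_vertices :: "point set set \<Rightarrow> point set \<Rightarrow> point set set \<Rightarrow> point set" where
  "X_vertices T D G = {v \<in> nodes T \<inter> D. degree G v = 4}"

definition interior_vertices :: "point set set \<Rightarrow> point set \<Rightarrow> point set set \<Rightarrow> point set" where
  "interior_vertices T D G = V_vertices T D G \<union> T_vertices T D G \<union> X_vertices T D G"

definition part_on_line :: "point set set \<Rightarrow> point set \<Rightarrow> point set" where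
  "part_on_line G l = \<Union> (closure ` {s\<in>G. s \<subseteq> l})"

definition edges :: "point set set \<Rightarrow> point set \<Rightarrow> point set set \<Rightarrow> point set set" where
  "edges T D G = (\<Union>l\<in>T. components (part_on_line G l \<inter> D - interior_vertices T D G))"

definition primary_edges :: "point set set \<Rightarrow> point set set \<Rightarrow> point set set" where
  "primary_edges T G = (\<Union>l\<in>T. components (part_on_line G l))"

definition line_of :: "point set set \<Rightarrow> point set \<Rightarrow> point set" where
  "line_of T e = (THE l. l \<in> T \<and> e \<subseteq> l)"

definition crossing_lines :: "point set set \<Rightarrow> point set \<Rightarrow> point set set" where
  "crossing_lines T e = {l\<in>T. l \<inter> e \<noteq> {} \<and> \<not> e \<subseteq> l}"

definition nodes_on :: "point set set \<Rightarrow> point set set \<Rightarrow> point set" where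
  "nodes_on T G = nodes T \<inter> \<Union> (closure ` G)"


section \<open>Polygonal fields\<close>

definition normalised_pmf :: "'a set \<Rightarrow> ('a \<Rightarrow> real) \<Rightarrow> 'a pmf" where
  "normalised_pmf S w = embed_pmf (\<lambda>x. if x \<in> S then w x / sum w S else 0)"

lemma pmf_normalised_pmf:
  assumes "finite S" and "\<And>x. x \<in> S \<Longrightarrow> 0 \<le> w x" and "0 < sum w S"
  shows "pmf (normalised_pmf S w) x = (if x \<in> S then w x / sum w S else 0)"
  unfolding normalised_pmf_def
proof (rule pmf_embed_pmf)
  fix x
  show "0 \<le> (if x \<in> S then w x / sum w S else 0)"
    using assms by auto
next
  have "(\<integral>\<^sup>+ x. ennreal (if x \<in> S then w x / sum w S else 0) \<partial>count_space UNIV)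
      = (\<Sum>x\<in>S. ennreal (w x / sum w S))"
    by (subst nn_integral_count_space'[of S]) (use assms in auto)
  also have "\<dots> = ennreal (\<Sum>x\<in>S. w x / sum w S)"
    by (rule sum_ennreal) (use assms in auto)
  also have "(\<Sum>x\<in>S. w x / sum w S) = 1"
    using assms by (simp flip: sum_divide_distrib)
  finally show "(\<integral>\<^sup>+ x. ennreal (if x \<in> S then w x / sum w S else 0) \<partial>count_space UNIV) = 1"
    by simp
qed

text \<open>\<open>exp (- h)\<close> for an energy \<open>h\<close> that is real or \<open>\<infinity>\<close>.\<close>

definition boltzmann :: "ereal \<Rightarrow> real" where
  "boltzmann h = (if h = \<infinity> then 0 else exp (- real_of_ereal h))"

definition polygonal_field ::
  "point set set \<Rightarrow> (point set \<Rightarrow> real) \<Rightarrow> point set \<Rightarrow> nat \<Rightarrow> (config \<Rightarrow> ereal) \<Rightarrow> config pmf" where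
  "polygonal_field T \<pi> D k H = normalised_pmf (configs T D k)
     (\<lambda>\<gamma>. boltzmann (H \<gamma>) * (\<Prod>e \<in> primary_edges T (fst \<gamma>). \<pi> (line_of T e)))"

definition alpha_X :: "real \<Rightarrow> real" where
  "alpha_X \<alpha>\<^sub>V = 1 - \<alpha>\<^sub>V"

definition alpha_T :: "nat \<Rightarrow> real \<Rightarrow> real" where
  "alpha_T k \<alpha>\<^sub>V = (1 - (real k - 2) / (real k - 1) * alpha_X \<alpha>\<^sub>V) / 2"

definition eps :: "nat \<Rightarrow> real \<Rightarrow> real" where
  "eps k \<alpha>\<^sub>V = \<alpha>\<^sub>V / (real k - 1) + (real k - 2) / (real k - 1) * alpha_T k \<alpha>\<^sub>V"

text \<open>
  The library has \<open>ln 0 = 0\<close> on the reals, whereas the energy needs \<open>log 0 = - \<infinity>\<close>. The convention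
  \<open>0 * \<infinity> = 0\<close> is that of type \<^typ>\<open>ereal\<close>.
\<close>

definition elog :: "real \<Rightarrow> ereal" where
  "elog x = (if x = 0 then - \<infinity> else ereal (ln x))"

text \<open>Exactly two lines pass through a node, so the last product has two factors.\<close>

definition Phi ::
  "point set set \<Rightarrow> (point set \<Rightarrow> real) \<Rightarrow> point set \<Rightarrow> nat \<Rightarrow> real \<Rightarrow> config \<Rightarrow> ereal" where
  "Phi T \<pi> D k \<alpha>\<^sub>V = (\<lambda>(G, c).
     - (ereal (card (V_vertices T D G)) * elog \<alpha>\<^sub>V)
     - ereal (card (T_vertices T D G)) * elog ((real k - 1) * alpha_T k \<alpha>\<^sub>V)
     - ereal (card (X_vertices T D G)) * elog ((real k - 1) * alpha_X \<alpha>\<^sub>V)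
     + ereal (card (edges T D G) * ln (real k - 1))
     - ereal (\<Sum>e \<in> edges T D G. \<Sum>l \<in> crossing_lines T e. ln (1 - eps k \<alpha>\<^sub>V * \<pi> l))
     + ereal (\<Sum>v \<in> nodes_on T G. ln (1 - \<alpha>\<^sub>V / (real k - 1) * (\<Prod>l \<in> {l\<in>T. v \<in> l}. \<pi> l))))"


section \<open>Particle dynamics\<close>

definition leftmost :: "point set \<Rightarrow> point" where
  "leftmost S = (THE p. p \<in> closure S \<and> (\<forall>q \<in> closure S. fst p \<le> fst q))"

definition entry_point :: "point set \<Rightarrow> point set \<Rightarrow> point" where
  "entry_point D l = arg_min_on fst (l \<inter> frontier D)"

definition entry_points :: "point set set \<Rightarrow> point set \<Rightarrow> point set" where
  "entry_points T D = entry_point D ` {l\<in>T. l \<inter> D \<noteq> {}}"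

definition sites_at :: "point set set \<Rightarrow> point set \<Rightarrow> real \<Rightarrow> point set" where
  "sites_at T D t = {v \<in> (nodes T \<inter> D) \<union> entry_points T D. fst v = t}"

text \<open>
  The cell at the left-most point of the window. If a line of the tessellation enters there, two
  cells meet at that point, and the choice of the one that gets the initial colour is arbitrary.
\<close>

definition initial_cell :: "point set set \<Rightarrow> point set \<Rightarrow> point set" where
  "initial_cell T D = (SOME C. C \<in> cells T D \<and> leftmost D \<in> closure C)"

text \<open>
  Every cell \<open>C\<close> other than the initial one begins at a site, namely at its left-most point, and its
  colour is determined there. At an entry point the other adjacent cell is the one to the left.
\<close>

definition begins_at :: "point set set \<Rightarrow> point set \<Rightarrow> point set \<Rightarrow> point \<Rightarrow> bool" where
  "begins_at T D C v \<longleftrightarrow> C \<in> cells T D \<and> C \<noteq> initial_cell T D \<and> leftmost C = v"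

definition cell_before_entry :: "point set set \<Rightarrow> point set \<Rightarrow> point \<Rightarrow> point set" where
  "cell_before_entry T D v =
     (THE C. C \<in> cells T D \<and> v \<in> closure C \<and> \<not> begins_at T D C v)"

text \<open>
  Four cells meet at a node in the window. One begins there, and the following lie before it (to
  the left), above it and below it.
\<close>

definition cell_before :: "point set set \<Rightarrow> point set \<Rightarrow> point \<Rightarrow> point set" where
  "cell_before T D v =
     (THE C. C \<in> cells T D \<and> v \<in> closure C \<and> (\<forall>q\<in>C. fst q < fst v))"

definition cell_above :: "point set set \<Rightarrow> point set \<Rightarrow> point \<Rightarrow> point set" where
  "cell_above T D v =
     (THE C. C \<in> cells T D \<and> (\<forall>\<^sub>F h in at_right 0. (fst v, snd v + h) \<in> C))"

definition cell_below :: "point set set \<Rightarrow> point set \<Rightarrow> point \<Rightarrow> point set" where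
  "cell_below T D v =
     (THE C. C \<in> cells T D \<and> (\<forall>\<^sub>F h in at_right 0. (fst v, snd v - h) \<in> C))"

text \<open>
  Of the two lines through a node, \<open>upper_line\<close> is the one that runs above the other after the node,
  hence below it before the node; \<open>lower_line\<close> is the other one.
\<close>

definition upper_line :: "point set set \<Rightarrow> point \<Rightarrow> point set" where
  "upper_line T v = (THE l. l \<in> T \<and> v \<in> l \<and>
     (\<forall>m\<in>T. v \<in> m \<longrightarrow> (\<forall>p\<in>l. \<forall>q\<in>m. fst v < fst p \<and> fst p = fst q \<longrightarrow> snd q \<le> snd p)))"

definition lower_line :: "point set set \<Rightarrow> point \<Rightarrow> point set" where
  "lower_line T v = (THE l. l \<in> T \<and> v \<in> l \<and>
     (\<forall>m\<in>T. v \<in> m \<longrightarrow> (\<forall>p\<in>l. \<forall>q\<in>m. fst v < fst p \<and> fst p = fst q \<longrightarrow> snd p \<le> snd q)))"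

text \<open>
  The state of the dynamics is a pair \<open>(G, c)\<close> of the segments traversed so far by particles,
  including those on which the present particles move, and the colours determined so far. The
  particle on a segment dies at its end if that lies on the boundary; so only ends at nodes occur below.
\<close>

definition hit_along :: "point set set \<Rightarrow> point set \<Rightarrow> point \<Rightarrow> bool" where
  "hit_along G l v \<longleftrightarrow> (\<exists>s\<in>G. s \<subseteq> l \<and> v \<in> closure s \<and> (\<forall>q\<in>s. fst q < fst v))"

definition segments_leaving ::
  "point set set \<Rightarrow> point set \<Rightarrow> point \<Rightarrow> point set set \<Rightarrow> point set set" where
  "segments_leaving T D v L =
     {s \<in> segments T D. v \<in> closure s \<and> (\<forall>q\<in>s. fst v < fst q) \<and> (\<exists>l\<in>L. s \<subseteq> l)}"

definition new_colour :: "nat \<Rightarrow> nat set \<Rightarrow> nat pmf" where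
  "new_colour k X = pmf_of_set ({1..k} - X)"

text \<open>
  The outcome at a site is a pair \<open>(L, i)\<close> of the set of lines along which particles leave
  the site and the colour of the cell that begins there.

  At a node, let \<open>a\<close> and \<open>b\<close> be the colours of the cells above and below. If particles leave along
  both lines, they bound a new polygon, whose colour is uniform outside \<open>X\<close>. Otherwise the cell that
  begins at the node belongs to the same face as the cell from which no trajectory separates it.
  That is the cell below if the only particle to leave does so along the upper line, and the cell above
  if it leaves along the lower line; if no particle leaves, it is both.
\<close>

definition leave ::
  "nat \<Rightarrow> point set \<Rightarrow> point set \<Rightarrow> nat \<Rightarrow> nat \<Rightarrow> nat set \<Rightarrow> point set set \<Rightarrow> (point set set \<times> nat) pmf" where
  "leave k u l a b X L =
     (if L = {u, l} then map_pmf (Pair L) (new_colour k X)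
      else return_pmf (L, if L = {u} then b else a))"

definition collision :: "nat \<Rightarrow> real \<Rightarrow> point set \<Rightarrow> point set \<Rightarrow> nat \<Rightarrow> nat \<Rightarrow> point set set pmf" where
  "collision k \<alpha>\<^sub>V u l a b =
     (if a = b then pmf_of_list [({}, \<alpha>\<^sub>V), ({u, l}, alpha_X \<alpha>\<^sub>V)]
      else pmf_of_list
        [({u}, alpha_T k \<alpha>\<^sub>V), ({l}, alpha_T k \<alpha>\<^sub>V),
         ({u, l}, (real k - 2) * alpha_X \<alpha>\<^sub>V / (real k - 1))])"

text \<open>A single particle moving along \<open>m\<close> arrives at the node of \<open>m\<close> and \<open>m'\<close>.\<close>

definition passage ::
  "(point set \<Rightarrow> real) \<Rightarrow> nat \<Rightarrow> real \<Rightarrow> point set \<Rightarrow> point set \<Rightarrow> point set set pmf" where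
  "passage \<pi> k \<alpha>\<^sub>V m m' = pmf_of_list
     [({m'}, \<alpha>\<^sub>V * \<pi> m' / (real k - 1)),
      ({m, m'}, (real k - 2) * alpha_T k \<alpha>\<^sub>V * \<pi> m' / (real k - 1)),
      ({m}, 1 - eps k \<alpha>\<^sub>V * \<pi> m')]"

definition node_outcome ::
  "point set set \<Rightarrow> (point set \<Rightarrow> real) \<Rightarrow> point set \<Rightarrow> nat \<Rightarrow> real \<Rightarrow> config \<Rightarrow> point \<Rightarrow>
     (point set set \<times> nat) pmf" where
  "node_outcome T \<pi> D k \<alpha>\<^sub>V = (\<lambda>(G, c) v.
     let u = upper_line T v; l = lower_line T v;
         a = c (cell_above T D v); b = c (cell_below T D v); w = c (cell_before T D v)
     in bernoulli_pmf (\<alpha>\<^sub>V * \<pi> u * \<pi> l / (real k - 1)) \<bind> (\<lambda>birth.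
          if hit_along G u v \<and> hit_along G l v then
            collision k \<alpha>\<^sub>V u l a b \<bind> leave k u l a b {a, b}
          else if hit_along G u v then
            passage \<pi> k \<alpha>\<^sub>V u l \<bind> leave k u l a b {w, b}
          else if hit_along G l v then
            passage \<pi> k \<alpha>\<^sub>V l u \<bind> leave k u l a b {a, w}
          else
            leave k u l a b {w} (if birth then {u, l} else {})))"

definition entry_outcome ::
  "point set set \<Rightarrow> (point set \<Rightarrow> real) \<Rightarrow> point set \<Rightarrow> nat \<Rightarrow> config \<Rightarrow> point \<Rightarrow>
     (point set set \<times> nat) pmf" where
  "entry_outcome T \<pi> D k = (\<lambda>(G, c) v.
     let l = (THE l. l \<in> T \<and> v \<in> l); w = c (cell_before_entry T D v)
     in bernoulli_pmf (\<pi> l / (1 + \<pi> l)) \<bind> (\<lambda>birth.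
          if birth then map_pmf (Pair {l}) (new_colour k {w}) else return_pmf ({}, w)))"

definition site_outcome ::
  "point set set \<Rightarrow> (point set \<Rightarrow> real) \<Rightarrow> point set \<Rightarrow> nat \<Rightarrow> real \<Rightarrow> config \<Rightarrow> point \<Rightarrow>
     (point set set \<times> nat) pmf" where
  "site_outcome T \<pi> D k \<alpha>\<^sub>V st v =
     (if v \<in> nodes T then node_outcome T \<pi> D k \<alpha>\<^sub>V st v else entry_outcome T \<pi> D k st v)"

definition update ::
  "point set set \<Rightarrow> point set \<Rightarrow> real \<Rightarrow> config \<Rightarrow> (point \<Rightarrow> point set set \<times> nat) \<Rightarrow> config" where
  "update T D t = (\<lambda>(G, c) out.
     (G \<union> (\<Union>v \<in> sites_at T D t. segments_leaving T D v (fst (out v))),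
      (\<lambda>C. if \<exists>v \<in> sites_at T D t. begins_at T D C v then snd (out (leftmost C)) else c C)))"

text \<open>
  Simultaneous events take place at different sites and are independent given the past. The second
  argument
  of \<^const>\<open>Pi_pmf\<close> is only a default value outside the set of sites.
\<close>

definition step ::
  "point set set \<Rightarrow> (point set \<Rightarrow> real) \<Rightarrow> point set \<Rightarrow> nat \<Rightarrow> real \<Rightarrow> config \<Rightarrow> real \<Rightarrow> config pmf" where
  "step T \<pi> D k \<alpha>\<^sub>V st t =
     map_pmf (update T D t st)
       (Pi_pmf (sites_at T D t) ({}, 0) (site_outcome T \<pi> D k \<alpha>\<^sub>V st))"

primrec run ::
  "point set set \<Rightarrow> (point set \<Rightarrow> real) \<Rightarrow> point set \<Rightarrow> nat \<Rightarrow> real \<Rightarrow> real list \<Rightarrow> config \<Rightarrow> config pmf" where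
  "run T \<pi> D k \<alpha>\<^sub>V [] st = return_pmf st"
| "run T \<pi> D k \<alpha>\<^sub>V (t # ts) st = step T \<pi> D k \<alpha>\<^sub>V st t \<bind> run T \<pi> D k \<alpha>\<^sub>V ts"

definition particle_dynamics ::
  "point set set \<Rightarrow> (point set \<Rightarrow> real) \<Rightarrow> point set \<Rightarrow> nat \<Rightarrow> real \<Rightarrow> config pmf" where
  "particle_dynamics T \<pi> D k \<alpha>\<^sub>V =
     pmf_of_set {1..k} \<bind> (\<lambda>i.
       run T \<pi> D k \<alpha>\<^sub>V
         (sorted_list_of_set (fst ` ((nodes T \<inter> D) \<union> entry_points T D)))
         ({}, (\<lambda>C. if C = initial_cell T D then i else undefined)))"

end

theory Submission
  imports Defs
begin

text \<open>
  Every line is the zero set of an affine height function, so the cells and the segments are the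
  classes of points of the window with the same vector of signs, and their closures can be read
  off from these signs. Exactly one cell begins at each site (node or entry point), and the law of
  the outcome at a site depends only on what has been determined strictly earlier. Hence the
  probability that the dynamics ends in a configuration is a product over the sites of one-step
  probabilities that can be evaluated at the final configuration itself.

  The Gibbs weight is a product over the sites as well: count each edge and each primary edge at the
  site where its first segment starts, and each factor \<open>1 - \<epsilon> \<pi>\<close> at the node that is passed straight.
  Site by site the two products differ by a factor that does not depend on the configuration, namely
  \<open>1 - \<alpha> \<pi> \<pi>' / (k - 1)\<close> at a node and \<open>1 / (1 + \<pi>)\<close> at an entry point. As impossible configurations have
  probability 0, normalisation gives the equality of the two laws.
\<close>

section \<open>Sign vectors of cells and segments\<close>

text \<open>The two laws agree because of a local bookkeeping of powers of K = k - 1. Each edge has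
  Gibbs weight 1/K and is charged to its starting site, so one kind of vertex can pay for different
  moves: a V-vertex with j departing edges is a double death (j = 0), a turn (j = 1) or a birth (j =
  2); a T-vertex is a collision with one survivor (j = 1) or a split (j = 2). The factors of K in
  the coefficients of T- and X-vertices, in the turning and birth rates, and in the uniform choice
  of a new colour among k - 1 or k - 2 colours balance exactly. A primary edge pays its activity
  once, at its first site; hence a turning or splitting particle pays only for the line it joins.
  The factor that remains is the probability that no birth is attempted at the site; the Gibbs
  weight divides it out exactly at the nodes that the graph meets, where a birth attempt is void or
  has succeeded. The obstacles are geometric: sites may be simultaneous, so all laws must depend on
  strictly earlier data only, and a line may enter at the left-most point, where two cells have
  their left-most point and only one of them is initial.\<close>

lemma line_form:
  fixes l :: "point set"
  assumes "affine l" "aff_dim l = 1" "\<And>p q. p \<in> l \<Longrightarrow> q \<in> l \<Longrightarrow> p \<noteq> q \<Longrightarrow> fst p \<noteq> fst q"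
  shows "\<exists>a b. l = {p. snd p = a * fst p + b}"
proof -
  have "aff_dim l = DIM(point) - 1" using assms(2) by simp
  then obtain n c where n: "n \<noteq> 0" and "affine hull l = {x. n \<bullet> x = c}"
    using aff_dim_eq_hyperplane by blast
  then have l: "l = {x. n \<bullet> x = c}" using assms(1) by (simp add: hull_same)
  obtain n1 n2 where n12: "n = (n1, n2)" by (cases n)
  have "n2 \<noteq> 0"
  proof
    assume "n2 = 0"
    then have "n1 \<noteq> 0" using n n12 by (auto simp: zero_prod_def)
    then have "(c / n1, 0) \<in> l" "(c / n1, 1) \<in> l" using \<open>n2 = 0\<close> n12 l by auto
    then show False using assms(3) by fastforce
  qed
  then have "l = {p. snd p = (- n1 / n2) * fst p + c / n2}"
    unfolding l n12 by (auto simp: field_simps inner_prod_def)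
  then show ?thesis by blast
qed

definition slope :: "point set \<Rightarrow> real" where
  "slope l = (SOME a. \<exists>b. l = {p. snd p = a * fst p + b})"

definition icpt :: "point set \<Rightarrow> real" where
  "icpt l = (SOME b. l = {p. snd p = slope l * fst p + b})"

text \<open>The signed vertical distance of a point from the line: positive above, 0 on it, negative
  below. It is affine in the point, which is what makes all later sign computations linear.\<close>

definition hgt :: "point set \<Rightarrow> point \<Rightarrow> real" where
  "hgt l p = snd p - slope l * fst p - icpt l"

lemma hgt_add: "hgt l (p + \<theta> *\<^sub>R w) = hgt l p + \<theta> * (snd w - slope l * fst w)"
  by (simp add: hgt_def algebra_simps)

lemma hgt_toward: "hgt l (p + \<theta> *\<^sub>R (q - p)) = (1 - \<theta>) * hgt l p + \<theta> * hgt l q"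
  by (simp add: hgt_def algebra_simps)

lemma continuous_hgt: "continuous_on S (hgt l)"
  unfolding hgt_def by (intro continuous_intros)

lemma hgt_convex_comb:
  "u + w = 1 \<Longrightarrow> hgt l (u *\<^sub>R p + w *\<^sub>R q) = u * hgt l p + w * hgt l q"
proof -
  assume "u + w = 1"
  then have "icpt l = u * icpt l + w * icpt l" by (simp flip: distrib_right)
  then show ?thesis by (simp add: hgt_def algebra_simps)
qed

text \<open>Each of the three sign classes of the reals is convex; this is what makes faces
  convex.\<close>

lemma sgn_convex_comb:
  fixes a b :: real
  assumes "sgn a = s" "sgn b = s" "0 \<le> u" "0 \<le> w" "u + w = 1"
  shows "sgn (u * a + w * b) = s"
proof -
  have pos: "u * x + w * y > 0" if "x > 0" "y > 0" for x y :: real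
  proof (cases "u = 0")
    case False
    then have "u * x > 0" "w * y \<ge> 0" using that assms by auto
    then show ?thesis by linarith
  qed (use that assms in auto)
  consider "a > 0" "b > 0" "s = 1" | "a = 0" "b = 0" "s = 0" | "a < 0" "b < 0" "s = -1"
    using assms(1,2) by (auto simp: sgn_if split: if_splits)
  then show ?thesis
  proof cases
    case 1
    then show ?thesis using pos[of a b] by simp
  next
    case 3
    then show ?thesis using pos[of "- a" "- b"] by simp
  qed simp
qed

text \<open>The intermediate value theorem; it confines a connected component to one sign
  class.\<close>

lemma connected_sgn_const:
  fixes f :: "'a::topological_space \<Rightarrow> real"
  assumes "connected S" "continuous_on S f" "\<And>x. x \<in> S \<Longrightarrow> f x \<noteq> 0" "x \<in> S" "y \<in> S"
  shows "sgn (f x) = sgn (f y)"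
proof -
  have c: "connected (f ` S)" using assms connected_continuous_image by blast
  have *: False if "a \<in> S" "b \<in> S" "f a < 0" "f b > 0" for a b
  proof -
    have "0 \<in> f ` S" using connectedD_interval[OF c, of "f a" "f b" 0] that by auto
    then show False using assms(3) by auto
  qed
  show ?thesis using *[of x y] *[of y x] assms(3)[of x] assms(3)[of y] assms(4,5)
    by (cases "f x > 0"; cases "f y > 0") (auto simp: sgn_if)
qed

locale tessellated_window =
  fixes T :: "point set set" and D :: "point set"
  assumes tess: "regular_tessellation T" and win: "window T D" and nospat: "no_spatial_direction T D"
begin

text \<open>Unlike \<open>T\<close> this family is always finite, since \<open>D\<close> is bounded.
  Sign vectors range over it, so that all the open conditions on them can be met at once by a small
  step.\<close>

definition L :: "point set set" where "L = {l \<in> T. l \<inter> D \<noteq> {}}"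

lemma D_props: "bounded D" "open D" "convex D" "D \<noteq> {}" "nodes T \<inter> frontier D = {}"
  using win unfolding window_def by blast+

lemmas T_affine = tess[unfolded regular_tessellation_def, THEN conjunct2, THEN conjunct1]
  and T_three = tess[unfolded regular_tessellation_def, THEN conjunct2, THEN conjunct2, THEN conjunct1]
  and T_loc_fin = tess[unfolded regular_tessellation_def, THEN conjunct2, THEN conjunct2, THEN conjunct2]
  and T_not_vertical = nospat[unfolded no_spatial_direction_def, THEN conjunct1]
  and frontier_not_vertical = nospat[unfolded no_spatial_direction_def, THEN conjunct2]

lemma line_inj: "l \<in> T \<Longrightarrow> p \<in> l \<Longrightarrow> q \<in> l \<Longrightarrow> fst p = fst q \<Longrightarrow> p = q"
  using T_not_vertical by metis

lemma line_eq: assumes "l \<in> T" shows "l = {p. hgt l p = 0}"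
proof -
  have "\<exists>a b. l = {p. snd p = a * fst p + b}"
  proof (rule line_form)
    show "affine l" "aff_dim l = 1" using T_affine assms by simp_all
    show "fst p \<noteq> fst q" if "p \<in> l" "q \<in> l" "p \<noteq> q" for p q
      using line_inj[OF assms that(1,2)] that(3) by blast
  qed
  then have "\<exists>b. l = {p. snd p = slope l * fst p + b}"
    unfolding slope_def by (rule someI_ex)
  then have "l = {p. snd p = slope l * fst p + icpt l}"
    unfolding icpt_def by (rule someI_ex)
  also have "\<dots> = {p. hgt l p = 0}" unfolding hgt_def by (auto simp: algebra_simps)
  finally show ?thesis .
qed

lemma on_line: "l \<in> T \<Longrightarrow> p \<in> l \<longleftrightarrow> hgt l p = 0"
  using line_eq by blast

lemma L_sub: "L \<subseteq> T" and L_fin: "finite L"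
  using T_loc_fin D_props(1) unfolding L_def by auto

lemma in_L: "l \<in> T \<Longrightarrow> p \<in> l \<Longrightarrow> p \<in> D \<Longrightarrow> l \<in> L"
  unfolding L_def by blast

lemma slope_eqD:
  assumes "l \<in> T" "m \<in> T" "v \<in> l" "v \<in> m" "slope l = slope m" shows "l = m"
proof -
  have "icpt l = icpt m" using assms on_line unfolding hgt_def by auto
  then have "hgt l = hgt m" using assms unfolding hgt_def by auto
  then show ?thesis using line_eq assms by metis
qed

lemma meet_unique:
  assumes "l \<in> T" "m \<in> T" "l \<noteq> m" "p \<in> l" "p \<in> m" "q \<in> l" "q \<in> m" shows "p = q"
proof -
  have s: "slope l \<noteq> slope m" using slope_eqD assms by blast
  have "snd p = slope l * fst p + icpt l" "snd p = slope m * fst p + icpt m"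
    "snd q = slope l * fst q + icpt l" "snd q = slope m * fst q + icpt m"
    using assms on_line unfolding hgt_def by auto
  then have "(slope l - slope m) * (fst p - fst q) = 0" by (simp add: algebra_simps)
  then have "fst p = fst q" using s by simp
  then show ?thesis using line_inj assms by blast
qed

lemma node_lines:
  assumes "l \<in> T" "m \<in> T" "l \<noteq> m" "v \<in> l" "v \<in> m" "j \<in> T" "v \<in> j"
  shows "j = l \<or> j = m"
  using T_three[rule_format, of l m j] assms by blast

lemma nodesI: "l \<in> T \<Longrightarrow> m \<in> T \<Longrightarrow> l \<noteq> m \<Longrightarrow> v \<in> l \<Longrightarrow> v \<in> m \<Longrightarrow> v \<in> nodes T"
  unfolding nodes_def by blast

lemma closure_D_cases: "p \<in> closure D \<Longrightarrow> p \<in> D \<or> p \<in> frontier D"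
  using D_props by (auto simp: frontier_def interior_open)

lemma frontier_not_D: "p \<in> frontier D \<Longrightarrow> p \<notin> D"
  using D_props by (auto simp: frontier_def interior_open)

text \<open>Lets frontier points be left towards the inside, so that boundary sites can be treated
  by the same local analysis as nodes.\<close>

lemma closure_seg_D:
  assumes "p \<in> closure D" "q \<in> D" "0 < \<theta>" "\<theta> \<le> 1"
  shows "p + \<theta> *\<^sub>R (q - p) \<in> D"
proof (cases "p = q")
  case False
  have "p - \<theta> *\<^sub>R (p - q) \<in> interior D"
    by (rule mem_interior_closure_convex_shrink) (use assms D_props in \<open>auto simp: interior_open\<close>)
  then show ?thesis using D_props by (simp add: interior_open algebra_simps)
qed (use assms in auto)

text \<open>One notion for all strata of the arrangement: a face with no zero sign is a cell, with
  exactly one zero a segment, with two zeros a node.\<close>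

definition face :: "point \<Rightarrow> point set" where
  "face p = {q \<in> D. \<forall>m\<in>L. sgn (hgt m q) = sgn (hgt m p)}"

lemma face_self: "p \<in> D \<Longrightarrow> p \<in> face p"
  by (simp add: face_def)

lemma face_sub: "face p \<subseteq> D"
  by (auto simp: face_def)

lemma face_eq: "q \<in> face p \<Longrightarrow> face q = face p"
  unfolding face_def by auto

lemma convex_face: "convex (face p)"
proof (rule convexI)
  fix x y :: point and u w :: real
  assume a: "x \<in> face p" "y \<in> face p" "0 \<le> u" "0 \<le> w" "u + w = 1"
  then have "u *\<^sub>R x + w *\<^sub>R y \<in> D"
    using D_props(3) face_sub by (meson convexD subsetD)
  moreover have "sgn (hgt m (u *\<^sub>R x + w *\<^sub>R y)) = sgn (hgt m p)" if "m \<in> L" for m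
    unfolding hgt_convex_comb[OF a(5)]
    by (rule sgn_convex_comb) (use a that in \<open>auto simp: face_def\<close>)
  ultimately show "u *\<^sub>R x + w *\<^sub>R y \<in> face p" by (simp add: face_def)
qed

text \<open>On the way from \<open>q\<close> to \<open>p\<close> a sign that is 0 at
  \<open>q\<close> takes the value at \<open>p\<close> at once, and an agreeing sign persists. So
  the step need not be small.\<close>

lemma face_toward:
  assumes "p \<in> D" "q \<in> closure D" "\<And>m. m \<in> L \<Longrightarrow> hgt m q = 0 \<or> sgn (hgt m q) = sgn (hgt m p)"
    "0 < \<theta>" "\<theta> \<le> 1"
  shows "q + \<theta> *\<^sub>R (p - q) \<in> face p"
proof -
  have "sgn (hgt m (q + \<theta> *\<^sub>R (p - q))) = sgn (hgt m p)" if "m \<in> L" for m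
  proof (cases "hgt m q = 0")
    case True
    then show ?thesis using assms(4) by (simp add: hgt_toward sgn_mult)
  next
    case False
    then show ?thesis unfolding hgt_toward
      by (intro sgn_convex_comb) (use assms that in auto)
  qed
  then show ?thesis using closure_seg_D assms by (simp add: face_def)
qed

lemma closed_sgn: "closed {q. hgt m q = 0 \<or> sgn (hgt m q) = sgn (x::real)}"
proof -
  have *: "{q. hgt m q = 0 \<or> sgn (hgt m q) = sgn x} =
    (if x > 0 then {q. 0 \<le> hgt m q} else if x < 0 then {q. hgt m q \<le> 0} else {q. hgt m q = 0})"
    by (auto simp: sgn_if)
  have c: "continuous_on UNIV (hgt m)" by (rule continuous_hgt)
  show ?thesis unfolding *
    by (auto intro!: closed_Collect_le closed_Collect_eq c continuous_on_const)
qed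

lemma tendsto_move: "((\<lambda>\<theta>. p + \<theta> *\<^sub>R w) \<longlongrightarrow> (p::point)) (at_right 0)"
  by (rule tendsto_eq_intros refl tendsto_ident_at | simp)+

text \<open>Passing to the closure lets signs vanish but not flip. Conversely, a point whose signs
  agree with those of \<open>p\<close> up to vanishing is approached from inside the face along the
  straight line to \<open>p\<close>.\<close>

lemma closure_face:
  assumes "p \<in> D"
  shows "closure (face p) = {q \<in> closure D. \<forall>m\<in>L. hgt m q = 0 \<or> sgn (hgt m q) = sgn (hgt m p)}"
    (is "_ = ?R")
proof
  have "?R = closure D \<inter> (\<Inter>m\<in>L. {q. hgt m q = 0 \<or> sgn (hgt m q) = sgn (hgt m p)})" by auto
  then have "closed ?R" using closed_sgn by (simp add: closed_INT closed_Int)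
  moreover have "face p \<subseteq> ?R" using closure_subset by (auto simp: face_def)
  ultimately show "closure (face p) \<subseteq> ?R" by (rule closure_minimal[rotated])
  show "?R \<subseteq> closure (face p)"
  proof
    fix q assume q: "q \<in> ?R"
    have "\<forall>\<^sub>F \<theta> in at_right 0. q + \<theta> *\<^sub>R (p - q) \<in> closure (face p)"
      using eventually_at_right_less[of "0::real"] eventually_at_rightI[of 0 1 "\<lambda>\<theta>::real. \<theta> < 1", simplified]
    proof eventually_elim
      case (elim \<theta>)
      then have "q + \<theta> *\<^sub>R (p - q) \<in> face p" using q assms by (intro face_toward) auto
      then show ?case using closure_subset by blast
    qed
    then show "q \<in> closure (face p)"
      by (rule Lim_in_closed_set[OF closed_closure _ trivial_limit_at_right_real tendsto_move])
  qed
qed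

text \<open>Treats cells and segments together: \<open>X\<close> is the window without the lines, or
  a line in the window without the nodes. The face is connected because it is convex; a connected
  part of \<open>X\<close> cannot leave it, since a height that is nonzero at \<open>p\<close> has
  no zero on \<open>X\<close>.\<close>

lemma component_face:
  assumes p: "p \<in> X" and sub: "face p \<subseteq> X" "X \<subseteq> D"
    and nz: "\<And>m q. m \<in> L \<Longrightarrow> hgt m p \<noteq> 0 \<Longrightarrow> q \<in> X \<Longrightarrow> hgt m q \<noteq> 0"
    and z: "\<And>m q. m \<in> L \<Longrightarrow> hgt m p = 0 \<Longrightarrow> q \<in> X \<Longrightarrow> hgt m q = 0"
  shows "connected_component_set X p = face p"
proof
  show "face p \<subseteq> connected_component_set X p"
    using p sub face_self[of p] by (intro connected_component_maximal convex_connected convex_face) blast+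
  show "connected_component_set X p \<subseteq> face p"
  proof
    fix q assume q: "q \<in> connected_component_set X p"
    let ?K = "connected_component_set X p"
    have K: "?K \<subseteq> X" by (rule connected_component_subset)
    have "sgn (hgt m q) = sgn (hgt m p)" if "m \<in> L" for m
    proof (cases "hgt m p = 0")
      case True
      then show ?thesis using z[OF that True, of q] q K by auto
    next
      case False
      show ?thesis
        by (rule connected_sgn_const[of ?K])
          (use nz[OF that False] q K p continuous_hgt in \<open>auto simp: connected_component_refl\<close>)
    qed
    then show "q \<in> face p" using q K sub by (auto simp: face_def)
  qed
qed

lemma on_L: "l \<in> L \<Longrightarrow> p \<in> l \<longleftrightarrow> hgt l p = 0"
  using on_line L_sub by blast

lemma D_minus_lines: "D - \<Union>T = {p \<in> D. \<forall>m\<in>L. hgt m p \<noteq> 0}"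
proof (intro set_eqI iffI)
  fix p assume "p \<in> D - \<Union>T"
  then show "p \<in> {p \<in> D. \<forall>m\<in>L. hgt m p \<noteq> 0}" using on_L L_sub by blast
next
  fix p assume "p \<in> {p \<in> D. \<forall>m\<in>L. hgt m p \<noteq> 0}"
  then show "p \<in> D - \<Union>T" using on_L in_L by blast
qed

lemma face_zero_iff: "q \<in> face p \<Longrightarrow> m \<in> L \<Longrightarrow> hgt m q = 0 \<longleftrightarrow> hgt m p = 0"
proof -
  assume "q \<in> face p" "m \<in> L"
  then have "sgn (hgt m q) = sgn (hgt m p)" unfolding face_def by simp
  then show ?thesis by (metis sgn_zero_iff)
qed

lemma cells_eq: "cells T D = {face p | p. p \<in> D \<and> (\<forall>m\<in>L. hgt m p \<noteq> 0)}"
proof -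
  have c: "connected_component_set (D - \<Union>T) p = face p" if "p \<in> D - \<Union>T" for p
  proof (rule component_face[OF that])
    show "face p \<subseteq> D - \<Union>T"
      using that face_zero_iff[of _ p] face_sub[of p] unfolding D_minus_lines by blast
  qed (use that in \<open>auto simp: D_minus_lines\<close>)
  have "cells T D = face ` (D - \<Union>T)"
    unfolding cells_def components_def using c by (intro image_cong) auto
  then show ?thesis unfolding D_minus_lines by auto
qed

definition zeros :: "point \<Rightarrow> point set set" where "zeros p = {m \<in> L. hgt m p = 0}"

lemma zeros_face: "q \<in> face p \<Longrightarrow> zeros q = zeros p"
  using face_zero_iff unfolding zeros_def by blast

lemma zeros_eq: "p \<in> D \<Longrightarrow> zeros p = {l \<in> T. p \<in> l}"
  unfolding zeros_def using on_L in_L L_sub by blast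

text \<open>Inside the window \<open>zeros\<close> lists every line of the tessellation through the
  point, so a point of \<open>l\<close> is off the nodes exactly if the list contains nothing
  else.\<close>

lemma line_minus_nodes:
  assumes "l \<in> T" shows "l \<inter> D - nodes T = {p \<in> D. zeros p = {l}}"
proof -
  have "p \<in> nodes T \<longleftrightarrow> (\<exists>m\<in>T. m \<noteq> l \<and> p \<in> m)" if "p \<in> l" for p
    using that assms unfolding nodes_def by auto
  then have e: "p \<in> l \<inter> D - nodes T \<longleftrightarrow> p \<in> D \<and> {m \<in> T. p \<in> m} = {l}" for p
    using assms by blast
  have "p \<in> l \<inter> D - nodes T \<longleftrightarrow> p \<in> {p \<in> D. zeros p = {l}}" for p
    using e[of p] zeros_eq[of p] by (cases "p \<in> D") simp_all
  then show ?thesis by (rule set_eqI)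
qed

lemma segments_eq: "segments T D = {face p | p l. p \<in> D \<and> zeros p = {l}}"
proof -
  have c: "connected_component_set (l \<inter> D - nodes T) p = face p" if "l \<in> T" "p \<in> D" "zeros p = {l}" for p l
  proof (rule component_face)
    show "p \<in> l \<inter> D - nodes T" unfolding line_minus_nodes[OF that(1)] using that by simp
    show "face p \<subseteq> l \<inter> D - nodes T" 
    proof
      fix q assume "q \<in> face p"
      then have "q \<in> D" "zeros q = {l}" using face_sub zeros_face that by blast+
      then show "q \<in> l \<inter> D - nodes T" unfolding line_minus_nodes[OF that(1)] by simp
    qed
    show "l \<inter> D - nodes T \<subseteq> D" by blast
    show "hgt m q \<noteq> 0" if "m \<in> L" "hgt m p \<noteq> 0" "q \<in> l \<inter> D - nodes T" for m q
      using that line_minus_nodes[OF \<open>l \<in> T\<close>] \<open>zeros p = {l}\<close> unfolding zeros_def by auto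
    show "hgt m q = 0" if "m \<in> L" "hgt m p = 0" "q \<in> l \<inter> D - nodes T" for m q
      using that line_minus_nodes[OF \<open>l \<in> T\<close>] \<open>zeros p = {l}\<close> unfolding zeros_def by auto
  qed
  have "components (l \<inter> D - nodes T) = face ` {p \<in> D. zeros p = {l}}" if "l \<in> T" for l
    unfolding components_def line_minus_nodes[OF that] 
    using c[OF that, unfolded line_minus_nodes[OF that]] by (intro image_cong) auto
  then have e: "segments T D = (\<Union>l\<in>T. face ` {p \<in> D. zeros p = {l}})"
    unfolding segments_def by simp
  show ?thesis
  proof (rule set_eqI)
    fix s
    have "l \<in> T" if "zeros p = {l}" for p l
      using that L_sub unfolding zeros_def by blast
    then show "s \<in> segments T D \<longleftrightarrow> s \<in> {face p | p l. p \<in> D \<and> zeros p = {l}}"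
      unfolding e UN_iff image_iff mem_Collect_eq bex_simps Bex_def by metis
  qed
qed

end

lemma leftmostI:
  "p \<in> closure S \<Longrightarrow> (\<And>q. q \<in> closure S \<Longrightarrow> q \<noteq> p \<Longrightarrow> fst p < fst q) \<Longrightarrow> leftmost S = p"
  unfolding leftmost_def by (rule the_equality) (metis less_le not_le)+

lemma closure_fst_ge:
  assumes "\<And>q. q \<in> S \<Longrightarrow> a \<le> fst q" "q \<in> closure S" shows "a \<le> fst (q :: point)"
proof -
  have "closed {q::point. a \<le> fst q}" by (intro closed_Collect_le continuous_intros)
  moreover have "S \<subseteq> {q. a \<le> fst q}" using assms(1) by blast
  ultimately show ?thesis using closure_minimal assms(2) by blast
qed

section \<open>Small displacements, faces around a point, and left-most points\<close>

context tessellated_window begin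

lemma sgn_stable:
  assumes "hgt m p \<noteq> 0"
  shows "\<forall>\<^sub>F \<theta> in at_right 0. sgn (hgt m (p + \<theta> *\<^sub>R w)) = sgn (hgt m p)"
proof -
  have t: "((\<lambda>\<theta>. hgt m (p + \<theta> *\<^sub>R w)) \<longlongrightarrow> hgt m p) (at_right 0)"
    unfolding hgt_add by (rule tendsto_eq_intros refl tendsto_ident_at | simp)+
  show ?thesis
  proof (cases "hgt m p > 0")
    case True
    with order_tendstoD(1)[OF t this] show ?thesis by (auto elim: eventually_mono)
  next
    case False
    with assms have "hgt m p < 0" by simp
    with order_tendstoD(2)[OF t this] show ?thesis by (auto elim: eventually_mono)
  qed
qed

lemma stay_D: "p \<in> D \<Longrightarrow> \<forall>\<^sub>F \<theta> in at_right 0. p + \<theta> *\<^sub>R w \<in> D"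
  using topological_tendstoD[OF tendsto_move D_props(2)] by blast

lemma toward_D: 
  assumes "p \<in> closure D" "q \<in> D" shows "\<forall>\<^sub>F \<theta> in at_right 0. p + \<theta> *\<^sub>R (q - p) \<in> D"
  using eventually_at_right_less[of "0::real"] eventually_at_rightI[of 0 1 "\<lambda>\<theta>::real. \<theta> < 1", simplified]
  by eventually_elim (use closure_seg_D assms in auto)

text \<open>A sufficiently short step keeps the finitely many nonzero signs; on a line through
  \<open>p\<close> the new sign depends only on whether the direction is steeper or flatter than the
  line.\<close>

lemma move:
  assumes "\<forall>\<^sub>F \<theta> in at_right 0. p + \<theta> *\<^sub>R w \<in> D"
  obtains \<theta> where "0 < \<theta>" "\<theta> < 1" "p + \<theta> *\<^sub>R w \<in> D"
    "\<And>m. m \<in> L \<Longrightarrow> sgn (hgt m (p + \<theta> *\<^sub>R w)) =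
       (if hgt m p = 0 then sgn (snd w - slope m * fst w) else sgn (hgt m p))"
proof -
  have "\<forall>\<^sub>F \<theta> in at_right 0. \<forall>m\<in>{m\<in>L. hgt m p \<noteq> 0}. sgn (hgt m (p + \<theta> *\<^sub>R w)) = sgn (hgt m p)"
    by (rule eventually_ball_finite) (use L_fin sgn_stable in auto)
  then have "\<forall>\<^sub>F \<theta> in at_right 0. 0 < \<theta> \<and> \<theta> < 1 \<and> p + \<theta> *\<^sub>R w \<in> D \<and>
      (\<forall>m\<in>{m\<in>L. hgt m p \<noteq> 0}. sgn (hgt m (p + \<theta> *\<^sub>R w)) = sgn (hgt m p))"
    using assms eventually_at_right_less[of "0::real"]
      eventually_at_rightI[of 0 1 "\<lambda>\<theta>::real. \<theta> < 1", simplified]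
    by eventually_elim auto
  then obtain \<theta> where "0 < \<theta>" "\<theta> < 1" "p + \<theta> *\<^sub>R w \<in> D"
      "\<forall>m\<in>{m\<in>L. hgt m p \<noteq> 0}. sgn (hgt m (p + \<theta> *\<^sub>R w)) = sgn (hgt m p)"
    using eventually_happens'[OF trivial_limit_at_right_real] by blast
  then show thesis by (intro that[of \<theta>]) (auto simp: hgt_add sgn_mult)
qed

text \<open>The face near \<open>v\<close> on which the lines through \<open>v\<close> have the signs \<open>\<rho>\<close>; it may be empty.\<close>

definition locface :: "point \<Rightarrow> (point set \<Rightarrow> real) \<Rightarrow> point set" where
  "locface v \<rho> = {q \<in> D. \<forall>m\<in>L. sgn (hgt m q) = (if hgt m v = 0 then \<rho> m else sgn (hgt m v))}"

lemma locface_face: "q \<in> locface v \<rho> \<Longrightarrow> locface v \<rho> = face q"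
  unfolding locface_def face_def by auto

lemma locfaceD: "q \<in> locface v \<rho> \<Longrightarrow> m \<in> L \<Longrightarrow> hgt m v = 0 \<Longrightarrow> sgn (hgt m q) = \<rho> m"
  unfolding locface_def by auto

lemma locface_D: "q \<in> locface v \<rho> \<Longrightarrow> q \<in> D"
  unfolding locface_def by auto

lemma locface_cong:
  "(\<And>m. m \<in> L \<Longrightarrow> hgt m v = 0 \<Longrightarrow> \<rho> m = \<rho>' m) \<Longrightarrow> locface v \<rho> = locface v \<rho>'"
  unfolding locface_def by auto

lemma locface_nonempty:
  assumes "\<forall>\<^sub>F \<theta> in at_right 0. v + \<theta> *\<^sub>R w \<in> D"
    "\<And>m. m \<in> L \<Longrightarrow> hgt m v = 0 \<Longrightarrow> sgn (snd w - slope m * fst w) = \<rho> m"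
  shows "\<exists>q. q \<in> locface v \<rho>"
proof -
  obtain \<theta> where "v + \<theta> *\<^sub>R w \<in> D"
    "\<And>m. m \<in> L \<Longrightarrow> sgn (hgt m (v + \<theta> *\<^sub>R w)) =
       (if hgt m v = 0 then sgn (snd w - slope m * fst w) else sgn (hgt m v))"
    using move[OF assms(1)] by metis
  then have "v + \<theta> *\<^sub>R w \<in> locface v \<rho>"
    using assms(2) unfolding locface_def by auto
  then show ?thesis by blast
qed

text \<open>Reduces incidence at \<open>v\<close> to finite combinatorics: the faces that touch
  \<open>v\<close> are exactly the local faces, and these are told apart by the signs for the lines
  through \<open>v\<close>.\<close>

lemma in_closure_face_iff:
  assumes "q \<in> D" "v \<in> closure D"
  shows "v \<in> closure (face q) \<longleftrightarrow> face q = locface v (\<lambda>m. sgn (hgt m q))"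
proof
  assume "v \<in> closure (face q)"
  then have "\<forall>m\<in>L. hgt m v = 0 \<or> sgn (hgt m v) = sgn (hgt m q)"
    using closure_face assms by blast
  then have "q \<in> locface v (\<lambda>m. sgn (hgt m q))"
    unfolding locface_def using assms by auto
  then show "face q = locface v (\<lambda>m. sgn (hgt m q))" using locface_face by blast
next
  assume "face q = locface v (\<lambda>m. sgn (hgt m q))"
  then have "q \<in> locface v (\<lambda>m. sgn (hgt m q))" using assms face_self by blast
  then have h: "sgn (hgt m q) = (if hgt m v = 0 then sgn (hgt m q) else sgn (hgt m v))" if "m \<in> L" for m
    using that unfolding locface_def by simp
  have "hgt m v = 0 \<or> sgn (hgt m v) = sgn (hgt m q)" if "m \<in> L" for m
    using h[OF that] by (auto split: if_splits)
  then show "v \<in> closure (face q)" unfolding closure_face[OF assms(1)] using assms(2) by simp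
qed

text \<open>Incidence between two faces at the same point: one borders the other exactly if its sign
  pattern arises by replacing signs with 0.\<close>

lemma in_closure_locface:
  assumes "q \<in> locface v \<rho>'" "r \<in> locface v \<rho>"
  shows "q \<in> closure (locface v \<rho>) \<longleftrightarrow> (\<forall>m\<in>L. hgt m v = 0 \<longrightarrow> \<rho>' m = 0 \<or> \<rho>' m = \<rho> m)"
proof -
  have D: "q \<in> D" "r \<in> D" using assms locface_D by blast+
  then have "q \<in> closure D" using closure_subset by blast
  have "q \<in> closure (locface v \<rho>) \<longleftrightarrow> (\<forall>m\<in>L. hgt m q = 0 \<or> sgn (hgt m q) = sgn (hgt m r))"
    unfolding locface_face[OF assms(2)] closure_face[OF D(2)] using \<open>q \<in> closure D\<close> by blast
  also have "\<dots> \<longleftrightarrow> (\<forall>m\<in>L. sgn (hgt m q) = 0 \<or> sgn (hgt m q) = sgn (hgt m r))"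
    by (simp add: sgn_zero_iff)
  also have "\<dots> \<longleftrightarrow> (\<forall>m\<in>L. hgt m v = 0 \<longrightarrow> \<rho>' m = 0 \<or> \<rho>' m = \<rho> m)"
    using assms unfolding locface_def by auto
  finally show ?thesis .
qed

lemma v_in_closure_locface:
  assumes "v \<in> closure D" "r \<in> locface v \<rho>" shows "v \<in> closure (locface v \<rho>)"
proof -
  have "r \<in> D" using assms locface_D by blast
  then show ?thesis unfolding locface_face[OF assms(2)] closure_face[OF \<open>r \<in> D\<close>]
    using assms unfolding locface_def by auto
qed

lemma face_in_cells: "q \<in> D \<Longrightarrow> zeros q = {} \<Longrightarrow> face q \<in> cells T D"
  unfolding cells_eq zeros_def by blast

lemma cellE:
  assumes "C \<in> cells T D"
  obtains q where "q \<in> C" "q \<in> D" "C = face q" "\<And>m. m \<in> L \<Longrightarrow> hgt m q \<noteq> 0"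
  using assms face_self unfolding cells_eq by blast

lemma cell_face: "C \<in> cells T D \<Longrightarrow> q \<in> C \<Longrightarrow> C = face q"
  using face_eq unfolding cells_eq by blast

lemma cell_sub: "C \<in> cells T D \<Longrightarrow> C \<subseteq> D"
  using face_sub unfolding cells_eq by blast

lemma cell_disjoint: "C \<in> cells T D \<Longrightarrow> C' \<in> cells T D \<Longrightarrow> q \<in> C \<Longrightarrow> q \<in> C' \<Longrightarrow> C = C'"
  using cell_face by metis

lemma open_cell: assumes "C \<in> cells T D" shows "open C"
proof -
  have e: "D - \<Union>T = D \<inter> (\<Inter>m\<in>L. {p. hgt m p \<noteq> 0})" unfolding D_minus_lines by auto
  have "open {p. hgt m p \<noteq> 0}" for m
    by (intro open_Collect_neq continuous_hgt continuous_on_const)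
  then have "open (D - \<Union>T)" unfolding e using D_props(2) L_fin by (intro open_Int open_INT) auto
  then show ?thesis using assms open_components unfolding cells_def by blast
qed

lemma convex_cell: "C \<in> cells T D \<Longrightarrow> convex C"
  using convex_face by (metis cellE)

lemma cell_closure_mem:
  assumes "C \<in> cells T D" "p \<in> closure C" "p \<in> D" "zeros p = {}" shows "p \<in> C"
proof -
  obtain q where q: "q \<in> C" "q \<in> D" "C = face q" using cellE assms(1) by metis
  then have "\<forall>m\<in>L. hgt m p = 0 \<or> sgn (hgt m p) = sgn (hgt m q)"
    using assms(2) closure_face by blast
  then show ?thesis using q assms(3,4) unfolding zeros_def face_def by blast
qed

lemma open_left:
  assumes "open X" "p \<in> (X :: point set)" shows "\<exists>q\<in>X. fst q < fst p"
proof -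
  have "\<forall>\<^sub>F \<theta> in at_right 0. p + \<theta> *\<^sub>R (-1, 0) \<in> X"
    using topological_tendstoD[OF tendsto_move assms] by blast
  with eventually_at_right_less[of "0::real"]
  have "\<forall>\<^sub>F \<theta> in at_right 0. 0 < \<theta> \<and> p + \<theta> *\<^sub>R (-1, 0) \<in> X"
    by eventually_elim auto
  then obtain \<theta> where "0 < \<theta>" "p + \<theta> *\<^sub>R (-1, 0) \<in> X"
    using eventually_happens'[OF trivial_limit_at_right_real] by blast
  then show ?thesis by (intro bexI[of _ "p + \<theta> *\<^sub>R (-1, 0)"]) auto
qed

text \<open>Compactness gives an earliest point; the work is in its uniqueness, for which neither
  the lines nor the frontier may contain vertical pieces. The closure condition \<open>cl\<close>
  holds both for the window and for a cell, so both are covered.\<close>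

lemma leftmost_exists:
  assumes X: "X \<subseteq> D" "open X" "convex X" "X \<noteq> {}"
    and cl: "\<And>p. p \<in> closure X \<Longrightarrow> p \<in> D \<Longrightarrow> zeros p = {} \<Longrightarrow> p \<in> X"
  shows "leftmost X \<in> closure X" "\<And>q. q \<in> closure X \<Longrightarrow> q \<noteq> leftmost X \<Longrightarrow> fst (leftmost X) < fst q"
proof -
  have "compact (closure X)" using X(1) D_props(1) bounded_subset compact_closure by blast
  moreover have "continuous_on (closure X) (fst :: point \<Rightarrow> real)" by (intro continuous_intros)
  ultimately obtain p where p: "p \<in> closure X" "\<And>q. q \<in> closure X \<Longrightarrow> fst p \<le> fst q"
    using continuous_attains_inf[of "closure X" fst] X(4) by auto
  have uniq: "fst p < fst q" if q: "q \<in> closure X" "q \<noteq> p" for q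
  proof (rule ccontr)
    assume "\<not> fst p < fst q"
    then have fq: "fst q = fst p" using p(2)[OF q(1)] by simp
    \<comment> \<open>Two earliest points would be the ends of a vertical segment in the closure; as
      the frontier contains no such segment, some point of it lies inside the window.\<close>
    then obtain r where r: "r \<in> closed_segment p q" "r \<notin> frontier D"
      using frontier_not_vertical q(2) by (metis subsetI)
    have sub: "closed_segment p q \<subseteq> closure X"
      using closed_segment_subset[OF p(1) q(1)] X(3) by (simp add: convex_closure)
    have "closure X \<subseteq> closure D" using X(1) closure_mono by blast
    then have rD: "r \<in> D" using r sub closure_D_cases by blast
    \<comment> \<open>An end different from \<open>r\<close> gives a vertical direction at
      \<open>r\<close>. No line is vertical, so a short step in it leaves all lines and lands in the
      open set \<open>X\<close>, which then extends further to the left.\<close>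
    obtain e where e: "e \<in> {p, q}" "e \<noteq> r" using q(2) by blast
    have fr: "fst r = fst p"
    proof -
      obtain t where "r = (1 - t) *\<^sub>R p + t *\<^sub>R q" using r(1) unfolding in_segment by blast
      then have "fst r = (1 - t) * fst p + t * fst q" by simp
      then show ?thesis using fq by (simp add: algebra_simps)
    qed
    have fe: "fst (e - r) = 0" using e(1) fr fq by auto
    then have se: "snd (e - r) \<noteq> 0" using e(2) by (auto simp: prod_eq_iff)
    obtain \<theta> where \<theta>: "0 < \<theta>" "\<theta> < 1" "r + \<theta> *\<^sub>R (e - r) \<in> D"
      "\<And>m. m \<in> L \<Longrightarrow> sgn (hgt m (r + \<theta> *\<^sub>R (e - r))) =
       (if hgt m r = 0 then sgn (snd (e - r) - slope m * fst (e - r)) else sgn (hgt m r))"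
      using move[OF stay_D[OF rD]] by metis
    let ?r = "r + \<theta> *\<^sub>R (e - r)"
    have "hgt m ?r \<noteq> 0" if "m \<in> L" for m
    proof -
      have "sgn (hgt m ?r) \<noteq> 0" using \<theta>(4)[OF that] se unfolding fe by (simp add: sgn_zero_iff split: if_splits)
      then show ?thesis by auto
    qed
    then have z: "zeros ?r = {}" unfolding zeros_def by blast
    have "e \<in> closed_segment p q" using e(1) by auto
    then have "closed_segment r e \<subseteq> closed_segment p q" using r(1) by (simp add: subset_closed_segment)
    moreover have "?r \<in> closed_segment r e"
      unfolding in_segment using \<theta> by (intro exI[of _ \<theta>]) (auto simp: algebra_simps)
    ultimately have "?r \<in> closure X" using sub by blast
    then have "?r \<in> X" using cl \<theta>(3) z by blast
    then obtain x where "x \<in> X" "fst x < fst ?r" using open_left X(2) by blast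
    moreover have "fst ?r = fst p" using fr fe by auto
    ultimately show False using p(2)[of x] closure_subset by fastforce
  qed
  have "leftmost X = p" using leftmostI[OF p(1)] uniq by blast
  then show "leftmost X \<in> closure X" "\<And>q. q \<in> closure X \<Longrightarrow> q \<noteq> leftmost X \<Longrightarrow> fst (leftmost X) < fst q"
    using p(1) uniq by auto
qed

lemmas leftmost_D = leftmost_exists[OF subset_refl D_props(2,3,4)]

lemma leftmost_cell:
  assumes "C \<in> cells T D"
  shows "leftmost C \<in> closure C" "\<And>q. q \<in> closure C \<Longrightarrow> q \<noteq> leftmost C \<Longrightarrow> fst (leftmost C) < fst q"
proof -
  have "C \<noteq> {}" using assms cellE by blast
  note * = leftmost_exists[OF cell_sub[OF assms] open_cell[OF assms] convex_cell[OF assms] this cell_closure_mem[OF assms]]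
  show "leftmost C \<in> closure C" "\<And>q. q \<in> closure C \<Longrightarrow> q \<noteq> leftmost C \<Longrightarrow> fst (leftmost C) < fst q"
    using * by blast+
qed

lemma closure_cell_sub: "C \<in> cells T D \<Longrightarrow> closure C \<subseteq> closure D"
  using cell_sub closure_mono by blast

lemma leftmost_cell_le: "C \<in> cells T D \<Longrightarrow> q \<in> closure C \<Longrightarrow> fst (leftmost C) \<le> fst q"
  using leftmost_cell(2) by (metis less_imp_le order_refl)

lemma leftmost_cell_lt: "C \<in> cells T D \<Longrightarrow> q \<in> C \<Longrightarrow> fst (leftmost C) < fst q"
  using leftmost_cell_le open_left[OF open_cell] closure_subset by (metis le_less_trans subsetD)

lemma leftmost_cell_eq:
  "C \<in> cells T D \<Longrightarrow> v \<in> closure C \<Longrightarrow> (\<And>q. q \<in> C \<Longrightarrow> fst v \<le> fst q) \<Longrightarrow> leftmost C = v"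
proof (rule ccontr)
  assume a: "C \<in> cells T D" "v \<in> closure C" "\<And>q. q \<in> C \<Longrightarrow> fst v \<le> fst q" "leftmost C \<noteq> v"
  have "fst v \<le> fst (leftmost C)" by (rule closure_fst_ge[OF a(3) leftmost_cell(1)[OF a(1)]])
  then show False using leftmost_cell(2)[OF a(1,2)] a(4) by simp
qed

lemma frontier_single_line:
  "v \<in> frontier D \<Longrightarrow> l \<in> T \<Longrightarrow> m \<in> T \<Longrightarrow> v \<in> l \<Longrightarrow> v \<in> m \<Longrightarrow> l = m"
  using D_props(5) nodesI by blast

lemma initial_cell_in: "initial_cell T D \<in> cells T D \<and> leftmost D \<in> closure (initial_cell T D)"
proof -
  let ?v = "leftmost D"
  have vD: "?v \<in> closure D" using leftmost_D(1) by blast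
  have "?v \<notin> D" using open_left[OF D_props(2)] leftmost_D(2) closure_subset by (metis less_asym less_irrefl subsetD)
  then have vf: "?v \<in> frontier D" using closure_D_cases vD by blast
  \<comment> \<open>The left-most point is on the frontier, hence on at most one line, and a
    vertical shift takes a point of \<open>D\<close> off that line. Heading for such a
    \<open>q\<close> enters a cell at the left-most point.\<close>
  obtain q where q: "q \<in> D" "\<And>m. m \<in> L \<Longrightarrow> hgt m ?v = 0 \<Longrightarrow> hgt m q \<noteq> 0"
  proof (cases "\<exists>m\<in>L. hgt m ?v = 0")
    case False
    then show ?thesis using that D_props(4) by blast
  next
    case True
    then obtain m where m: "m \<in> L" "hgt m ?v = 0" by blast
    obtain d where d: "d \<in> D" using D_props(4) by blast
    obtain \<theta> where "d + \<theta> *\<^sub>R (0, 1) \<in> D" "sgn (hgt m (d + \<theta> *\<^sub>R (0, 1))) =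
       (if hgt m d = 0 then sgn (snd (0::real, 1::real) - slope m * fst (0::real,1::real)) else sgn (hgt m d))"
      using move[OF stay_D[OF d, of "(0,1)"]] m by metis
    then have "d + \<theta> *\<^sub>R (0, 1) \<in> D" "hgt m (d + \<theta> *\<^sub>R (0, 1)) \<noteq> 0"
      by (auto simp: sgn_zero_iff split: if_splits)
    moreover have "j = m" if "j \<in> L" "hgt j ?v = 0" for j
      using frontier_single_line[OF vf] that m on_L L_sub by blast
    ultimately show ?thesis using that by metis
  qed
  have "\<exists>r. r \<in> locface ?v (\<lambda>m. sgn (snd (q - ?v) - slope m * fst (q - ?v)))"
    by (rule locface_nonempty[OF toward_D[OF vD q(1)]]) (rule refl)
  then obtain r where r: "r \<in> locface ?v (\<lambda>m. sgn (snd (q - ?v) - slope m * fst (q - ?v)))" by blast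
  have "hgt m r \<noteq> 0" if "m \<in> L" for m
  proof (cases "hgt m ?v = 0")
    case True
    have "hgt m (?v + 1 *\<^sub>R (q - ?v)) = hgt m ?v + 1 * (snd (q - ?v) - slope m * fst (q - ?v))" by (rule hgt_add)
    then have "snd (q - ?v) - slope m * fst (q - ?v) = hgt m q" using True by simp
    then show ?thesis using locfaceD[OF r that True] q(2)[OF that True] by (metis sgn_zero_iff)
  next
    case False
    then show ?thesis using r that unfolding locface_def by (auto simp: sgn_zero_iff)
  qed
  then have "face r \<in> cells T D" using r locface_D face_in_cells unfolding zeros_def by blast
  moreover have "?v \<in> closure (face r)" using v_in_closure_locface[OF vD r] locface_face[OF r] by simp
  ultimately show ?thesis unfolding initial_cell_def by (intro someI_ex[where P="\<lambda>C. C \<in> cells T D \<and> ?v \<in> closure C"]) blast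
qed

section \<open>The cells and segments at a node\<close>

definition N :: "point set" where "N = nodes T \<inter> D"
definition B :: "point set" where "B = entry_points T D"
definition sites :: "point set" where "sites = N \<union> B"

abbreviation up :: "point \<Rightarrow> point set" where "up \<equiv> upper_line T"
abbreviation lo :: "point \<Rightarrow> point set" where "lo \<equiv> lower_line T"

lemma line_point: "m \<in> T \<Longrightarrow> (t, slope m * t + icpt m) \<in> m"
  unfolding on_line hgt_def by simp

lemma snd_on_line: "m \<in> T \<Longrightarrow> p \<in> m \<Longrightarrow> q \<in> m \<Longrightarrow> snd p = snd q + slope m * (fst p - fst q)"
  unfolding on_line hgt_def by (simp add: algebra_simps)

lemma node_above:
  assumes "u \<in> T" "l \<in> T" "v \<in> u" "v \<in> l" "slope l < slope u" "p \<in> u" "q \<in> l" "fst v < fst p" "fst p = fst q"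
  shows "snd q < snd p"
proof -
  have "slope l * (fst p - fst v) < slope u * (fst p - fst v)" using assms by simp
  then show ?thesis using snd_on_line[of u p v] snd_on_line[of l q v] assms by simp
qed

text \<open>The steeper of the two lines is the upper one after the node.\<close>

lemma node_lines_exist:
  assumes "v \<in> N"
  shows "\<exists>u l. u \<in> L \<and> l \<in> L \<and> v \<in> u \<and> v \<in> l \<and> slope l < slope u \<and> up v = u \<and> lo v = l"
proof -
  obtain l1 l2 where l12: "l1 \<in> T" "l2 \<in> T" "l1 \<noteq> l2" "v \<in> l1" "v \<in> l2" "v \<in> D"
    using assms unfolding N_def nodes_def by blast
  then have "slope l1 \<noteq> slope l2" using slope_eqD by blast
  then obtain u l where ul: "u \<in> T" "l \<in> T" "u \<noteq> l" "v \<in> u" "v \<in> l" "slope l < slope u"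
    using l12 by (metis linorder_neqE)
  have only: "m = u \<or> m = l" if "m \<in> T" "v \<in> m" for m using node_lines ul that by blast
  \<comment> \<open>Comparison points one time unit after the node. They show that the flatter line
    fails the test for the upper line and the steeper one the test for the lower line.\<close>
  let ?p = "(fst v + 1, slope u * (fst v + 1) + icpt u)"
  let ?q = "(fst v + 1, slope l * (fst v + 1) + icpt l)"
  have pq: "?p \<in> u" "?q \<in> l" using line_point ul by blast+
  have "snd ?q < snd ?p" using node_above[OF ul(1,2,4,5,6) pq] by simp
  then have lt: "\<not> snd ?p \<le> snd ?q" by simp
  have "up v = u" unfolding upper_line_def
  proof (rule the_equality)
    have "snd q \<le> snd p" if "m \<in> T" "v \<in> m" "p \<in> u" "q \<in> m" "fst v < fst p" "fst p = fst q" for m p q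
      using only[OF that(1,2)] node_above[OF ul(1,2,4,5,6), of p q] line_inj[of u p q] that ul(1) by fastforce
    then show "u \<in> T \<and> v \<in> u \<and> (\<forall>m\<in>T. v \<in> m \<longrightarrow> (\<forall>p\<in>u. \<forall>q\<in>m. fst v < fst p \<and> fst p = fst q \<longrightarrow> snd q \<le> snd p))"
      using ul by blast
  next
    fix j assume j: "j \<in> T \<and> v \<in> j \<and> (\<forall>m\<in>T. v \<in> m \<longrightarrow> (\<forall>p\<in>j. \<forall>q\<in>m. fst v < fst p \<and> fst p = fst q \<longrightarrow> snd q \<le> snd p))"
    have "j \<noteq> l"
    proof
      assume "j = l"
      then have "fst v < fst ?q \<and> fst ?q = fst ?p \<longrightarrow> snd ?p \<le> snd ?q" using j ul(1,4) pq by blast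
      then show False using lt by simp
    qed
    then show "j = u" using only j by blast
  qed
  moreover have "lo v = l" unfolding lower_line_def
  proof (rule the_equality)
    have "snd p \<le> snd q" if "m \<in> T" "v \<in> m" "p \<in> l" "q \<in> m" "fst v < fst p" "fst p = fst q" for m p q
      using only[OF that(1,2)] node_above[OF ul(1,2,4,5,6), of q p] line_inj[of l p q] that ul(2) by fastforce
    then show "l \<in> T \<and> v \<in> l \<and> (\<forall>m\<in>T. v \<in> m \<longrightarrow> (\<forall>p\<in>l. \<forall>q\<in>m. fst v < fst p \<and> fst p = fst q \<longrightarrow> snd p \<le> snd q))"
      using ul by blast
  next
    fix j assume j: "j \<in> T \<and> v \<in> j \<and> (\<forall>m\<in>T. v \<in> m \<longrightarrow> (\<forall>p\<in>j. \<forall>q\<in>m. fst v < fst p \<and> fst p = fst q \<longrightarrow> snd p \<le> snd q))"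
    have "j \<noteq> u"
    proof
      assume "j = u"
      then have "fst v < fst ?p \<and> fst ?p = fst ?q \<longrightarrow> snd ?p \<le> snd ?q" using j ul(2,5) pq by blast
      then show False using lt by simp
    qed
    then show "j = l" using only j by blast
  qed
  ultimately show ?thesis using ul in_L l12(6) by blast
qed

lemma node_D: "v \<in> N \<Longrightarrow> v \<in> D" unfolding N_def by simp

lemma node_closure: "v \<in> N \<Longrightarrow> v \<in> closure D" using node_D closure_subset by blast

lemma node_up_lo:
  assumes "v \<in> N"
  shows "up v \<in> L" "lo v \<in> L" "v \<in> up v" "v \<in> lo v" "slope (lo v) < slope (up v)" "up v \<noteq> lo v"
    "up v \<in> T" "lo v \<in> T"
proof -
  show "up v \<in> L" "lo v \<in> L" "v \<in> up v" "v \<in> lo v" "slope (lo v) < slope (up v)"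
    using node_lines_exist[OF assms] by blast+
  then show "up v \<noteq> lo v" "up v \<in> T" "lo v \<in> T" using L_sub by auto
qed

lemma node_lines_eq: assumes "v \<in> N" shows "{m \<in> T. v \<in> m} = {up v, lo v}"
  using node_up_lo[OF assms] node_lines[OF node_up_lo(7,8,6,3,4)[OF assms]] assms by blast

lemma node_zero_iff: "v \<in> N \<Longrightarrow> m \<in> L \<Longrightarrow> hgt m v = 0 \<longleftrightarrow> m = up v \<or> m = lo v"
  using node_lines_eq on_L L_sub node_up_lo by blast

text \<open>
  At a node, the signs \<open>(\<sigma>, \<tau>)\<close> for the upper and the lower line are \<open>(1, 1)\<close> in the cell above, \<open>(-1, -1)\<close>
  in the cell below, \<open>(1, -1)\<close> in the cell before and \<open>(-1, 1)\<close> in the cell after the node. They are \<open>(0, 1)\<close>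
  and \<open>(-1, 0)\<close> on the outgoing, \<open>(0, -1)\<close> and \<open>(1, 0)\<close> on the incoming segments.
\<close>

definition quad :: "point \<Rightarrow> real \<Rightarrow> real \<Rightarrow> point set" where
  "quad v \<sigma> \<tau> = locface v (\<lambda>m. if m = up v then \<sigma> else \<tau>)"

lemma sgn_cases: "sgn (x::real) \<in> {-1, 0, 1}" by (auto simp: sgn_if)

text \<open>Once one short step has reached the local face, all shorter ones lie in it by
  \<open>face_toward\<close>. The cells above and below a node are defined by such an eventual
  condition.\<close>

lemma eventually_locface:
  assumes "v \<in> closure D" "\<forall>\<^sub>F \<theta> in at_right 0. v + \<theta> *\<^sub>R w \<in> D"
    "\<And>m. m \<in> L \<Longrightarrow> hgt m v = 0 \<Longrightarrow> sgn (snd w - slope m * fst w) = \<rho> m"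
  shows "\<forall>\<^sub>F \<theta> in at_right 0. v + \<theta> *\<^sub>R w \<in> locface v \<rho>"
proof -
  obtain \<theta> where \<theta>: "0 < \<theta>" "v + \<theta> *\<^sub>R w \<in> D"
    "\<And>m. m \<in> L \<Longrightarrow> sgn (hgt m (v + \<theta> *\<^sub>R w)) =
       (if hgt m v = 0 then sgn (snd w - slope m * fst w) else sgn (hgt m v))"
    using move[OF assms(2)] by metis
  let ?p = "v + \<theta> *\<^sub>R w"
  have p: "?p \<in> locface v \<rho>" using \<theta> assms(3) unfolding locface_def by auto
  have "v + h *\<^sub>R w \<in> locface v \<rho>" if "0 < h" "h < \<theta>" for h
  proof -
    have "v + (h / \<theta>) *\<^sub>R (?p - v) \<in> face ?p"
      by (rule face_toward) (use \<theta> assms(1) that in \<open>auto split: if_splits\<close>)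
    then show ?thesis using \<theta>(1) locface_face[OF p] by simp
  qed
  then show ?thesis using \<theta>(1) by (intro eventually_at_rightI[of 0 \<theta>]) auto
qed

lemma quad_nonempty:
  assumes v: "v \<in> N" and "\<sigma> \<in> {-1, 0, 1}" "\<tau> \<in> {-1, 0, 1}" shows "\<exists>q. q \<in> quad v \<sigma> \<tau>"
proof -
  \<comment> \<open>The time component of the direction is solved for so that \<open>?w\<close>
    rises at rate \<sigma> relative to the upper and at rate \<tau> relative to the lower line; this
    is possible because the slopes differ.\<close>
  obtain x where x: "(slope (up v) - slope (lo v)) * x = \<tau> - \<sigma>"
    using node_up_lo(5)[OF v] by (metis diff_gt_0_iff_gt less_irrefl nonzero_mult_div_cancel_left times_divide_eq_right)
  let ?w = "(x, \<sigma> + slope (up v) * x)"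
  have lo: "snd ?w - slope (lo v) * fst ?w = \<tau>" using x by (simp add: algebra_simps)
  have up: "snd ?w - slope (up v) * fst ?w = \<sigma>" by simp
  have s: "sgn \<sigma> = \<sigma>" "sgn \<tau> = \<tau>" using assms by auto
  show ?thesis unfolding quad_def
  proof (rule locface_nonempty[OF stay_D[OF node_D[OF v], of ?w]])
    fix m assume "m \<in> L" "hgt m v = 0"
    then have "m = up v \<or> m = lo v" using node_zero_iff v by blast
    then show "sgn (snd ?w - slope m * fst ?w) = (if m = up v then \<sigma> else \<tau>)"
      using lo up s node_up_lo(6)[OF v] by auto
  qed
qed

lemma quad_sgn:
  assumes "v \<in> N" "q \<in> quad v \<sigma> \<tau>" shows "sgn (hgt (up v) q) = \<sigma>" "sgn (hgt (lo v) q) = \<tau>"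
  using locfaceD[OF assms(2)[unfolded quad_def]] node_up_lo[OF assms(1)] node_zero_iff[OF assms(1)] by auto

lemma quad_eq_iff:
  assumes "v \<in> N" "\<sigma> \<in> {-1, 0, 1}" "\<tau> \<in> {-1, 0, 1}"
  shows "quad v \<sigma> \<tau> = quad v \<sigma>' \<tau>' \<longleftrightarrow> \<sigma> = \<sigma>' \<and> \<tau> = \<tau>'"
  using quad_nonempty[OF assms] quad_sgn[OF assms(1)] by metis

lemma quad_D: "q \<in> quad v \<sigma> \<tau> \<Longrightarrow> q \<in> D" unfolding quad_def using locface_D by blast

lemma quad_face: "q \<in> quad v \<sigma> \<tau> \<Longrightarrow> quad v \<sigma> \<tau> = face q" unfolding quad_def using locface_face by blast

lemma quad_zero:
  assumes "v \<in> N" "q \<in> quad v \<sigma> \<tau>"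
  shows "zeros q = {m. m = up v \<and> \<sigma> = 0 \<or> m = lo v \<and> \<tau> = 0}"
proof -
  have "m \<in> L \<and> hgt m q = 0 \<longleftrightarrow> m = up v \<and> \<sigma> = 0 \<or> m = lo v \<and> \<tau> = 0" for m
  proof (cases "m = up v \<or> m = lo v")
    case True
    then show ?thesis using quad_sgn[OF assms] node_up_lo[OF assms(1)] sgn_zero_iff by metis
  next
    case False
    then have "m \<in> L \<Longrightarrow> hgt m v \<noteq> 0" using node_zero_iff assms(1) by blast
    then have "m \<in> L \<Longrightarrow> hgt m q \<noteq> 0"
      using assms(2) unfolding quad_def locface_def by (auto simp: sgn_zero_iff)
    then show ?thesis using False by blast
  qed
  then show ?thesis unfolding zeros_def by simp
qed

lemma quad_cell:
  assumes "v \<in> N" "\<sigma> \<in> {-1, 1}" "\<tau> \<in> {-1, 1}" shows "quad v \<sigma> \<tau> \<in> cells T D"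
proof -
  obtain q where q: "q \<in> quad v \<sigma> \<tau>" using quad_nonempty[OF assms(1)] assms by blast
  have "zeros q = {}" using quad_zero[OF assms(1) q] assms by auto
  then show ?thesis using face_in_cells quad_D[OF q] quad_face[OF q] by simp
qed

lemma face_in_segments: "q \<in> D \<Longrightarrow> zeros q = {l} \<Longrightarrow> face q \<in> segments T D"
  unfolding segments_eq by blast

lemma segE:
  assumes "s \<in> segments T D"
  obtains q l where "q \<in> s" "q \<in> D" "s = face q" "zeros q = {l}" "l \<in> L"
proof -
  obtain q l where "q \<in> D" "s = face q" "zeros q = {l}" using assms unfolding segments_eq by blast
  moreover then have "l \<in> L" unfolding zeros_def by blast
  ultimately show thesis using that face_self by blast
qed

lemma quad_seg_up:
  assumes "v \<in> N" "\<tau> \<in> {-1, 1}" shows "quad v 0 \<tau> \<in> segments T D" "quad v 0 \<tau> \<subseteq> up v"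
proof -
  obtain q where q: "q \<in> quad v 0 \<tau>" using quad_nonempty[OF assms(1)] assms by blast
  have "zeros q = {up v}" using quad_zero[OF assms(1) q] assms by auto
  then show "quad v 0 \<tau> \<in> segments T D" using face_in_segments quad_D[OF q] quad_face[OF q] by simp
  show "quad v 0 \<tau> \<subseteq> up v"
    using quad_sgn(1)[OF assms(1)] on_L[OF node_up_lo(1)[OF assms(1)]] sgn_zero_iff by (metis subsetI)
qed

lemma quad_seg_lo:
  assumes "v \<in> N" "\<sigma> \<in> {-1, 1}" shows "quad v \<sigma> 0 \<in> segments T D" "quad v \<sigma> 0 \<subseteq> lo v"
proof -
  obtain q where q: "q \<in> quad v \<sigma> 0" using quad_nonempty[OF assms(1)] assms by blast
  have "zeros q = {lo v}" using quad_zero[OF assms(1) q] assms by auto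
  then show "quad v \<sigma> 0 \<in> segments T D" using face_in_segments quad_D[OF q] quad_face[OF q] by simp
  show "quad v \<sigma> 0 \<subseteq> lo v"
    using quad_sgn(2)[OF assms(1)] on_L[OF node_up_lo(2)[OF assms(1)]] sgn_zero_iff by (metis subsetI)
qed

lemma node_in_closure_quad:
  "v \<in> N \<Longrightarrow> \<sigma> \<in> {-1, 0, 1} \<Longrightarrow> \<tau> \<in> {-1, 0, 1} \<Longrightarrow> v \<in> closure (quad v \<sigma> \<tau>)"
  using quad_nonempty v_in_closure_locface node_closure unfolding quad_def by metis

lemma quad_closure_iff:
  assumes "v \<in> N" "\<sigma> \<in> {-1, 0, 1}" "\<tau> \<in> {-1, 0, 1}" "q \<in> quad v \<sigma>' \<tau>'"
  shows "q \<in> closure (quad v \<sigma> \<tau>) \<longleftrightarrow> (\<sigma>' = 0 \<or> \<sigma>' = \<sigma>) \<and> (\<tau>' = 0 \<or> \<tau>' = \<tau>)"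
proof -
  obtain r where "r \<in> quad v \<sigma> \<tau>" using quad_nonempty assms by blast
  then show ?thesis using in_closure_locface[of q v _ r] assms(4) node_zero_iff[OF assms(1)] node_up_lo[OF assms(1)]
    unfolding quad_def by auto
qed

lemma face_at_node:
  assumes "v \<in> N" "q \<in> D" "v \<in> closure (face q)"
  shows "face q = quad v (sgn (hgt (up v) q)) (sgn (hgt (lo v) q))"
proof -
  have "face q = locface v (\<lambda>m. sgn (hgt m q))"
    using in_closure_face_iff[OF assms(2) node_closure[OF assms(1)]] assms(3) by blast
  also have "\<dots> = quad v (sgn (hgt (up v) q)) (sgn (hgt (lo v) q))"
    unfolding quad_def by (rule locface_cong) (use node_zero_iff[OF assms(1)] in auto)
  finally show ?thesis .
qed

lemma cell_at_node:
  assumes "v \<in> N" "C \<in> cells T D" "v \<in> closure C"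
  shows "C \<in> {quad v 1 1, quad v 1 (-1), quad v (-1) 1, quad v (-1) (-1)}"
proof -
  obtain q where q: "q \<in> D" "C = face q" "\<And>m. m \<in> L \<Longrightarrow> hgt m q \<noteq> 0" using assms(2) cellE by metis
  have "sgn (hgt (up v) q) \<in> {-1, 1}" "sgn (hgt (lo v) q) \<in> {-1, 1}"
    using q(3) node_up_lo[OF assms(1)] by (auto simp: sgn_if)
  moreover have "C = quad v (sgn (hgt (up v) q)) (sgn (hgt (lo v) q))"
    unfolding q(2) by (rule face_at_node[OF assms(1) q(1)]) (use assms(3) q(2) in simp)
  ultimately show ?thesis by auto
qed

text \<open>A segment has exactly one zero sign, and at a node the line responsible must be one of
  the two through it; so exactly one of the two local signs vanishes.\<close>

lemma seg_at_node:
  assumes "v \<in> N" "s \<in> segments T D" "v \<in> closure s"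
  shows "s \<in> {quad v 0 1, quad v 0 (-1), quad v 1 0, quad v (-1) 0}"
proof -
  obtain q l where q: "q \<in> D" "s = face q" "zeros q = {l}" "q \<in> s" using assms(2) segE by metis
  let ?\<sigma> = "sgn (hgt (up v) q)" and ?\<tau> = "sgn (hgt (lo v) q)"
  have s: "s = quad v ?\<sigma> ?\<tau>" 
    unfolding q(2) by (rule face_at_node[OF assms(1) q(1)]) (use assms(3) q(2) in simp)
  then have "q \<in> quad v ?\<sigma> ?\<tau>" using q(4) by (rule subst)
  then have "zeros q = {m. m = up v \<and> ?\<sigma> = 0 \<or> m = lo v \<and> ?\<tau> = 0}"
    by (rule quad_zero[OF assms(1)])
  then have "{l} = {m. m = up v \<and> ?\<sigma> = 0 \<or> m = lo v \<and> ?\<tau> = 0}"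
    by (rule trans[OF q(3)[symmetric]])
  then have "m \<in> {l} \<longleftrightarrow> m \<in> {m. m = up v \<and> ?\<sigma> = 0 \<or> m = lo v \<and> ?\<tau> = 0}" for m
    by (rule arg_cong)
  then have z: "m = l \<longleftrightarrow> m = up v \<and> ?\<sigma> = 0 \<or> m = lo v \<and> ?\<tau> = 0" for m
    by (simp only: singleton_iff mem_Collect_eq)
  have "(?\<sigma> = 0) \<noteq> (?\<tau> = 0)"
  proof (cases "?\<sigma> = 0")
    case True
    then have "up v = l" using z[of "up v"] by simp
    moreover have "?\<tau> = 0 \<Longrightarrow> lo v = l" using z[of "lo v"] by simp
    ultimately show ?thesis using True node_up_lo(6)[OF assms(1)] by metis
  next
    case False
    then show ?thesis using z[of l] by simp
  qed
  then show ?thesis using s sgn_cases[of "hgt (up v) q"] sgn_cases[of "hgt (lo v) q"] by auto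
qed

text \<open>The two lines drift apart linearly: \<open>hgt (lo v) q - hgt (up v) q\<close> is a
  positive multiple of the time elapsed since \<open>v\<close>, so opposed signs reveal the side in
  time.\<close>

lemma quad_fst:
  assumes "v \<in> N" "q \<in> quad v \<sigma> \<tau>"
  shows "\<sigma> \<le> 0 \<Longrightarrow> 0 \<le> \<tau> \<Longrightarrow> \<sigma> \<noteq> 0 \<or> \<tau> \<noteq> 0 \<Longrightarrow> fst v < fst q"
    and "0 \<le> \<sigma> \<Longrightarrow> \<tau> \<le> 0 \<Longrightarrow> \<sigma> \<noteq> 0 \<or> \<tau> \<noteq> 0 \<Longrightarrow> fst q < fst v"
proof -
  note ul = node_up_lo[OF assms(1)] and s = quad_sgn[OF assms]
  have "hgt (up v) v = 0" "hgt (lo v) v = 0" using ul on_L by blast+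
  then have e: "(slope (up v) - slope (lo v)) * (fst q - fst v) = hgt (lo v) q - hgt (up v) q"
    unfolding hgt_def by (simp add: algebra_simps)
  have pos: "slope (up v) - slope (lo v) > 0" using ul by simp
  {
    assume a: "\<sigma> \<le> 0" "0 \<le> \<tau>" "\<sigma> \<noteq> 0 \<or> \<tau> \<noteq> 0"
    then have "hgt (up v) q \<le> 0" "0 \<le> hgt (lo v) q" "hgt (up v) q \<noteq> 0 \<or> hgt (lo v) q \<noteq> 0"
      using s by (auto simp: sgn_if split: if_splits)
    then have "(slope (up v) - slope (lo v)) * (fst q - fst v) > 0" unfolding e by linarith
    then show "fst v < fst q" using pos by (simp add: zero_less_mult_iff)
  }
  {
    assume a: "0 \<le> \<sigma>" "\<tau> \<le> 0" "\<sigma> \<noteq> 0 \<or> \<tau> \<noteq> 0"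
    then have "hgt (lo v) q \<le> 0" "0 \<le> hgt (up v) q" "hgt (up v) q \<noteq> 0 \<or> hgt (lo v) q \<noteq> 0"
      using s by (auto simp: sgn_if split: if_splits)
    then have "(slope (up v) - slope (lo v)) * (fst q - fst v) < 0" unfolding e by linarith
    then show "fst q < fst v" using pos by (simp add: mult_less_0_iff)
  }
qed

lemma leftmost_F: assumes "v \<in> N" shows "leftmost (quad v (-1) 1) = v"
proof (rule leftmost_cell_eq)
  show "quad v (-1) 1 \<in> cells T D" using quad_cell assms by blast
  show "v \<in> closure (quad v (-1) 1)" using node_in_closure_quad assms by blast
  show "fst v \<le> fst q" if "q \<in> quad v (-1) 1" for q using quad_fst(1)[OF assms that] by simp
qed

lemma vertical_in_quad:
  assumes "v \<in> N" "\<sigma> \<in> {-1, 1}"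
  shows "\<forall>\<^sub>F h in at_right 0. (fst v, snd v + \<sigma> * h) \<in> quad v \<sigma> \<sigma>"
proof -
  have "\<forall>\<^sub>F h in at_right 0. v + h *\<^sub>R (0, \<sigma>) \<in> quad v \<sigma> \<sigma>" unfolding quad_def
    by (rule eventually_locface[OF node_closure[OF assms(1)] stay_D[OF node_D[OF assms(1)]]]) (use assms(2) in auto)
  moreover have "v + h *\<^sub>R (0, \<sigma>) = (fst v, snd v + \<sigma> * h)" for h by (simp add: prod_eq_iff)
  ultimately show ?thesis by simp
qed

lemma eventually_cell_unique:
  assumes "C \<in> cells T D" "C' \<in> cells T D" "\<forall>\<^sub>F h in at_right (0::real). f h \<in> C" "\<forall>\<^sub>F h in at_right 0. f h \<in> C'"
  shows "C = C'"
proof -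
  have "\<forall>\<^sub>F h in at_right 0. f h \<in> C \<and> f h \<in> C'" using assms(3,4) by (rule eventually_conj)
  from eventually_happens'[OF trivial_limit_at_right_real this]
  obtain h where "f h \<in> C" "f h \<in> C'" by blast
  then show ?thesis by (rule cell_disjoint[OF assms(1,2)])
qed

lemma cell_above_node: assumes "v \<in> N" shows "cell_above T D v = quad v 1 1"
  unfolding cell_above_def
proof (rule the_equality)
  have e: "\<forall>\<^sub>F h in at_right 0. (fst v, snd v + h) \<in> quad v 1 1" using vertical_in_quad[OF assms, of 1] by simp
  moreover have c: "quad v 1 1 \<in> cells T D" using quad_cell[OF assms] by simp
  ultimately show "quad v 1 1 \<in> cells T D \<and> (\<forall>\<^sub>F h in at_right 0. (fst v, snd v + h) \<in> quad v 1 1)" by blast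
  show "C = quad v 1 1" if "C \<in> cells T D \<and> (\<forall>\<^sub>F h in at_right 0. (fst v, snd v + h) \<in> C)" for C
    using eventually_cell_unique[OF _ c _ e] that by blast
qed

lemma cell_below_node: assumes "v \<in> N" shows "cell_below T D v = quad v (-1) (-1)"
  unfolding cell_below_def
proof (rule the_equality)
  have e: "\<forall>\<^sub>F h in at_right 0. (fst v, snd v - h) \<in> quad v (-1) (-1)" using vertical_in_quad[OF assms, of "-1"] by simp
  moreover have c: "quad v (-1) (-1) \<in> cells T D" using quad_cell[OF assms] by simp
  ultimately show "quad v (-1) (-1) \<in> cells T D \<and> (\<forall>\<^sub>F h in at_right 0. (fst v, snd v - h) \<in> quad v (-1) (-1))" by blast
  show "C = quad v (-1) (-1)" if "C \<in> cells T D \<and> (\<forall>\<^sub>F h in at_right 0. (fst v, snd v - h) \<in> C)" for C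
    using eventually_cell_unique[OF _ c _ e] that by blast
qed

text \<open>These cells contain points at the very time of \<open>v\<close>, and an open cell begins
  strictly before each of its points.\<close>

lemma leftmost_AB: assumes "v \<in> N" "\<sigma> \<in> {-1, 1}" shows "fst (leftmost (quad v \<sigma> \<sigma>)) < fst v"
proof -
  have c: "quad v \<sigma> \<sigma> \<in> cells T D" using quad_cell assms by blast
  obtain h where "(fst v, snd v + \<sigma> * h) \<in> quad v \<sigma> \<sigma>"
    using eventually_happens'[OF trivial_limit_at_right_real vertical_in_quad[OF assms]] by blast
  then show ?thesis using leftmost_cell_lt[OF c] by fastforce
qed

lemma leftmost_W: assumes "v \<in> N" shows "fst (leftmost (quad v 1 (-1))) < fst v"
proof -
  have c: "quad v 1 (-1) \<in> cells T D" using quad_cell assms by blast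
  obtain q where q: "q \<in> quad v 1 (-1)" using quad_nonempty[OF assms] by blast
  then have "fst q < fst v" using quad_fst(2)[OF assms q] by simp
  then show ?thesis using leftmost_cell_lt[OF c q] by simp
qed

lemma leftmost_at_node:
  assumes "v \<in> N" "C \<in> cells T D" "leftmost C = v" shows "C = quad v (-1) 1"
  using cell_at_node[OF assms(1,2)] leftmost_cell(1)[OF assms(2)] leftmost_AB[OF assms(1)] leftmost_W[OF assms(1)] assms(3)
  by fastforce

lemma cell_before_node: assumes "v \<in> N" shows "cell_before T D v = quad v 1 (-1)"
  unfolding cell_before_def
proof (rule the_equality)
  show "quad v 1 (-1) \<in> cells T D \<and> v \<in> closure (quad v 1 (-1)) \<and> (\<forall>q\<in>quad v 1 (-1). fst q < fst v)"
    using quad_cell[OF assms] node_in_closure_quad[OF assms] quad_fst(2)[OF assms] by auto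
  fix C assume C: "C \<in> cells T D \<and> v \<in> closure C \<and> (\<forall>q\<in>C. fst q < fst v)"
  have "C \<noteq> quad v \<sigma> \<sigma>" if "\<sigma> \<in> {-1, 1}" for \<sigma>
    using eventually_happens'[OF trivial_limit_at_right_real vertical_in_quad[OF assms that]] C by fastforce
  moreover have "C \<noteq> quad v (-1) 1"
    using quad_nonempty[OF assms, of "-1" 1] quad_fst(1)[OF assms, of _ "-1" 1] C by fastforce
  ultimately show "C = quad v 1 (-1)" using cell_at_node[OF assms] C by blast
qed

lemma leftmost_D_lt: "p \<in> D \<Longrightarrow> fst (leftmost D) < fst p"
  using open_left[OF D_props(2)] leftmost_D(2) closure_subset by (metis less_trans order_less_irrefl subsetD)

text \<open>The cell after a node lies to the right of it, whereas the initial cell touches the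
  left-most point of the window; so the exception for the initial cell in \<open>begins_at\<close>
  never applies at a node.\<close>

lemma begins_at_node: assumes "v \<in> N" shows "begins_at T D C v \<longleftrightarrow> C = quad v (-1) 1"
proof -
  have "initial_cell T D \<noteq> quad v (-1) 1"
  proof
    assume a: "initial_cell T D = quad v (-1) 1"
    then have "leftmost D \<in> closure (quad v (-1) 1)" "quad v (-1) 1 \<in> cells T D" using initial_cell_in by auto
    then have "fst v \<le> fst (leftmost D)" using leftmost_cell_le leftmost_F[OF assms] by metis
    then show False using leftmost_D_lt[OF node_D[OF assms]] by simp
  qed
  then show ?thesis unfolding begins_at_def
    using leftmost_at_node[OF assms] leftmost_F[OF assms] quad_cell[OF assms] by auto
qed

text \<open>A node is determined by its pair of lines.\<close>

lemma finite_N: "finite N"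
proof -
  have "inj_on (\<lambda>v. (up v, lo v)) N"
    using node_up_lo meet_unique by (intro inj_onI) (metis prod.inject)
  moreover have "(\<lambda>v. (up v, lo v)) ` N \<subseteq> L \<times> L" using node_up_lo by auto
  ultimately show ?thesis using L_fin by (meson finite_SigmaI finite_subset finite_imageD)
qed

section \<open>Entry points, and where cells and segments start\<close>

lemma card_line_frontier: "l \<in> L \<Longrightarrow> card (l \<inter> frontier D) = 2"
proof -
  assume "l \<in> L"
  then have "l \<in> T" "l \<inter> closure D \<noteq> {}" using closure_subset[of D] unfolding L_def by auto
  then show ?thesis using win unfolding window_def by simp
qed

lemma between_D:
  assumes "l \<in> T" "a \<in> l" "a \<in> closure D" "q \<in> l" "q \<in> D" "p \<in> l"
    "fst a < fst p \<and> fst p \<le> fst q \<or> fst q \<le> fst p \<and> fst p < fst a"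
  shows "p \<in> D"
proof -
  have ne: "fst q \<noteq> fst a" using assms(7) by auto
  let ?t = "(fst p - fst a) / (fst q - fst a)"
  have t: "0 < ?t" "?t \<le> 1" using assms(7) by (auto simp: zero_less_divide_iff divide_le_eq_1)
  let ?r = "a + ?t *\<^sub>R (q - a)"
  have "?r \<in> D" using closure_seg_D assms(3,5) t by blast
  moreover have "?r \<in> l" using assms(1,2,4) by (simp add: on_line hgt_toward)
  moreover have "fst ?r = fst p" using ne by simp
  ultimately show ?thesis using line_inj assms(1,6) by metis
qed

text \<open>If a point of the line in \<open>D\<close> did not come after the entry point, the entry
  point would lie between it and the other frontier point, hence in the open set \<open>D\<close>;
  the exit is symmetric.\<close>

lemma frontier_two:
  assumes "l \<in> L"
  shows "\<exists>x. l \<inter> frontier D = {entry_point D l, x} \<and> fst (entry_point D l) < fst x \<and>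
    (\<forall>q\<in>l \<inter> D. fst (entry_point D l) < fst q \<and> fst q < fst x)"
proof -
  have lT: "l \<in> T" using assms L_sub by blast
  let ?S = "l \<inter> frontier D" and ?e = "entry_point D l"
  have "finite ?S" "?S \<noteq> {}" using card_line_frontier[OF assms] by (metis card.infinite zero_neq_numeral, metis card.empty zero_neq_numeral)
  then have e: "?e \<in> ?S" "\<And>x. x \<in> ?S \<Longrightarrow> \<not> fst x < fst ?e"
    unfolding entry_point_def using arg_min_if_finite[of ?S fst] by blast+
  obtain a b where ab: "?S = {a, b}" "a \<noteq> b" using card_line_frontier[OF assms] card_2_iff by metis
  then obtain x where x: "?S = {?e, x}" "x \<noteq> ?e" using e(1) by (metis insert_commute insert_iff singletonD)
  then have xS: "x \<in> ?S" by blast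
  have "fst x \<noteq> fst ?e" using line_inj[OF lT] xS e(1) x(2) by blast
  then have ex: "fst ?e < fst x" using e(2)[OF xS] by simp
  have cl: "?e \<in> closure D" "x \<in> closure D" "?e \<notin> D" "x \<notin> D"
    using e(1) xS frontier_not_D by (auto simp: frontier_def)
  have "fst ?e < fst q \<and> fst q < fst x" if q: "q \<in> l" "q \<in> D" for q
  proof (intro conjI; rule ccontr)
    assume "\<not> fst ?e < fst q"
    then have "?e \<in> D" using between_D[OF lT _ cl(2) q, of ?e] xS e(1) ex by simp
    then show False using cl by blast
  next
    assume "\<not> fst q < fst x"
    then have "x \<in> D" using between_D[OF lT _ cl(1) q, of x] xS e(1) ex by simp
    then show False using cl by blast
  qed
  then show ?thesis using x(1) ex by blast
qed

lemma entry_points_eq: "B = entry_point D ` L"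
  unfolding B_def entry_points_def L_def by simp

lemma finite_B: "finite B" unfolding entry_points_eq using L_fin by simp

lemma finite_sites: "finite sites" unfolding sites_def using finite_N finite_B by simp

definition lin :: "point \<Rightarrow> point set" where "lin v = (THE l. l \<in> T \<and> v \<in> l)"

lemma entry:
  assumes "v \<in> B"
  shows "lin v \<in> L" "{m \<in> T. v \<in> m} = {lin v}" "v \<in> frontier D" "v \<in> closure D" "v \<notin> D"
    "v = entry_point D (lin v)"
    "\<And>q. q \<in> lin v \<Longrightarrow> q \<in> D \<Longrightarrow> fst v < fst q"
proof -
  obtain l where l: "l \<in> L" "v = entry_point D l" using assms unfolding entry_points_eq by blast
  obtain x where x: "l \<inter> frontier D = {v, x}" "\<forall>q\<in>l \<inter> D. fst v < fst q"
    using frontier_two[OF l(1)] l(2) by blast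
  have v: "v \<in> frontier D" "v \<in> l" using x(1) by blast+
  have lT: "l \<in> T" using l L_sub by blast
  have only: "m = l" if "m \<in> T" "v \<in> m" for m using frontier_single_line[OF v(1)] that lT v(2) by blast
  have lin: "lin v = l" unfolding lin_def using lT v(2) only by (intro the_equality) blast+
  show "v \<in> frontier D" "v \<in> closure D" "v \<notin> D" using v(1) frontier_not_D by (auto simp: frontier_def)
  show "lin v \<in> L" "v = entry_point D (lin v)" "\<And>q. q \<in> lin v \<Longrightarrow> q \<in> D \<Longrightarrow> fst v < fst q"
    unfolding lin using l x by blast+
  show "{m \<in> T. v \<in> m} = {lin v}" unfolding lin using only lT v(2) by blast
qed

lemma entry_not_node: "v \<in> B \<Longrightarrow> v \<notin> nodes T"
  using entry(3) D_props(5) by blast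

lemma entry_zero_iff: "v \<in> B \<Longrightarrow> m \<in> L \<Longrightarrow> hgt m v = 0 \<longleftrightarrow> m = lin v"
  using entry(1,2) on_L L_sub by blast

text \<open>The counterpart of \<open>quad\<close> at an entry point, where a single sign suffices
  since only one line passes: 1 and -1 give the two adjacent cells, 0 the segment that
  enters.\<close>

definition half :: "point \<Rightarrow> real \<Rightarrow> point set" where
  "half v \<sigma> = locface v (\<lambda>_. \<sigma>)"

lemma half_nonempty:
  assumes v: "v \<in> B" and "\<sigma> \<in> {-1, 0, 1}" shows "\<exists>q. q \<in> half v \<sigma>"
proof -
  let ?l = "lin v"
  obtain p where p: "p \<in> ?l" "p \<in> D" using entry(1)[OF v] unfolding L_def by blast
  obtain \<theta> where t: "p + \<theta> *\<^sub>R (0, \<sigma>) \<in> D" "sgn (hgt ?l (p + \<theta> *\<^sub>R (0, \<sigma>))) =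
       (if hgt ?l p = 0 then sgn (snd (0::real, \<sigma>) - slope ?l * fst (0::real,\<sigma>)) else sgn (hgt ?l p))"
    using move[OF stay_D[OF p(2), of "(0,\<sigma>)"]] entry(1)[OF v] by metis
  \<comment> \<open>An interior point of the line, shifted vertically to the side \<sigma> (or not
    at all for \<sigma> = 0); heading for it from \<open>v\<close> enters the wanted half.\<close>
  let ?d = "p + \<theta> *\<^sub>R (0, \<sigma>)"
  have d: "sgn (hgt ?l ?d) = \<sigma>" using t(2) p(1) on_L[OF entry(1)[OF v]] assms(2) by auto
  show ?thesis unfolding half_def
  proof (rule locface_nonempty[OF toward_D[OF entry(4)[OF v] t(1)]])
    fix m assume m: "m \<in> L" "hgt m v = 0"
    then have "m = ?l" using entry_zero_iff v by blast
    moreover have "hgt m ?d = hgt m v + (snd (?d - v) - slope m * fst (?d - v))"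
      by (simp add: hgt_def algebra_simps)
    ultimately show "sgn (snd (?d - v) - slope m * fst (?d - v)) = \<sigma>" using d m(2) by simp
  qed
qed

lemma half_sgn: "v \<in> B \<Longrightarrow> q \<in> half v \<sigma> \<Longrightarrow> sgn (hgt (lin v) q) = \<sigma>"
  using locfaceD[of q v _ "lin v"] entry(1) entry_zero_iff unfolding half_def by blast

lemma half_eq_iff: "v \<in> B \<Longrightarrow> \<sigma> \<in> {-1, 0, 1} \<Longrightarrow> half v \<sigma> = half v \<sigma>' \<longleftrightarrow> \<sigma> = \<sigma>'"
  using half_nonempty half_sgn by metis

lemma half_D: "q \<in> half v \<sigma> \<Longrightarrow> q \<in> D" unfolding half_def using locface_D by blast

lemma half_face: "q \<in> half v \<sigma> \<Longrightarrow> half v \<sigma> = face q" unfolding half_def using locface_face by blast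

lemma half_zero:
  assumes "v \<in> B" "q \<in> half v \<sigma>" shows "zeros q = {m. m = lin v \<and> \<sigma> = 0}"
proof -
  have "m \<in> L \<and> hgt m q = 0 \<longleftrightarrow> m = lin v \<and> \<sigma> = 0" for m
  proof (cases "m = lin v")
    case True
    then show ?thesis using half_sgn[OF assms] entry(1)[OF assms(1)] sgn_zero_iff by metis
  next
    case False
    then have "m \<in> L \<Longrightarrow> hgt m v \<noteq> 0" using entry_zero_iff assms(1) by blast
    then have "m \<in> L \<Longrightarrow> hgt m q \<noteq> 0"
      using assms(2) unfolding half_def locface_def by (auto simp: sgn_zero_iff)
    then show ?thesis using False by blast
  qed
  then show ?thesis unfolding zeros_def by simp
qed

lemma half_cell: assumes "v \<in> B" "\<sigma> \<in> {-1, 1}" shows "half v \<sigma> \<in> cells T D"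
proof -
  obtain q where q: "q \<in> half v \<sigma>" using half_nonempty[OF assms(1)] assms by blast
  have "zeros q = {}" using half_zero[OF assms(1) q] assms by auto
  then show ?thesis using face_in_cells half_D[OF q] half_face[OF q] by simp
qed

lemma half_seg: assumes "v \<in> B" shows "half v 0 \<in> segments T D" "half v 0 \<subseteq> lin v"
proof -
  obtain q where q: "q \<in> half v 0" using half_nonempty[OF assms(1)] assms by blast
  have "zeros q = {lin v}" using half_zero[OF assms(1) q] assms by auto
  then show "half v 0 \<in> segments T D" using face_in_segments half_D[OF q] half_face[OF q] by simp
  show "half v 0 \<subseteq> lin v"
    using half_sgn[OF assms(1)] on_L[OF entry(1)[OF assms(1)]] sgn_zero_iff by (metis subsetI)
qed

lemma entry_in_closure_half: "v \<in> B \<Longrightarrow> \<sigma> \<in> {-1, 0, 1} \<Longrightarrow> v \<in> closure (half v \<sigma>)"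
  using half_nonempty v_in_closure_locface entry(4) unfolding half_def by metis

lemma half_closure_iff:
  assumes "v \<in> B" "\<sigma> \<in> {-1, 0, 1}" "q \<in> half v \<sigma>'"
  shows "q \<in> closure (half v \<sigma>) \<longleftrightarrow> \<sigma>' = 0 \<or> \<sigma>' = \<sigma>"
proof -
  obtain r where "r \<in> half v \<sigma>" using half_nonempty assms by blast
  then show ?thesis using in_closure_locface[of q v _ r] assms(3) entry_zero_iff[OF assms(1)] entry(1)[OF assms(1)]
    unfolding half_def by auto
qed

lemma face_at_entry:
  assumes "v \<in> B" "q \<in> D" "v \<in> closure (face q)"
  shows "face q = half v (sgn (hgt (lin v) q))"
proof -
  have "face q = locface v (\<lambda>m. sgn (hgt m q))"
    using in_closure_face_iff[OF assms(2) entry(4)[OF assms(1)]] assms(3) by blast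
  also have "\<dots> = half v (sgn (hgt (lin v) q))"
    unfolding half_def by (rule locface_cong) (use entry_zero_iff[OF assms(1)] in auto)
  finally show ?thesis .
qed

lemma cell_at_entry:
  assumes "v \<in> B" "C \<in> cells T D" "v \<in> closure C"
  shows "C = half v 1 \<or> C = half v (-1)"
proof -
  obtain q where q: "q \<in> D" "C = face q" "\<And>m. m \<in> L \<Longrightarrow> hgt m q \<noteq> 0" using assms(2) cellE by metis
  have "sgn (hgt (lin v) q) \<in> {-1, 1}" using q(3) entry(1)[OF assms(1)] by (auto simp: sgn_if)
  moreover have "C = half v (sgn (hgt (lin v) q))"
    unfolding q(2) by (rule face_at_entry[OF assms(1) q(1)]) (use assms(3) q(2) in simp)
  ultimately show ?thesis by auto
qed

lemma seg_at_entry: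
  assumes "v \<in> B" "s \<in> segments T D" "v \<in> closure s" shows "s = half v 0"
proof -
  obtain q l where q: "q \<in> D" "s = face q" "zeros q = {l}" "q \<in> s" using assms(2) segE by metis
  let ?\<sigma> = "sgn (hgt (lin v) q)"
  have s: "s = half v ?\<sigma>"
    unfolding q(2) by (rule face_at_entry[OF assms(1) q(1)]) (use assms(3) q(2) in simp)
  then have "q \<in> half v ?\<sigma>" using q(4) by (rule subst)
  then have "zeros q = {m. m = lin v \<and> ?\<sigma> = 0}" by (rule half_zero[OF assms(1)])
  then have "?\<sigma> = 0" using q(3) by blast
  then show ?thesis using s by simp
qed

lemma point_left_of:
  assumes "p \<in> closure D" "p \<noteq> leftmost D" shows "\<exists>d\<in>D. fst d < fst p"
proof (rule ccontr)
  assume a: "\<not> (\<exists>d\<in>D. fst d < fst p)"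
  have "fst p \<le> fst (leftmost D)"
    by (rule closure_fst_ge[of D]) (use a leftmost_D(1) in \<open>auto simp: not_less\<close>)
  then show False using leftmost_D(2)[OF _ assms(1,2)] by simp
qed

lemma move_toward:
  assumes "p \<in> closure D" "d \<in> D" "\<And>m. m \<in> L \<Longrightarrow> hgt m p = 0 \<Longrightarrow> sgn (hgt m d) = \<rho> m" 
  obtains \<theta> where "0 < \<theta>" "\<theta> < 1" "p + \<theta> *\<^sub>R (d - p) \<in> locface p \<rho>"
proof -
  obtain \<theta> where t: "0 < \<theta>" "\<theta> < 1" "p + \<theta> *\<^sub>R (d - p) \<in> D"
    "\<And>m. m \<in> L \<Longrightarrow> sgn (hgt m (p + \<theta> *\<^sub>R (d - p))) =
       (if hgt m p = 0 then sgn (snd (d - p) - slope m * fst (d - p)) else sgn (hgt m p))"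
    using move[OF toward_D[OF assms(1,2)]] by metis
  have "snd (d - p) - slope m * fst (d - p) = hgt m d" if "hgt m p = 0" for m
    using that by (simp add: hgt_def algebra_simps)
  then have "p + \<theta> *\<^sub>R (d - p) \<in> locface p \<rho>" using t(3,4) assms(3) unfolding locface_def by auto
  then show thesis using that t by blast
qed

lemma fst_toward_less: "0 < \<theta> \<Longrightarrow> fst d < fst p \<Longrightarrow> fst (p + \<theta> *\<^sub>R (d - p)) < fst (p::point)"
  using mult_pos_neg[of \<theta> "fst d - fst p"] by simp

text \<open>Which side of the line begins at the entry point is not visible from the local signs, as
  it depends on how the frontier runs there; hence the existential \<sigma>. The other side is the
  initial cell or begins strictly earlier, so its colour is already known.\<close>

lemma begins_at_entry:
  assumes v: "v \<in> B"
  shows "\<exists>\<sigma>\<in>{-1, 1}. (\<forall>C. begins_at T D C v \<longleftrightarrow> C = half v \<sigma>) \<and>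
     cell_before_entry T D v = half v (- \<sigma>) \<and>
     (half v (- \<sigma>) = initial_cell T D \<or> fst (leftmost (half v (- \<sigma>))) < fst v)"
proof -
  let ?I = "initial_cell T D"
  have ne: "half v \<sigma> \<noteq> half v (- \<sigma>)" if "\<sigma> \<in> {-1, 1}" for \<sigma>
    using half_eq_iff[OF v, of \<sigma> "-\<sigma>"] that by auto
  have "\<exists>\<sigma>\<in>{-1, 1}. leftmost (half v \<sigma>) = v \<and> half v \<sigma> \<noteq> ?I \<and>
     (half v (- \<sigma>) = ?I \<or> fst (leftmost (half v (- \<sigma>))) < fst v)"
  proof (cases "v = leftmost D")
    case True
    \<comment> \<open>At the left-most point of the window both halves have \<open>v\<close> as
      their left-most point; the arbitrary choice in \<open>initial_cell\<close> decides which one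
      counts as beginning there.\<close>
    have lm: "leftmost (half v \<sigma>) = v" if "\<sigma> \<in> {-1, 1}" for \<sigma>
    proof (rule leftmost_cell_eq[OF half_cell[OF v that]])
      show "v \<in> closure (half v \<sigma>)" using entry_in_closure_half v that by blast
      show "fst v \<le> fst q" if "q \<in> half v \<sigma>" for q
        using leftmost_D_lt[OF half_D[OF that]] True by simp
    qed
    have "?I = half v 1 \<or> ?I = half v (-1)" using cell_at_entry[OF v] initial_cell_in True by blast
    then obtain \<sigma> where s: "\<sigma> \<in> {-1, 1}" "?I = half v (- \<sigma>)" by force
    then show ?thesis using lm[OF s(1)] ne[OF s(1)] by (intro bexI[of _ \<sigma>]) auto
  next
    case False
    then obtain d where d: "d \<in> D" "fst d < fst v" using point_left_of entry(4)[OF v] by blast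
    define \<sigma> where "\<sigma> = - sgn (hgt (lin v) d)"
    have "hgt (lin v) d \<noteq> 0" using entry(7)[OF v _ d(1)] d(2) on_L[OF entry(1)[OF v]] by fastforce
    then have s: "\<sigma> \<in> {-1, 1}" "- \<sigma> \<in> {-1, 1}" unfolding \<sigma>_def by (auto simp: sgn_if)
    have "sgn (hgt m d) = - \<sigma>" if "m \<in> L" "hgt m v = 0" for m
      using entry_zero_iff[OF v that(1)] that unfolding \<sigma>_def by simp
    then obtain \<theta> where t: "0 < \<theta>" "v + \<theta> *\<^sub>R (d - v) \<in> half v (- \<sigma>)"
      using move_toward[OF entry(4)[OF v] d(1), of "\<lambda>_. - \<sigma>"] unfolding half_def by metis
    have before: "fst (leftmost (half v (- \<sigma>))) < fst v"
      using leftmost_cell_lt[OF half_cell[OF v s(2)] t(2)] fst_toward_less[OF t(1) d(2)] by simp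
    \<comment> \<open>A point of the other side before \<open>v\<close> could be joined to
      \<open>d\<close> inside \<open>D\<close>; the connecting segment would cross the line at a
      point before \<open>v\<close>, against the fact that \<open>v\<close> is the entry
      point.\<close>
    have right: "fst v \<le> fst q" if q: "q \<in> half v \<sigma>" for q
    proof (rule ccontr)
      assume "\<not> fst v \<le> fst q"
      then have fq: "fst q < fst v" by simp
      let ?a = "hgt (lin v) d" and ?b = "hgt (lin v) q"
      have sg: "sgn ?b = - sgn ?a" using half_sgn[OF v q] unfolding \<sigma>_def by simp
      have ab: "?a - ?b \<noteq> 0" using \<open>?a \<noteq> 0\<close> sg by (auto simp: sgn_if split: if_splits)
      \<comment> \<open>The zero of the affine height along the segment from \<open>d\<close> to
        \<open>q\<close>.\<close>
      define t where "t = ?a / (?a - ?b)"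
      have t01: "0 < t" "t < 1"
        unfolding t_def using \<open>?a \<noteq> 0\<close> sg by (auto simp: sgn_if zero_less_divide_iff divide_less_eq_1 split: if_splits)
      let ?r = "d + t *\<^sub>R (q - d)"
      have "?r \<in> D" using closure_seg_D[of d q t] d(1) half_D[OF q] closure_subset t01 by fastforce
      moreover have "hgt (lin v) ?r = 0" unfolding hgt_toward t_def using ab by (simp add: field_simps)
      ultimately have "fst v < fst ?r" using entry(7)[OF v] on_L[OF entry(1)[OF v]] by blast
      moreover have "fst ?r = (1 - t) * fst d + t * fst q" by (simp add: algebra_simps)
      moreover have "(1 - t) * fst d < (1 - t) * fst v" "t * fst q < t * fst v" using t01 d(2) fq by simp_all
      moreover have "(1 - t) * fst v + t * fst v = fst v" by (simp add: algebra_simps)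
      ultimately show False by linarith
    qed
    have lm: "leftmost (half v \<sigma>) = v"
      by (rule leftmost_cell_eq[OF half_cell[OF v s(1)]]) (use right entry_in_closure_half[OF v] s in auto)
    have "half v \<sigma> \<noteq> ?I"
    proof
      assume "half v \<sigma> = ?I"
      then have "fst v \<le> fst (leftmost D)"
        using leftmost_cell_le[of ?I "leftmost D"] initial_cell_in lm by simp
      then show False using leftmost_D(2)[OF _ entry(4)[OF v] False] by simp
    qed
    then show ?thesis using s lm before by blast
  qed
  then obtain \<sigma> where s: "\<sigma> \<in> {-1, 1}" "leftmost (half v \<sigma>) = v" "half v \<sigma> \<noteq> ?I"
     "half v (- \<sigma>) = ?I \<or> fst (leftmost (half v (- \<sigma>))) < fst v" by blast
  have s': "- \<sigma> \<in> {-1, 1}" using s(1) by auto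
  have at: "C = half v \<sigma> \<or> C = half v (- \<sigma>)" if "C \<in> cells T D" "v \<in> closure C" for C
    using cell_at_entry[OF v that] s(1) by auto
  have bg: "begins_at T D C v \<longleftrightarrow> C = half v \<sigma>" for C
  proof
    assume b: "begins_at T D C v"
    then have "C \<in> cells T D" "C \<noteq> ?I" "leftmost C = v" unfolding begins_at_def by blast+
    moreover then have "v \<in> closure C" using leftmost_cell(1) by blast
    ultimately show "C = half v \<sigma>" using at s(4) by fastforce
  next
    assume "C = half v \<sigma>"
    then show "begins_at T D C v" unfolding begins_at_def using s half_cell[OF v s(1)] by blast
  qed
  have "cell_before_entry T D v = half v (- \<sigma>)" unfolding cell_before_entry_def
  proof (rule the_equality)
    show "half v (- \<sigma>) \<in> cells T D \<and> v \<in> closure (half v (- \<sigma>)) \<and> \<not> begins_at T D (half v (- \<sigma>)) v"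
      using half_cell[OF v s'] entry_in_closure_half[OF v] s' bg ne[OF s(1)] by auto
  qed (use at bg in blast)
  then show ?thesis using s bg by blast
qed

lemma begins_at_site:
  assumes "v \<in> sites" shows "\<exists>!C. begins_at T D C v"
  using assms begins_at_node begins_at_entry unfolding sites_def by (metis UnE)

definition fcell :: "point \<Rightarrow> point set" where "fcell v = (THE C. begins_at T D C v)"

lemma begins_at_iff: "v \<in> sites \<Longrightarrow> begins_at T D C v \<longleftrightarrow> C = fcell v"
  unfolding fcell_def using begins_at_site theI'[OF begins_at_site] by metis

lemma fcell_node: "v \<in> N \<Longrightarrow> fcell v = quad v (-1) 1"
  using begins_at_iff begins_at_node unfolding sites_def by blast

text \<open>A point of the line in the closed window is an inner point of a segment, a node, the
  entry or the exit. The fourth premise excludes the first case and \<open>nx\<close> the last, as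
  no part of the line in \<open>D\<close> lies beyond the exit.\<close>

lemma site_cases_on_line:
  assumes "m \<in> L" "p \<in> m" "p \<in> closure D" "p \<in> D \<Longrightarrow> zeros p \<noteq> {m}"
    and nx: "\<And>q. q \<in> m \<Longrightarrow> q \<in> D \<Longrightarrow> \<exists>r\<in>D. r \<in> m \<and> fst p < fst r"
  shows "p \<in> sites"
proof (cases "p \<in> D")
  case True
  have "m \<in> zeros p" using assms on_L unfolding zeros_def by blast
  then obtain j where "j \<in> zeros p" "j \<noteq> m" using assms(4)[OF True] by blast
  then have "p \<in> nodes T" using nodesI[of m j p] assms(1,2) on_L L_sub unfolding zeros_def by blast
  then show ?thesis using True unfolding sites_def N_def by blast
next
  case False
  then have pf: "p \<in> m \<inter> frontier D" using closure_D_cases assms(2,3) by blast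
  obtain x where x: "m \<inter> frontier D = {entry_point D m, x}" "\<forall>q\<in>m \<inter> D. fst q < fst x"
    using frontier_two[OF assms(1)] by blast
  obtain q where "q \<in> m" "q \<in> D" using assms(1) unfolding L_def by blast
  then obtain r where "r \<in> D" "r \<in> m" "fst p < fst r" using nx by blast
  moreover then have "fst r < fst x" using x(2) by blast
  ultimately have "p \<noteq> x" by fastforce
  then have "p = entry_point D m" using pf x(1) by blast
  then show ?thesis unfolding sites_def entry_points_eq using assms(1) by blast
qed

text \<open>Step back along the line itself: in the direction \<open>(-1, - slope l)\<close> the
  sign for \<open>l\<close> stays 0, and all other signs are nonzero and persist.\<close>

lemma seg_move_left:
  assumes "s \<in> segments T D" "x \<in> s" shows "\<exists>y\<in>s. fst y < fst x"
proof -
  obtain q l where q: "q \<in> D" "s = face q" "zeros q = {l}" using assms(1) segE by metis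
  have s: "s = face x" using face_eq assms(2) q(2) by simp
  have z: "zeros x = {l}" using zeros_face assms(2) q by blast
  have xD: "x \<in> D" using assms(2) q face_sub by blast
  obtain \<theta> where t: "0 < \<theta>" "x + \<theta> *\<^sub>R (-1, - slope l) \<in> D"
    "\<And>m. m \<in> L \<Longrightarrow> sgn (hgt m (x + \<theta> *\<^sub>R (-1, - slope l))) =
       (if hgt m x = 0 then sgn (snd (-1::real, - slope l) - slope m * fst (-1::real, - slope l)) else sgn (hgt m x))"
    using move[OF stay_D[OF xD, of "(-1, - slope l)"]] by metis
  have "m = l" if "m \<in> L" "hgt m x = 0" for m using that z unfolding zeros_def by blast
  then have "x + \<theta> *\<^sub>R (-1, - slope l) \<in> face x" unfolding face_def using t by auto
  then show ?thesis using t(1) unfolding s by (intro bexI[of _ "x + \<theta> *\<^sub>R (-1, - slope l)"]) auto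
qed

text \<open>The earliest point of the closed segment cannot belong to the open segment, in which one
  can always move left; so it is a node or the entry point of the line.\<close>

lemma seg_start:
  assumes "s \<in> segments T D"
  shows "\<exists>v\<in>sites. v \<in> closure s \<and> (\<forall>q\<in>s. fst v < fst q)"
proof -
  obtain q l where q: "q \<in> D" "s = face q" "zeros q = {l}" "q \<in> s" "l \<in> L" using assms segE by metis
  have cs: "closure s \<subseteq> closure D" using face_sub closure_mono q(2) by blast
  then have "compact (closure s)" using D_props(1) bounded_closure compact_eq_bounded_closed bounded_subset closed_closure by metis
  moreover have "continuous_on (closure s) (fst :: point \<Rightarrow> real)" by (intro continuous_intros)
  moreover have "closure s \<noteq> {}" using q(4) by auto
  ultimately obtain p where p: "p \<in> closure s" "\<And>x. x \<in> closure s \<Longrightarrow> fst p \<le> fst x"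
    using continuous_attains_inf[of "closure s" fst] by auto
  have lt: "fst p < fst x" if "x \<in> s" for x
    using seg_move_left[OF assms that] p(2) closure_subset by fastforce
  have hz: "hgt l q = 0" using q(3) unfolding zeros_def by blast
  have pc: "\<forall>m\<in>L. hgt m p = 0 \<or> sgn (hgt m p) = sgn (hgt m q)" using p(1) closure_face[OF q(1)] q(2) by blast
  have "hgt l p = 0" using pc q(5) hz sgn_zero_iff by metis
  then have pl: "p \<in> l" using on_L q(5) by blast
  have "p \<in> sites"
  proof (rule site_cases_on_line[OF q(5) pl])
    show "p \<in> closure D" using p(1) cs by blast
    show "zeros p \<noteq> {l}" if "p \<in> D"
    proof
      assume zp: "zeros p = {l}"
      have "sgn (hgt m p) = sgn (hgt m q)" if "m \<in> L" for m
      proof (cases "m = l")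
        case False
        then have "hgt m p \<noteq> 0" using zp that unfolding zeros_def by blast
        then show ?thesis using pc that by blast
      qed (use hz \<open>hgt l p = 0\<close> in simp)
      then have "p \<in> s" using \<open>p \<in> D\<close> q(2) unfolding face_def by blast
      then show False using lt by blast
    qed
    have "q \<in> l" using hz on_L q(5) by blast
    then show "\<exists>r\<in>D. r \<in> l \<and> fst p < fst r" for x :: point using lt[OF q(4)] q(1) by blast
  qed
  then show ?thesis using p(1) lt by blast
qed

text \<open>This makes the sites account for all cells but the initial one. At the left-most point
  of a cell it must be impossible to move left within the closed cell, which forces two lines
  through an inner point, or one entering line on the frontier.\<close>

lemma cell_start:
  assumes "C \<in> cells T D" "C \<noteq> initial_cell T D"
  shows "leftmost C \<in> sites"
proof -
  let ?p = "leftmost C" and ?I = "initial_cell T D"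
  obtain q where q: "q \<in> C" "q \<in> D" "C = face q" "\<And>m. m \<in> L \<Longrightarrow> hgt m q \<noteq> 0" using cellE assms(1) by metis
  have pC: "?p \<in> closure C" using leftmost_cell(1) assms(1) by blast
  then have pD: "?p \<in> closure D" using closure_cell_sub assms(1) by blast
  have pc: "\<forall>m\<in>L. hgt m ?p = 0 \<or> sgn (hgt m ?p) = sgn (hgt m q)" using pC closure_face[OF q(2)] q(3) by blast
  have no_left: False if "r \<in> closure C" "fst r < fst ?p" for r
    using leftmost_cell_le[OF assms(1) that(1)] that(2) by simp
  \<comment> \<open>If \<open>d\<close> lies on every line through the left-most point, these signs
    stay 0 on the way to \<open>d\<close> and the others persist, so the closed cell would contain
    an earlier point.\<close>
  have no_left_line: False
    if d: "d \<in> D" "fst d < fst ?p" and on: "\<And>m. m \<in> L \<Longrightarrow> hgt m ?p = 0 \<Longrightarrow> hgt m d = 0" for d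
  proof -
    obtain \<theta> where t: "0 < \<theta>" "?p + \<theta> *\<^sub>R (d - ?p) \<in> locface ?p (\<lambda>_. 0)"
      using move_toward[OF pD d(1), of "\<lambda>_. 0"] on by (metis sgn_0)
    let ?r = "?p + \<theta> *\<^sub>R (d - ?p)"
    have rD: "?r \<in> closure D" using t(2) locface_D closure_subset by blast
    have h: "hgt m ?r = 0 \<or> sgn (hgt m ?r) = sgn (hgt m q)" if "m \<in> L" for m
    proof (cases "hgt m ?p = 0")
      case True
      then show ?thesis using locfaceD[OF t(2) that] by (metis sgn_zero_iff)
    next
      case False
      then have "sgn (hgt m ?r) = sgn (hgt m ?p)" using t(2) that unfolding locface_def by simp
      then show ?thesis using pc that False by metis
    qed
    have "?r \<in> closure (face q)" unfolding closure_face[OF q(2)] using rD h by blast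
    then have "?r \<in> closure C" by (rule subst[OF q(3)[symmetric]])
    then show False using no_left fst_toward_less[OF t(1) d(2)] by blast
  qed
  show ?thesis
  proof (cases "\<exists>m\<in>L. hgt m ?p = 0")
    case True
    then obtain m where m: "m \<in> L" "hgt m ?p = 0" by blast
    have pm: "?p \<in> m" using m on_L by blast
    have right: "fst ?p \<le> fst d" if "d \<in> D" "d \<in> m" "\<And>j. j \<in> L \<Longrightarrow> hgt j ?p = 0 \<Longrightarrow> j = m" for d
      using no_left_line[OF that(1)] that on_L by (metis not_le)
    show ?thesis
    proof (rule site_cases_on_line[OF m(1) pm pD])
      show "zeros ?p \<noteq> {m}" if inD: "?p \<in> D"
      proof
        assume z: "zeros ?p = {m}"
        have sg: "face ?p \<in> segments T D" using face_in_segments inD z by blast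
        then obtain y where y: "y \<in> face ?p" "fst y < fst ?p" using seg_move_left[OF sg face_self[OF inD]] by blast
        have "y \<in> D" using y face_sub by blast
        moreover have "hgt j y = 0" if "j \<in> L" "hgt j ?p = 0" for j using face_zero_iff y(1) that by blast
        ultimately show False using no_left_line y(2) by blast
      qed
      show "\<exists>r\<in>D. r \<in> m \<and> fst ?p < fst r" if d: "d \<in> m" "d \<in> D" for d
      proof (cases "?p \<in> D")
        case True
        obtain \<theta> where t: "0 < \<theta>" "?p + \<theta> *\<^sub>R (1, slope m) \<in> D" using move[OF stay_D[OF True, of "(1, slope m)"]] by metis
        have "hgt m (?p + \<theta> *\<^sub>R (1, slope m)) = 0" unfolding hgt_add using m(2) by simp
        then show ?thesis using t m(1) on_L by (intro bexI[of _ "?p + \<theta> *\<^sub>R (1, slope m)"]) auto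
      next
        case False
        then have pf: "?p \<in> frontier D" using closure_D_cases pD by blast
        have "j = m" if "j \<in> L" "hgt j ?p = 0" for j
          using frontier_single_line[OF pf] that m pm on_L L_sub by blast
        then have "fst ?p \<le> fst d" using right d by blast
        moreover have "fst ?p \<noteq> fst d" using line_inj[of m ?p d] pm d m(1) L_sub False by blast
        ultimately show ?thesis using d by (intro bexI[of _ d]) auto
      qed
    qed
  next
    case False
    then have nz: "\<And>m. m \<in> L \<Longrightarrow> hgt m ?p \<noteq> 0" by blast
    \<comment> \<open>With no line through the point, only the end of the window can stop a move to
      the left. The initial cell touches the same point, and the signs there leave room for one cell
      only.\<close>
    have "?p = leftmost D"
    proof (rule ccontr)
      assume "?p \<noteq> leftmost D"
      then obtain d where "d \<in> D" "fst d < fst ?p" using point_left_of pD by blast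
      then show False using no_left_line nz by blast
    qed
    then have "?p \<in> closure ?I" "?I \<in> cells T D" using initial_cell_in by auto
    then obtain i where i: "i \<in> D" "?I = face i" using cellE by metis
    have "?p \<in> closure (face i)" using \<open>?p \<in> closure ?I\<close> by (rule subst[OF i(2)])
    then have pi: "\<forall>m\<in>L. hgt m ?p = 0 \<or> sgn (hgt m ?p) = sgn (hgt m i)" using closure_face[OF i(1)] by blast
    have "sgn (hgt m i) = sgn (hgt m q)" if "m \<in> L" for m
      using nz[OF that] pc[rule_format, OF that] pi[rule_format, OF that] by simp
    then have "i \<in> face q" using i(1) unfolding face_def by blast
    then have "?I = C" using face_eq i(2) q(3) by blast
    then show ?thesis using assms(2) by blast
  qed
qed

end

section \<open>The dynamics as a product over the sites\<close>

text \<open>Intended for \<open>update\<close>, which can be inverted only on outcome functions of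
  the right shape; these carry the law of a step.\<close>

lemma pmf_map_inj_on:
  assumes "inj_on f A" "set_pmf M \<subseteq> A" "x \<in> A"
  shows "pmf (map_pmf f M) (f x) = pmf M x"
proof -
  have "measure (measure_pmf M) (f -` {f x}) = measure (measure_pmf M) (f -` {f x} \<inter> set_pmf M)"
    by (simp add: measure_Int_set_pmf)
  also have "f -` {f x} \<inter> set_pmf M = {x} \<inter> set_pmf M"
    using assms by (auto simp: inj_on_def)
  finally show ?thesis by (simp add: pmf_map measure_Int_set_pmf pmf.rep_eq)
qed

lemma sum_if_eq:
  "finite A \<Longrightarrow> (\<Sum>i\<in>A. if P \<and> Q \<and> x = i then y else 0) = (if P \<and> Q \<and> x \<in> A then y else (0::real))"
  by (cases P; cases Q) simp_all

section \<open>Configurations encoded by outcomes at the sites, and truncated states\<close>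

context tessellated_window begin

abbreviation "init \<equiv> initial_cell T D"

definition lines_at :: "point \<Rightarrow> point set set" where
  "lines_at v = (if v \<in> N then {up v, lo v} else {lin v})"

text \<open>The segment on which a particle leaves \<open>v\<close> along \<open>l\<close>. It has
  this meaning only for \<open>l\<close> in \<open>lines_at v\<close>; elsewhere the value is
  arbitrary.\<close>

definition oseg :: "point \<Rightarrow> point set \<Rightarrow> point set" where
  "oseg v l = (if v \<in> N then (if l = up v then quad v 0 1 else quad v (-1) 0) else half v 0)"

lemma finite_lines_at: "finite (lines_at v)" unfolding lines_at_def by simp

lemma site_cases [consumes 1]: "v \<in> sites \<Longrightarrow> (v \<in> N \<Longrightarrow> P) \<Longrightarrow> (v \<in> B \<Longrightarrow> v \<notin> N \<Longrightarrow> P) \<Longrightarrow> P"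
  unfolding sites_def by blast

lemma entry_not_N: "v \<in> B \<Longrightarrow> v \<notin> N" using entry_not_node unfolding N_def by blast

lemma oseg_props:
  assumes "v \<in> sites" "l \<in> lines_at v"
  shows "oseg v l \<in> segments T D" "oseg v l \<subseteq> l" "v \<in> closure (oseg v l)" "\<forall>q\<in>oseg v l. fst v < fst q" "l \<in> L"
    "l \<in> T" "v \<in> l"
proof -
  have "oseg v l \<in> segments T D \<and> oseg v l \<subseteq> l \<and> v \<in> closure (oseg v l) \<and> (\<forall>q\<in>oseg v l. fst v < fst q) \<and> l \<in> L \<and> v \<in> l"
    using assms(1)
  proof (cases rule: site_cases)
    case 1
    note ul = node_up_lo[OF 1] and sg = quad_seg_up[OF 1, of 1] quad_seg_lo[OF 1, of "-1"]
    have cl: "v \<in> closure (quad v 0 1)" "v \<in> closure (quad v (-1) 0)" using node_in_closure_quad[OF 1] by auto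
    have f: "\<forall>q\<in>quad v 0 1. fst v < fst q" "\<forall>q\<in>quad v (-1) 0. fst v < fst q" using quad_fst(1)[OF 1] by auto
    have "l = up v \<or> l = lo v" using assms(2) 1 unfolding lines_at_def by simp
    then show ?thesis
    proof
      assume "l = up v"
      then show ?thesis using 1 ul sg cl f unfolding oseg_def by simp
    next
      assume "l = lo v"
      then show ?thesis using 1 ul sg cl f unfolding oseg_def by simp
    qed
  next
    case 2
    have l: "l = lin v" using assms(2) 2 unfolding lines_at_def by simp
    have "fst v < fst q" if "q \<in> half v 0" for q
      using entry(7)[OF 2(1)] half_seg(2)[OF 2(1)] half_D that by blast
    moreover have "v \<in> lin v" using entry(2)[OF 2(1)] by blast
    ultimately show ?thesis
      using 2 half_seg[OF 2(1)] entry_in_closure_half[OF 2(1), of 0] entry(1)[OF 2(1)] unfolding oseg_def l by simp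
  qed
  then show "oseg v l \<in> segments T D" "oseg v l \<subseteq> l" "v \<in> closure (oseg v l)" "\<forall>q\<in>oseg v l. fst v < fst q" "l \<in> L"
    "l \<in> T" "v \<in> l" using L_sub by blast+
qed

lemma closure_on_line:
  assumes "l \<in> T" "s \<subseteq> l" shows "closure s \<subseteq> l"
proof -
  have "closed {p. hgt l p = 0}" by (intro closed_Collect_eq continuous_hgt continuous_on_const)
  then have "closed l" by (subst line_eq[OF assms(1)])
  then show ?thesis by (rule closure_minimal[OF assms(2)])
qed

lemma leftmost_on_line:
  assumes "l \<in> T" "s \<subseteq> l" "v \<in> closure s" "\<forall>q\<in>s. fst v < fst q" shows "leftmost s = v"
proof (rule leftmostI[OF assms(3)])
  fix q assume q: "q \<in> closure s" "q \<noteq> v"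
  have "fst v \<le> fst q" by (rule closure_fst_ge[OF _ q(1)]) (use assms(4) less_imp_le in blast)
  moreover have "fst v \<noteq> fst q"
    using line_inj[of l v q] closure_on_line[OF assms(1,2)] assms(1,3) q by blast
  ultimately show "fst v < fst q" by simp
qed

lemma leftmost_oseg: "v \<in> sites \<Longrightarrow> l \<in> lines_at v \<Longrightarrow> leftmost (oseg v l) = v"
  by (rule leftmost_on_line[OF oseg_props(6,2,3,4)])

lemma seg_nonempty: "s \<in> segments T D \<Longrightarrow> s \<noteq> {}" using segE by blast

lemma seg_line_unique:
  assumes "s \<in> segments T D" "l \<in> T" "m \<in> T" "s \<subseteq> l" "s \<subseteq> m" shows "l = m"
proof -
  obtain q j where q: "q \<in> s" "q \<in> D" "zeros q = {j}" using segE[OF assms(1)] by metis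
  then have "l = j" "m = j" using zeros_eq[OF q(2)] assms by blast+
  then show ?thesis by simp
qed

text \<open>The left-most point of a segment recovers the site, and the line containing it recovers
  \<open>l\<close>. With \<open>seg_is_oseg\<close>, segments are thus coded by pairs of a site and
  a line through it, so a graph is the same as a choice of departing lines at each site.\<close>

lemma oseg_inj:
  assumes "v \<in> sites" "l \<in> lines_at v" "v' \<in> sites" "l' \<in> lines_at v'" "oseg v l = oseg v' l'"
  shows "v = v' \<and> l = l'"
proof
  show "v = v'" using leftmost_oseg assms by metis
  show "l = l'"
    by (rule seg_line_unique[of "oseg v l"]) (use oseg_props[OF assms(1,2)] oseg_props[OF assms(3,4)] assms(5) in auto)
qed

lemma seg_is_oseg:
  assumes "s \<in> segments T D" shows "\<exists>v\<in>sites. \<exists>l\<in>lines_at v. s = oseg v l"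
proof -
  obtain v where v: "v \<in> sites" "v \<in> closure s" "\<forall>q\<in>s. fst v < fst q" using seg_start[OF assms] by blast
  from v(1) show ?thesis
  proof (cases rule: site_cases)
    case 1
    obtain q where q: "q \<in> s" using seg_nonempty assms by blast
    have "s \<noteq> quad v 0 (-1)" "s \<noteq> quad v 1 0"
      using quad_fst(2)[OF 1, of q 0 "-1"] quad_fst(2)[OF 1, of q 1 0] v(3) q by fastforce+
    then have s: "s = quad v 0 1 \<or> s = quad v (-1) 0" using seg_at_node[OF 1 assms v(2)] by blast
    have "oseg v (up v) = quad v 0 1" "oseg v (lo v) = quad v (-1) 0"
      using 1 node_up_lo(6)[OF 1] unfolding oseg_def by auto
    then show ?thesis using s v(1) 1 unfolding lines_at_def by auto
  next
    case 2
    then have "s = half v 0" using seg_at_entry assms v(2) by blast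
    then have "s = oseg v (lin v)" "lin v \<in> lines_at v" using 2 unfolding oseg_def lines_at_def by auto
    then show ?thesis using v(1) by blast
  qed
qed

lemma segments_leaving_eq:
  assumes "v \<in> sites" "M \<subseteq> lines_at v"
  shows "segments_leaving T D v M = oseg v ` M"
proof (rule set_eqI)
  fix s
  show "s \<in> segments_leaving T D v M \<longleftrightarrow> s \<in> oseg v ` M"
  proof
    assume "s \<in> segments_leaving T D v M"
    then obtain m where s: "s \<in> segments T D" "v \<in> closure s" "\<forall>q\<in>s. fst v < fst q" "m \<in> M" "s \<subseteq> m"
      unfolding segments_leaving_def by blast
    obtain w l where w: "w \<in> sites" "l \<in> lines_at w" "s = oseg w l" using seg_is_oseg[OF s(1)] by blast
    have m: "m \<in> T" using s(4) assms oseg_props(6) by blast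
    have "w = v" using leftmost_on_line[OF m s(5,2,3)] leftmost_oseg[OF w(1,2)] w(3) by simp
    moreover have "l = m" using seg_line_unique[OF s(1) _ m _ s(5)] oseg_props[OF w(1,2)] w(3) by blast
    ultimately show "s \<in> oseg v ` M" using w s by blast
  next
    assume "s \<in> oseg v ` M"
    then obtain m where "m \<in> M" "s = oseg v m" by blast
    then show "s \<in> segments_leaving T D v M"
      using oseg_props[OF assms(1), of m] assms(2) unfolding segments_leaving_def by blast
  qed
qed

text \<open>Of the four segments at the node only the one with signs \<open>(0, -1)\<close> is both
  on the upper line and earlier.\<close>

lemma hit_along_up:
  assumes "v \<in> N" "G \<subseteq> segments T D" shows "hit_along G (up v) v \<longleftrightarrow> quad v 0 (-1) \<in> G"
proof
  assume "hit_along G (up v) v"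
  then obtain s where s: "s \<in> G" "s \<subseteq> up v" "v \<in> closure s" "\<forall>q\<in>s. fst q < fst v" unfolding hit_along_def by blast
  have sg: "s \<in> segments T D" using s(1) assms by blast
  obtain q where q: "q \<in> s" using seg_nonempty[OF sg] by blast
  have "s \<noteq> quad v 0 1" using quad_fst(1)[OF assms(1), of q 0 1] s(4) q by fastforce
  moreover have "s \<noteq> quad v \<sigma> 0" if "\<sigma> \<in> {-1, 1}" for \<sigma>
    using quad_seg_lo(2)[OF assms(1) that] seg_line_unique[OF sg _ _ s(2), of "lo v"] node_up_lo[OF assms(1)] by blast
  ultimately have "s = quad v 0 (-1)" using seg_at_node[OF assms(1) sg s(3)] by blast
  then show "quad v 0 (-1) \<in> G" using s(1) by simp
next
  assume "quad v 0 (-1) \<in> G"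
  moreover have "v \<in> closure (quad v 0 (-1))" using node_in_closure_quad[OF assms(1)] by simp
  ultimately show "hit_along G (up v) v" unfolding hit_along_def
    using quad_seg_up(2)[OF assms(1), of "-1"] quad_fst(2)[OF assms(1), of _ 0 "-1"] by (intro bexI[of _ "quad v 0 (-1)"]) auto
qed

lemma hit_along_lo:
  assumes "v \<in> N" "G \<subseteq> segments T D" shows "hit_along G (lo v) v \<longleftrightarrow> quad v 1 0 \<in> G"
proof
  assume "hit_along G (lo v) v"
  then obtain s where s: "s \<in> G" "s \<subseteq> lo v" "v \<in> closure s" "\<forall>q\<in>s. fst q < fst v" unfolding hit_along_def by blast
  have sg: "s \<in> segments T D" using s(1) assms by blast
  obtain q where q: "q \<in> s" using seg_nonempty[OF sg] by blast
  have "s \<noteq> quad v (-1) 0" using quad_fst(1)[OF assms(1), of q "-1" 0] s(4) q by fastforce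
  moreover have "s \<noteq> quad v 0 \<sigma>" if "\<sigma> \<in> {-1, 1}" for \<sigma>
    using quad_seg_up(2)[OF assms(1) that] seg_line_unique[OF sg _ _ s(2), of "up v"] node_up_lo[OF assms(1)] by blast
  ultimately have "s = quad v 1 0" using seg_at_node[OF assms(1) sg s(3)] by blast
  then show "quad v 1 0 \<in> G" using s(1) by simp
next
  assume "quad v 1 0 \<in> G"
  moreover have "v \<in> closure (quad v 1 0)" using node_in_closure_quad[OF assms(1)] by simp
  ultimately show "hit_along G (lo v) v" unfolding hit_along_def
    using quad_seg_lo(2)[OF assms(1), of 1] quad_fst(2)[OF assms(1), of _ 1 0] by (intro bexI[of _ "quad v 1 0"]) auto
qed

definition stime :: "point set \<Rightarrow> real" where "stime s = fst (leftmost s)"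

lemma stime_oseg: "v \<in> sites \<Longrightarrow> l \<in> lines_at v \<Longrightarrow> stime (oseg v l) = fst v"
  unfolding stime_def using leftmost_oseg by simp

lemma stime_less:
  assumes "s \<in> segments T D" "q \<in> s" shows "stime s < fst q"
proof -
  obtain v l where "v \<in> sites" "l \<in> lines_at v" "s = oseg v l" using seg_is_oseg[OF assms(1)] by blast
  then show ?thesis using stime_oseg oseg_props(4) assms(2) by metis
qed

definition late :: "real set \<Rightarrow> point set \<Rightarrow> bool" where
  "late X C \<longleftrightarrow> C \<in> cells T D \<and> C \<noteq> init \<and> fst (leftmost C) \<in> X"

text \<open>The state of a run that ends in \<open>\<gamma>\<close>, at a moment when the times \<open>X\<close> are still to come.\<close>

definition cut :: "real set \<Rightarrow> config \<Rightarrow> config" where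
  "cut X \<gamma> = ({s \<in> fst \<gamma>. \<not> (s \<in> segments T D \<and> stime s \<in> X)}, \<lambda>C. if late X C then undefined else snd \<gamma> C)"

text \<open>What must have been drawn at \<open>v\<close> in a run that ends in \<gamma>.\<close>

definition outcome :: "config \<Rightarrow> point \<Rightarrow> point set set \<times> nat" where
  "outcome \<gamma> v = ({l \<in> lines_at v. oseg v l \<in> fst \<gamma>}, snd \<gamma> (fcell v))"

lemma cut_empty: "cut {} \<gamma> = \<gamma>" unfolding cut_def late_def by simp

lemma cut_cut: "cut X (cut Y \<gamma>) = cut (X \<union> Y) \<gamma>"
  unfolding cut_def late_def by (auto simp: fun_eq_iff)

lemma sites_at_eq: "sites_at T D t = {v \<in> sites. fst v = t}"
  unfolding sites_at_def sites_def N_def B_def by simp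

lemma finite_sites_at: "finite (sites_at T D t)" unfolding sites_at_eq using finite_sites by simp

lemma fcell_props:
  assumes "v \<in> sites"
  shows "fcell v \<in> cells T D" "fcell v \<noteq> init" "leftmost (fcell v) = v"
  using begins_at_iff[OF assms, of "fcell v"] unfolding begins_at_def by simp_all

lemma begins_now_iff:
  "(\<exists>v\<in>sites_at T D t. begins_at T D C v) \<longleftrightarrow> late {t} C"
proof
  assume "\<exists>v\<in>sites_at T D t. begins_at T D C v"
  then show "late {t} C" unfolding begins_at_def late_def sites_at_eq by auto
next
  assume l: "late {t} C"
  then have "leftmost C \<in> sites_at T D t" using cell_start unfolding late_def sites_at_eq by simp
  moreover have "begins_at T D C (leftmost C)" using l unfolding begins_at_def late_def by simp
  ultimately show "\<exists>v\<in>sites_at T D t. begins_at T D C v" by blast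
qed

text \<open>The outcome functions on which \<open>update\<close> loses no information. The value off
  the sites is the default used in the product measure of a step; it has to be fixed for
  injectivity.\<close>

definition proper :: "real \<Rightarrow> (point \<Rightarrow> point set set \<times> nat) set" where
  "proper t = {out. (\<forall>v. v \<notin> sites_at T D t \<longrightarrow> out v = ({}, 0)) \<and> (\<forall>v\<in>sites_at T D t. fst (out v) \<subseteq> lines_at v)}"

lemma properD:
  assumes "out \<in> proper t" "v \<in> sites_at T D t"
  shows "v \<in> sites" "fst v = t" "fst (out v) \<subseteq> lines_at v" 
proof -
  show "v \<in> sites" "fst v = t" using assms(2) unfolding sites_at_eq by blast+
  show "fst (out v) \<subseteq> lines_at v" using assms unfolding proper_def by blast
qed

lemma update_eq:
  assumes "out \<in> proper t"
  shows "update T D t st out = (fst st \<union> (\<Union>v\<in>sites_at T D t. oseg v ` fst (out v)),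
     \<lambda>C. if late {t} C then snd (out (leftmost C)) else snd st C)"
proof -
  have "segments_leaving T D v (fst (out v)) = oseg v ` fst (out v)" if "v \<in> sites_at T D t" for v
    by (rule segments_leaving_eq[OF properD(1,3)[OF assms that]])
  then have "(\<Union>v\<in>sites_at T D t. segments_leaving T D v (fst (out v))) = (\<Union>v\<in>sites_at T D t. oseg v ` fst (out v))"
    by simp
  then show ?thesis unfolding update_def begins_now_iff by (simp add: case_prod_unfold)
qed

lemma new_seg_time:
  assumes "out \<in> proper t" "s \<in> (\<Union>v\<in>sites_at T D t. oseg v ` fst (out v))"
  shows "s \<in> segments T D" "stime s = t"
proof -
  obtain v l where v: "v \<in> sites_at T D t" "l \<in> fst (out v)" "s = oseg v l" using assms(2) by blast
  then have "v \<in> sites" "l \<in> lines_at v" "fst v = t" using properD[OF assms(1) v(1)] by blast+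
  then show "s \<in> segments T D" "stime s = t" using v(3) oseg_props(1) stime_oseg by auto
qed

text \<open>A step adds only segments and colours that belong to its own time, so hiding this time
  again undoes it.\<close>

lemma cut_update_now:
  assumes "out \<in> proper t" "t \<in> X" shows "cut X (update T D t st out) = cut X st"
proof -
  have "{s \<in> fst st \<union> (\<Union>v\<in>sites_at T D t. oseg v ` fst (out v)). \<not> (s \<in> segments T D \<and> stime s \<in> X)}
      = {s \<in> fst st. \<not> (s \<in> segments T D \<and> stime s \<in> X)}"
    using new_seg_time[OF assms(1)] assms(2) by blast
  moreover have "late {t} C \<Longrightarrow> late X C" for C using assms(2) unfolding late_def by simp
  ultimately show ?thesis unfolding cut_def update_eq[OF assms(1)] by (auto simp: fun_eq_iff)
qed

lemma cut_update_later:
  assumes "out \<in> proper t" "t \<notin> X" "cut X st = st"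
  shows "cut X (update T D t st out) = update T D t st out"
proof -
  have st: "{s \<in> fst st. \<not> (s \<in> segments T D \<and> stime s \<in> X)} = fst st" "late X C \<Longrightarrow> snd st C = undefined" for C
  proof -
    have "fst (cut X st) = fst st" "snd (cut X st) C = snd st C" using assms(3) by simp_all
    then show "{s \<in> fst st. \<not> (s \<in> segments T D \<and> stime s \<in> X)} = fst st" "late X C \<Longrightarrow> snd st C = undefined"
      unfolding cut_def by simp_all
  qed
  have "s \<in> fst st \<Longrightarrow> \<not> (s \<in> segments T D \<and> stime s \<in> X)" for s using st(1) by blast
  moreover have "s \<in> (\<Union>v\<in>sites_at T D t. oseg v ` fst (out v)) \<Longrightarrow> \<not> (s \<in> segments T D \<and> stime s \<in> X)" for s
    using new_seg_time[OF assms(1)] assms(2) by blast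
  ultimately have "{s \<in> fst st \<union> (\<Union>v\<in>sites_at T D t. oseg v ` fst (out v)). \<not> (s \<in> segments T D \<and> stime s \<in> X)}
      = fst st \<union> (\<Union>v\<in>sites_at T D t. oseg v ` fst (out v))"
    by blast
  moreover have "late {t} C \<Longrightarrow> \<not> late X C" for C using assms(2) unfolding late_def by simp
  ultimately show ?thesis unfolding cut_def update_eq[OF assms(1)] using st(2) by (auto simp: fun_eq_iff)
qed

text \<open>Drawing at time \<open>t\<close> exactly what \<gamma> records advances one truncation
  of \<gamma> to the next.\<close>

lemma update_outcome:
  assumes "fst \<gamma> \<subseteq> segments T D" "t \<notin> X"
    and out: "out = (\<lambda>v. if v \<in> sites_at T D t then outcome \<gamma> v else ({}, 0))"
  shows "update T D t (cut (insert t X) \<gamma>) out = cut X \<gamma>" "out \<in> proper t"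
proof -
  show p: "out \<in> proper t" unfolding proper_def out outcome_def by auto
  have sg: "fst (cut (insert t X) \<gamma>) \<union> (\<Union>v\<in>sites_at T D t. oseg v ` fst (out v)) = fst (cut X \<gamma>)"
  proof (rule set_eqI)
    fix s
    show "s \<in> fst (cut (insert t X) \<gamma>) \<union> (\<Union>v\<in>sites_at T D t. oseg v ` fst (out v)) \<longleftrightarrow> s \<in> fst (cut X \<gamma>)"
    proof (cases "s \<in> segments T D \<and> stime s = t")
      case True
      then obtain v l where v: "v \<in> sites" "l \<in> lines_at v" "s = oseg v l" using seg_is_oseg by blast
      then have vt: "v \<in> sites_at T D t" using True stime_oseg unfolding sites_at_eq by auto
      have "s \<in> (\<Union>v\<in>sites_at T D t. oseg v ` fst (out v)) \<longleftrightarrow> s \<in> fst \<gamma>"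
      proof
        assume "s \<in> fst \<gamma>"
        then have "l \<in> fst (out v)" using v vt unfolding out outcome_def by simp
        then show "s \<in> (\<Union>v\<in>sites_at T D t. oseg v ` fst (out v))" using v vt by blast
      qed (auto simp: out outcome_def)
      then show ?thesis using True assms(2) unfolding cut_def by simp
    next
      case False
      then have "s \<notin> (\<Union>v\<in>sites_at T D t. oseg v ` fst (out v))" using new_seg_time[OF p] by blast
      then show ?thesis using False unfolding cut_def by auto
    qed
  qed
  have col: "(if late {t} C then snd (out (leftmost C)) else snd (cut (insert t X) \<gamma>) C) = snd (cut X \<gamma>) C" for C
  proof (cases "late {t} C")
    case True
    then have C: "C \<in> cells T D" "C \<noteq> init" "leftmost C \<in> sites" "fst (leftmost C) = t"
      using cell_start unfolding late_def by auto
    then have "begins_at T D C (leftmost C)" unfolding begins_at_def by simp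
    then have "fcell (leftmost C) = C" using begins_at_iff[OF C(3)] by simp
    then have "snd (out (leftmost C)) = snd \<gamma> C" using C unfolding out outcome_def sites_at_eq by simp
    moreover have "\<not> late X C" using C assms(2) unfolding late_def by simp
    ultimately show ?thesis using True unfolding cut_def by simp
  next
    case False
    then have "late (insert t X) C \<longleftrightarrow> late X C" unfolding late_def by auto
    then show ?thesis using False unfolding cut_def by simp
  qed
  show "update T D t (cut (insert t X) \<gamma>) out = cut X \<gamma>"
    unfolding update_eq[OF p] sg col by simp
qed

text \<open>Nothing that belongs to time \<open>t\<close> is in the state yet, so the added segments
  can be recognised; each remembers its site and line, and the colour drawn at a site is found in
  the cell that begins there.\<close>

lemma update_inj:
  assumes "cut {t} st = st" shows "inj_on (update T D t st) (proper t)"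
proof (rule inj_onI)
  have notin: "s \<notin> fst st" if "s \<in> segments T D" "stime s = t" for s
  proof
    assume "s \<in> fst st"
    then have "s \<in> fst (cut {t} st)" using assms by simp
    then show False using that unfolding cut_def by simp
  qed
  fix x y assume p: "x \<in> proper t" "y \<in> proper t" and e: "update T D t st x = update T D t st y"
  have sub: "fst (x v) \<subseteq> fst (y v)" if v: "v \<in> sites_at T D t" and p: "x \<in> proper t" "y \<in> proper t"
    and e: "update T D t st x = update T D t st y" for x y v
  proof
    fix l assume l: "l \<in> fst (x v)"
    have vs: "v \<in> sites" "l \<in> lines_at v" "fst v = t" using properD[OF p(1) v] l by blast+
    have "oseg v l \<in> fst (update T D t st x)" unfolding update_eq[OF p(1)] using v l by auto
    then have "oseg v l \<in> fst (update T D t st y)" using e by simp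
    moreover have "oseg v l \<notin> fst st" using notin oseg_props(1)[OF vs(1,2)] stime_oseg[OF vs(1,2)] vs(3) by simp
    ultimately obtain w m where w: "w \<in> sites_at T D t" "m \<in> fst (y w)" "oseg v l = oseg w m"
      unfolding update_eq[OF p(2)] by auto
    then have "w \<in> sites" "m \<in> lines_at w" using properD[OF p(2) w(1)] by blast+
    then have "v = w" "l = m" using oseg_inj[OF vs(1,2)] w(3) by blast+
    then show "l \<in> fst (y v)" using w(2) by simp
  qed
  show "x = y"
  proof
    fix v
    show "x v = y v"
    proof (cases "v \<in> sites_at T D t")
      case True
      then have v: "v \<in> sites" "fst v = t" unfolding sites_at_eq by auto
      have l: "late {t} (fcell v)" using fcell_props[OF v(1)] v(2) unfolding late_def by simp
      have "snd (update T D t st x) (fcell v) = snd (update T D t st y) (fcell v)" using e by simp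
      then have "snd (x v) = snd (y v)"
        unfolding update_eq[OF p(1)] update_eq[OF p(2)] using l fcell_props(3)[OF v(1)] by simp
      moreover have "fst (x v) = fst (y v)" using sub[OF True p e] sub[OF True p(2,1) e[symmetric]] by blast
      ultimately show ?thesis by (simp add: prod_eq_iff)
    next
      case False
      then have "x v = ({}, 0)" "y v = ({}, 0)" using p unfolding proper_def by blast+
      then show ?thesis by simp
    qed
  qed
qed

end

section \<open>Parameters as probabilities, and the law of a run\<close>

locale field_setting = tessellated_window T D for T D +
  fixes \<pi> :: "point set \<Rightarrow> real" and k :: nat and \<alpha> :: real
  assumes pi_bounds: "\<And>l. l \<in> T \<Longrightarrow> 0 < \<pi> l" "\<And>l. l \<in> T \<Longrightarrow> \<pi> l < 1"
    and k2: "2 \<le> k" and aV: "0 \<le> \<alpha>" "\<alpha> \<le> 1"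
begin

abbreviation "outcome_law \<equiv> site_outcome T \<pi> D k \<alpha>"
abbreviation "dynamics \<equiv> particle_dynamics T \<pi> D k \<alpha>"
abbreviation "energy \<equiv> Phi T \<pi> D k \<alpha>"
abbreviation "\<epsilon> \<equiv> eps k \<alpha>"
abbreviation "K \<equiv> real k - 1"
abbreviation "aX \<equiv> alpha_X \<alpha>"
abbreviation "aT \<equiv> alpha_T k \<alpha>"

lemma K_pos: "1 \<le> K" "0 < K" using k2 by auto

lemma aX_bounds: "0 \<le> aX" "aX \<le> 1" using aV unfolding alpha_X_def by auto

text \<open>The origin of \<open>alpha_T\<close>: the two outcomes with one survivor share equally
  what the survival of both leaves over.\<close>

lemma aT_eq: "(real k - 2) * aX / K = 1 - 2 * aT"
proof -
  have "2 * ((1 - x) / 2) = 1 - x" for x :: real by simp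
  note h = this
  show ?thesis unfolding alpha_T_def h by simp
qed

text \<open>Strict even for \<alpha> = 0, as (k - 2) / (k - 1) < 1. Hence T-vertices never make the
  energy infinite; only V- and X-vertices can.\<close>

lemma aT_pos: "0 < aT"
proof -
  have "(real k - 2) / K * aX \<le> (real k - 2) / K * 1"
    using aX_bounds k2 by (intro mult_left_mono) auto
  also have "\<dots> < 1" using K_pos by (simp add: divide_less_eq)
  finally show ?thesis unfolding alpha_T_def by simp
qed

lemma aT_le: "aT \<le> 1"
proof -
  have "0 \<le> (real k - 2) / K * aX" using aX_bounds k2 by simp
  then show ?thesis unfolding alpha_T_def by simp
qed

lemma eps_bounds: "0 \<le> \<epsilon>" "\<epsilon> \<le> 1"
proof -
  show "0 \<le> \<epsilon>" unfolding eps_def using aV aT_pos k2 by simp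
  have "(real k - 2) * aT \<le> (real k - 2) * 1" using aT_le k2 by (intro mult_left_mono) auto
  then have "\<alpha> + (real k - 2) * aT \<le> K" using aV by simp
  moreover have "\<epsilon> = (\<alpha> + (real k - 2) * aT) / K" unfolding eps_def by (simp add: add_divide_distrib)
  ultimately show "\<epsilon> \<le> 1" using K_pos by simp
qed

lemma eps_pi: assumes "l \<in> T" shows "0 < 1 - \<epsilon> * \<pi> l" "1 - \<epsilon> * \<pi> l \<le> 1"
proof -
  have "\<epsilon> * \<pi> l \<le> 1 * \<pi> l" using eps_bounds pi_bounds[OF assms] by (intro mult_right_mono) auto
  then show "0 < 1 - \<epsilon> * \<pi> l" using pi_bounds[OF assms] by linarith
  show "1 - \<epsilon> * \<pi> l \<le> 1" using eps_bounds pi_bounds[OF assms] by simp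
qed

lemma collision_wf:
  "pmf_of_list_wf [({}, \<alpha>), ({u, l}, aX)]"
  "pmf_of_list_wf [({u}, aT), ({l}, aT), ({u, l}, (real k - 2) * aX / K)]"
proof -
  show "pmf_of_list_wf [({}, \<alpha>), ({u, l}, aX)]"
    using aV by (auto simp: pmf_of_list_wf_def alpha_X_def)
  have "0 \<le> (real k - 2) * aX / K" using aX_bounds k2 by simp
  then show "pmf_of_list_wf [({u}, aT), ({l}, aT), ({u, l}, (real k - 2) * aX / K)]"
    using aT_pos unfolding aT_eq by (simp add: pmf_of_list_wf_def)
qed

text \<open>The probabilities of turning and of splitting add up to
  \<open>\<epsilon> * \<pi> m'\<close>, which is the origin of \<epsilon>.\<close>

lemma passage_wf:
  assumes "m' \<in> T"
  shows "pmf_of_list_wf [({m'}, \<alpha> * \<pi> m' / K), ({m, m'}, (real k - 2) * aT * \<pi> m' / K), ({m}, 1 - \<epsilon> * \<pi> m')]"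
  using aV pi_bounds[OF assms] aT_pos k2 eps_pi[OF assms]
  by (auto simp: pmf_of_list_wf_def eps_def add_divide_distrib algebra_simps)

lemma set_pmf_collision: "M \<in> set_pmf (collision k \<alpha> u l a b) \<Longrightarrow> M \<subseteq> {u, l}"
  using set_pmf_of_list[OF collision_wf(1)[of u l]] set_pmf_of_list[OF collision_wf(2)[of u l]]
  unfolding collision_def by (auto split: if_splits)

lemma set_pmf_passage: "m' \<in> T \<Longrightarrow> M \<in> set_pmf (passage \<pi> k \<alpha> m m') \<Longrightarrow> M \<subseteq> {m, m'}"
  using set_pmf_of_list[OF passage_wf[of m' m]] unfolding passage_def by auto

lemma set_pmf_leave: "x \<in> set_pmf (leave k u l a b X M) \<Longrightarrow> fst x = M"
  unfolding leave_def by (auto split: if_splits)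

lemma set_pmf_bind_leave: "x \<in> set_pmf (p \<bind> leave k u l a b X) \<Longrightarrow> fst x \<in> set_pmf p"
  using set_pmf_leave by (auto dest!: set_pmf_leave)

lemma site_outcome_lines:
  assumes "v \<in> sites" "x \<in> set_pmf (outcome_law st v)" shows "fst x \<subseteq> lines_at v"
  using assms(1)
proof (cases rule: site_cases)
  case 1
  then have n: "v \<in> nodes T" unfolding N_def by simp
  note ul = node_up_lo(7,8)[OF 1]
  let ?u = "up v" and ?l = "lo v"
  have la: "lines_at v = {?u, ?l}" using 1 unfolding lines_at_def by simp
  define a b w where "a = snd st (cell_above T D v)" "b = snd st (cell_below T D v)" "w = snd st (cell_before T D v)"
  have "x \<in> set_pmf (node_outcome T \<pi> D k \<alpha> st v)" using assms(2) n unfolding site_outcome_def by simp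
  then have "x \<in> (\<Union>birth\<in>set_pmf (bernoulli_pmf (\<alpha> * \<pi> ?u * \<pi> ?l / K)).
     set_pmf (if hit_along (fst st) ?u v \<and> hit_along (fst st) ?l v then
            collision k \<alpha> ?u ?l a b \<bind> leave k ?u ?l a b {a, b}
          else if hit_along (fst st) ?u v then
            passage \<pi> k \<alpha> ?u ?l \<bind> leave k ?u ?l a b {w, b}
          else if hit_along (fst st) ?l v then
            passage \<pi> k \<alpha> ?l ?u \<bind> leave k ?u ?l a b {a, w}
          else
            leave k ?u ?l a b {w} (if birth then {?u, ?l} else {})))"
    unfolding node_outcome_def case_prod_unfold Let_def set_bind_pmf a_b_w_def by simp
  then obtain birth where x: "x \<in> set_pmf (if hit_along (fst st) ?u v \<and> hit_along (fst st) ?l v then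
            collision k \<alpha> ?u ?l a b \<bind> leave k ?u ?l a b {a, b}
          else if hit_along (fst st) ?u v then
            passage \<pi> k \<alpha> ?u ?l \<bind> leave k ?u ?l a b {w, b}
          else if hit_along (fst st) ?l v then
            passage \<pi> k \<alpha> ?l ?u \<bind> leave k ?u ?l a b {a, w}
          else
            leave k ?u ?l a b {w} (if birth then {?u, ?l} else {}))" by blast
  consider "hit_along (fst st) ?u v \<and> hit_along (fst st) ?l v"
    | "hit_along (fst st) ?u v" "\<not> hit_along (fst st) ?l v"
    | "\<not> hit_along (fst st) ?u v" "hit_along (fst st) ?l v"
    | "\<not> hit_along (fst st) ?u v" "\<not> hit_along (fst st) ?l v" by blast
  then show ?thesis unfolding la
  proof cases
    case 1
    then have "x \<in> set_pmf (collision k \<alpha> ?u ?l a b \<bind> leave k ?u ?l a b {a, b})" using x by (simp only: if_True simp_thms)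
    then show "fst x \<subseteq> {?u, ?l}" using set_pmf_bind_leave set_pmf_collision by blast
  next
    case 2
    then have "x \<in> set_pmf (passage \<pi> k \<alpha> ?u ?l \<bind> leave k ?u ?l a b {w, b})"
      using x by (simp only: if_True if_False simp_thms)
    then show "fst x \<subseteq> {?u, ?l}" using set_pmf_bind_leave set_pmf_passage[OF ul(2)] by blast
  next
    case 3
    then have "x \<in> set_pmf (passage \<pi> k \<alpha> ?l ?u \<bind> leave k ?u ?l a b {a, w})"
      using x by (simp only: if_True if_False simp_thms)
    then show "fst x \<subseteq> {?u, ?l}" using set_pmf_bind_leave set_pmf_passage[OF ul(1)] by blast
  next
    case 4
    then have "x \<in> set_pmf (leave k ?u ?l a b {w} (if birth then {?u, ?l} else {}))"
      using x by (simp only: if_True if_False simp_thms)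
    from set_pmf_leave[OF this] show "fst x \<subseteq> {?u, ?l}" by simp
  qed
next
  case 2
  then have n: "v \<notin> nodes T" using entry_not_node by simp
  show ?thesis
    using assms(2) n 2 unfolding site_outcome_def entry_outcome_def lines_at_def lin_def
    by (auto simp: Let_def case_prod_unfold split: if_splits)
qed

text \<open>The law at \<open>v\<close> reads only arriving segments and the colours of cells
  before, above and below; all these start strictly before \<open>v\<close> or are initial. So even
  the time of \<open>v\<close> itself may be hidden: simultaneous sites do not see each
  other.\<close>

lemma site_outcome_cut:
  assumes "v \<in> sites" "fst \<gamma> \<subseteq> segments T D" "\<And>x. x \<in> X \<Longrightarrow> fst v \<le> x"
  shows "outcome_law (cut X \<gamma>) v = outcome_law \<gamma> v"
proof -
  have cG: "fst (cut X \<gamma>) \<subseteq> segments T D" using assms(2) unfolding cut_def by auto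
  have col: "snd (cut X \<gamma>) C = snd \<gamma> C" if "C = init \<or> fst (leftmost C) < fst v" for C
    using that assms(3)[of "fst (leftmost C)"] unfolding cut_def late_def by auto
  from assms(1) show ?thesis
  proof (cases rule: site_cases)
    case 1
    have n: "v \<in> nodes T" using 1 unfolding N_def by simp
    have seg: "s \<in> fst (cut X \<gamma>) \<longleftrightarrow> s \<in> fst \<gamma>" if "s \<in> segments T D" "q \<in> s" "fst q < fst v" for s q
      using stime_less[OF that(1,2)] assms(3)[of "stime s"] that unfolding cut_def by auto
    obtain q1 q2 where q: "q1 \<in> quad v 0 (-1)" "q2 \<in> quad v 1 0"
      using quad_nonempty[OF 1, of 0 "-1"] quad_nonempty[OF 1, of 1 0] by auto
    have h: "hit_along (fst (cut X \<gamma>)) (up v) v = hit_along (fst \<gamma>) (up v) v"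
      "hit_along (fst (cut X \<gamma>)) (lo v) v = hit_along (fst \<gamma>) (lo v) v"
      unfolding hit_along_up[OF 1 cG] hit_along_lo[OF 1 cG] hit_along_up[OF 1 assms(2)] hit_along_lo[OF 1 assms(2)]
      using seg[OF _ q(1)] seg[OF _ q(2)] quad_fst(2)[OF 1 q(1)] quad_fst(2)[OF 1 q(2)]
        quad_seg_up(1)[OF 1, of "-1"] quad_seg_lo(1)[OF 1, of 1] by auto
    have c: "snd (cut X \<gamma>) (cell_above T D v) = snd \<gamma> (cell_above T D v)"
      "snd (cut X \<gamma>) (cell_below T D v) = snd \<gamma> (cell_below T D v)"
      "snd (cut X \<gamma>) (cell_before T D v) = snd \<gamma> (cell_before T D v)"
      unfolding cell_above_node[OF 1] cell_below_node[OF 1] cell_before_node[OF 1]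
      using col leftmost_AB[OF 1, of 1] leftmost_AB[OF 1, of "-1"] leftmost_W[OF 1] by auto
    show ?thesis using n unfolding site_outcome_def node_outcome_def case_prod_unfold Let_def h c by simp
  next
    case 2
    have n: "v \<notin> nodes T" using entry_not_node 2 by simp
    have "cell_before_entry T D v = init \<or> fst (leftmost (cell_before_entry T D v)) < fst v"
      using begins_at_entry[OF 2(1)] by auto
    then have "snd (cut X \<gamma>) (cell_before_entry T D v) = snd \<gamma> (cell_before_entry T D v)" by (rule col)
    then show ?thesis using n unfolding site_outcome_def entry_outcome_def case_prod_unfold by simp
  qed
qed

lemma Pi_proper: "set_pmf (Pi_pmf (sites_at T D t) ({}, 0) (outcome_law st)) \<subseteq> proper t"
proof -
  have "sites_at T D t \<subseteq> sites" unfolding sites_at_eq by blast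
  then show ?thesis
    using site_outcome_lines unfolding set_Pi_pmf[OF finite_sites_at] PiE_dflt_def proper_def comp_def by blast
qed

lemma set_pmf_step:
  assumes "st' \<in> set_pmf (step T \<pi> D k \<alpha> st t)"
  shows "\<exists>out\<in>proper t. st' = update T D t st out"
proof -
  obtain out where o: "st' = update T D t st out"
    "out \<in> set_pmf (Pi_pmf (sites_at T D t) ({}, 0) (outcome_law st))"
    using assms unfolding step_def by auto
  have "out \<in> proper t" using o(2) Pi_proper by blast
  then show ?thesis using o(1) by blast
qed

text \<open>By injectivity of \<open>update\<close> exactly one outcome function leads to the next
  truncation of \<gamma>, and independence turns its probability into a product. The laws are then
  evaluated at \<gamma> instead of the current state.\<close>

lemma pmf_step:
  assumes "cut (insert t X) st = st" "t \<notin> X" "fst \<gamma> \<subseteq> segments T D" "\<And>x. x \<in> X \<Longrightarrow> t \<le> x"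
  shows "pmf (step T \<pi> D k \<alpha> st t) (cut X \<gamma>) =
    (if st = cut (insert t X) \<gamma> then \<Prod>v\<in>sites_at T D t. pmf (outcome_law \<gamma> v) (outcome \<gamma> v) else 0)"
proof (cases "st = cut (insert t X) \<gamma>")
  case True
  define out where "out = (\<lambda>v. if v \<in> sites_at T D t then outcome \<gamma> v else ({}, 0))"
  note uo = update_outcome[OF assms(3,2) out_def]
  have "cut {t} st = st" unfolding True cut_cut by simp
  then have inj: "inj_on (update T D t st) (proper t)" by (rule update_inj)
  let ?P = "Pi_pmf (sites_at T D t) ({}, 0) (outcome_law st)"
  have sub: "set_pmf ?P \<subseteq> proper t" by (rule Pi_proper)
  have "pmf (step T \<pi> D k \<alpha> st t) (cut X \<gamma>) = pmf (map_pmf (update T D t st) ?P) (update T D t st out)"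
    unfolding step_def using uo(1) True by simp
  also have "\<dots> = pmf ?P out" by (rule pmf_map_inj_on[OF inj sub uo(2)])
  also have "\<dots> = (\<Prod>v\<in>sites_at T D t. pmf (outcome_law st v) (out v))"
    by (subst pmf_Pi[OF finite_sites_at]) (auto simp: out_def)
  also have "\<dots> = (\<Prod>v\<in>sites_at T D t. pmf (outcome_law \<gamma> v) (outcome \<gamma> v))"
  proof (rule prod.cong[OF refl])
    fix v assume v: "v \<in> sites_at T D t"
    then have "outcome_law st v = outcome_law \<gamma> v"
      unfolding True using assms(3,4) by (intro site_outcome_cut) (auto simp: sites_at_eq)
    then show "pmf (outcome_law st v) (out v) = pmf (outcome_law \<gamma> v) (outcome \<gamma> v)"
      using v unfolding out_def by simp
  qed
  finally show ?thesis using True by simp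
next
  case False
  have "cut X \<gamma> \<notin> set_pmf (step T \<pi> D k \<alpha> st t)"
  proof
    assume "cut X \<gamma> \<in> set_pmf (step T \<pi> D k \<alpha> st t)"
    then obtain out where o: "out \<in> proper t" "cut X \<gamma> = update T D t st out" using set_pmf_step by blast
    \<comment> \<open>Hiding time \<open>t\<close> again recovers the previous state from the next
      one, so a different previous state cannot lead there.\<close>
    have "cut (insert t X) (cut X \<gamma>) = cut (insert t X) st" using cut_update_now[OF o(1)] o(2) by simp
    then show False using False assms(1) unfolding cut_cut by (simp add: insert_absorb2 Un_absorb)
  qed
  then show ?thesis using False by (simp add: pmf_eq_0_set_pmf)
qed

text \<open>Segments and colours are never revised, so a run ending in \<gamma> must pass through
  the truncations of \<gamma>; the sum over paths has one term.\<close>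

lemma pmf_run:
  assumes "sorted_wrt (<) ts" "cut (set ts) st = st" "fst st \<subseteq> segments T D"
  shows "pmf (run T \<pi> D k \<alpha> ts st) \<gamma> =
    (if st = cut (set ts) \<gamma> then \<Prod>v\<in>{v\<in>sites. fst v \<in> set ts}. pmf (outcome_law \<gamma> v) (outcome \<gamma> v) else 0)"
  using assms
proof (induction ts arbitrary: st)
  case Nil
  then show ?case by (auto simp: cut_empty)
next
  case (Cons t ts)
  let ?X = "set ts"
  let ?f = "\<lambda>v. pmf (outcome_law \<gamma> v) (outcome \<gamma> v)"
  have t: "t \<notin> ?X" "\<And>x. x \<in> ?X \<Longrightarrow> t \<le> x" using Cons.prems(1) by auto
  have st: "cut (insert t ?X) st = st" using Cons.prems(2) by simp
  have stX: "cut ?X st = st" using st cut_cut[of ?X "insert t ?X" st] by (simp add: Un_absorb1 subset_insertI)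
  have IH: "pmf (run T \<pi> D k \<alpha> ts st') \<gamma> = (if st' = cut ?X \<gamma> then \<Prod>v\<in>{v\<in>sites. fst v \<in> ?X}. ?f v else 0)"
    if st': "st' \<in> set_pmf (step T \<pi> D k \<alpha> st t)" for st'
  proof -
    obtain out where o: "out \<in> proper t" "st' = update T D t st out" using set_pmf_step st' by blast
    show ?thesis
    proof (rule Cons.IH)
      show "sorted_wrt (<) ts" using Cons.prems(1) by simp
      show "cut ?X st' = st'" unfolding o(2) by (rule cut_update_later[OF o(1) t(1) stX])
      show "fst st' \<subseteq> segments T D"
        unfolding o(2) update_eq[OF o(1)] using Cons.prems(3) new_seg_time(1)[OF o(1)] by auto
    qed
  qed
  \<comment> \<open>The final \<gamma> is arbitrary here, possibly with a graph that is no set of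
    segments; such a graph is caught because its truncation is not reachable.\<close>
  have seg: "fst \<gamma> \<subseteq> segments T D" if supp: "cut ?X \<gamma> \<in> set_pmf (step T \<pi> D k \<alpha> st t)"
  proof -
    obtain out where o: "out \<in> proper t" "cut ?X \<gamma> = update T D t st out" using set_pmf_step[OF supp] by blast
    have "fst (cut ?X \<gamma>) \<subseteq> segments T D"
      unfolding o(2) update_eq[OF o(1)] using Cons.prems(3) new_seg_time(1)[OF o(1)] by auto
    then show ?thesis unfolding cut_def by auto
  qed
  have "pmf (run T \<pi> D k \<alpha> (t # ts) st) \<gamma>
      = measure_pmf.expectation (step T \<pi> D k \<alpha> st t) (\<lambda>st'. pmf (run T \<pi> D k \<alpha> ts st') \<gamma>)"
    by (simp add: pmf_bind)
  \<comment> \<open>By the induction hypothesis only the state \<open>cut ?X \<gamma>\<close> can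
    lead to \<gamma>, so the expectation collapses to one term.\<close>
  also have "\<dots> = (\<Sum>st'\<in>{cut ?X \<gamma>}. pmf (run T \<pi> D k \<alpha> ts st') \<gamma> * pmf (step T \<pi> D k \<alpha> st t) st')"
    using IH by (intro integral_measure_pmf_real) (auto split: if_splits)
  also have "\<dots> = (\<Prod>v\<in>{v\<in>sites. fst v \<in> ?X}. ?f v) * pmf (step T \<pi> D k \<alpha> st t) (cut ?X \<gamma>)"
    using IH[of "cut ?X \<gamma>"] by (cases "cut ?X \<gamma> \<in> set_pmf (step T \<pi> D k \<alpha> st t)") (auto simp: set_pmf_iff)
  also have "\<dots> = (if st = cut (set (t # ts)) \<gamma> then \<Prod>v\<in>{v\<in>sites. fst v \<in> set (t # ts)}. ?f v else 0)"
  proof (cases "fst \<gamma> \<subseteq> segments T D")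
    case True
    have "{v\<in>sites. fst v \<in> set (t # ts)} = sites_at T D t \<union> {v\<in>sites. fst v \<in> ?X}" unfolding sites_at_eq by auto
    then have pe: "(\<Prod>v\<in>{v\<in>sites. fst v \<in> set (t # ts)}. ?f v) = (\<Prod>v\<in>sites_at T D t. ?f v) * (\<Prod>v\<in>{v\<in>sites. fst v \<in> ?X}. ?f v)"
      using t(1) finite_sites by (simp only:) (rule prod.union_disjoint, auto simp: sites_at_eq)
    have ps: "pmf (step T \<pi> D k \<alpha> st t) (cut ?X \<gamma>) =
      (if st = cut (insert t ?X) \<gamma> then \<Prod>v\<in>sites_at T D t. ?f v else 0)"
      by (rule pmf_step[OF st t(1) True]) (rule t(2))
    have ins: "set (t # ts) = insert t ?X" by simp
    show ?thesis
    proof (cases "st = cut (insert t ?X) \<gamma>")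
      case True
      have st': "st = cut (set (t # ts)) \<gamma>" unfolding ins by (rule True)
      show ?thesis unfolding if_P[OF st'] pe ps if_P[OF True] by (rule mult.commute)
    next
      case False
      have st': "st \<noteq> cut (set (t # ts)) \<gamma>" unfolding ins by (rule False)
      show ?thesis unfolding if_not_P[OF st'] ps if_not_P[OF False] by simp
    qed
  next
    case False
    then have "pmf (step T \<pi> D k \<alpha> st t) (cut ?X \<gamma>) = 0" using seg by (auto simp: pmf_eq_0_set_pmf)
    moreover have "st \<noteq> cut (set (t # ts)) \<gamma>"
      using False Cons.prems(3) unfolding cut_def by auto
    ultimately show ?thesis by simp
  qed
  finally show ?case .
qed

text \<open>When all sites are still to come, truncation hides every segment and every colour but
  that of the initial cell. What stays visible is junk, which must be absent: elements of the graph
  that are not segments, and colours of sets that are not cells.\<close>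

lemma initial_state_iff:
  "({}, \<lambda>C. if C = init then i else undefined) = cut (fst ` sites) (G, c) \<longleftrightarrow>
    G \<subseteq> segments T D \<and> (\<forall>C. C \<notin> cells T D \<longrightarrow> c C = undefined) \<and> c init = i"
proof -
  have late: "late (fst ` sites) C \<longleftrightarrow> C \<in> cells T D \<and> C \<noteq> init" for C
    unfolding late_def using cell_start[of C] by (cases "C \<in> cells T D \<and> C \<noteq> init") auto
  have "s \<in> segments T D \<and> stime s \<in> fst ` sites \<longleftrightarrow> s \<in> segments T D" for s
    using seg_is_oseg[of s] stime_oseg by fastforce
  then have "{} = fst (cut (fst ` sites) (G, c)) \<longleftrightarrow> G \<subseteq> segments T D" unfolding cut_def by auto
  moreover have "(\<lambda>C. if C = init then i else undefined) = snd (cut (fst ` sites) (G, c)) \<longleftrightarrow>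
      (\<forall>C. C \<notin> cells T D \<longrightarrow> c C = undefined) \<and> c init = i"
  proof -
    have i: "init \<in> cells T D" using initial_cell_in by blast
    have "(if C = init then i else undefined) = (if late (fst ` sites) C then undefined else c C) \<longleftrightarrow>
      (C \<notin> cells T D \<longrightarrow> c C = undefined) \<and> (C = init \<longrightarrow> c init = i)" for C
      unfolding late using i by (cases "C = init"; cases "C \<in> cells T D") (simp_all add: eq_commute)
    then show ?thesis unfolding cut_def fun_eq_iff snd_conv by (metis (no_types))
  qed
  ultimately show ?thesis unfolding prod_eq_iff fst_conv snd_conv by blast
qed

theorem pmf_dynamics:
  "pmf (dynamics) (G, c) =
    (if G \<subseteq> segments T D \<and> (\<forall>C. C \<notin> cells T D \<longrightarrow> c C = undefined) \<and> c init \<in> {1..k}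
     then (\<Prod>v\<in>sites. pmf (outcome_law (G, c) v) (outcome (G, c) v)) / k else 0)"
proof -
  let ?X = "fst ` sites"
  let ?ts = "sorted_list_of_set ?X"
  let ?P = "\<Prod>v\<in>sites. pmf (outcome_law (G, c) v) (outcome (G, c) v)"
  have ts: "sorted_wrt (<) ?ts" "set ?ts = ?X" using finite_sites by auto
  have X: "fst ` ((nodes T \<inter> D) \<union> entry_points T D) = ?X" unfolding sites_def N_def B_def by simp
  have all: "{v\<in>sites. fst v \<in> ?X} = sites" by auto
  have r: "pmf (run T \<pi> D k \<alpha> ?ts ({}, \<lambda>C. if C = init then i else undefined)) (G, c) =
    (if G \<subseteq> segments T D \<and> (\<forall>C. C \<notin> cells T D \<longrightarrow> c C = undefined) \<and> c init = i then ?P else 0)" for i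
    using pmf_run[OF ts(1), of "({}, \<lambda>C. if C = init then i else undefined)" "(G, c)"]
    unfolding ts(2) all initial_state_iff by (auto simp: cut_def late_def fun_eq_iff)
  have "pmf (dynamics) (G, c) = (\<Sum>i\<in>{1..k}.
     if G \<subseteq> segments T D \<and> (\<forall>C. C \<notin> cells T D \<longrightarrow> c C = undefined) \<and> c init = i then ?P else 0) / k"
    unfolding particle_dynamics_def X using k2 by (subst pmf_bind_pmf_of_set) (auto simp: r)
  also have "(\<Sum>i\<in>{1..k}.
     if G \<subseteq> segments T D \<and> (\<forall>C. C \<notin> cells T D \<longrightarrow> c C = undefined) \<and> c init = i then ?P else 0) =
     (if G \<subseteq> segments T D \<and> (\<forall>C. C \<notin> cells T D \<longrightarrow> c C = undefined) \<and> c init \<in> {1..k} then ?P else 0)"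
    by (rule sum_if_eq) simp
  finally show ?thesis by (simp only: if_distrib[of "\<lambda>x. x / real k"] div_0)
qed

end

section \<open>Consistent colourings and local probabilities\<close>

lemma card_Int_four:
  assumes "distinct [a, b, c, d]"
  shows "card (G \<inter> {a, b, c, d}) = of_bool (a \<in> G) + of_bool (b \<in> G) + of_bool (c \<in> G) + of_bool (d \<in> G)"
  using assms by (cases "a \<in> G"; cases "b \<in> G"; cases "c \<in> G"; cases "d \<in> G") (auto simp: Int_insert_right)

context tessellated_window begin

text \<open>The colour condition of \<open>configs\<close> for a single segment, isolated so that it
  can be established site by site.\<close>

definition consistent :: "point set set \<Rightarrow> (point set \<Rightarrow> nat) \<Rightarrow> point set \<Rightarrow> bool" where
  "consistent G c s \<longleftrightarrow> (\<forall>C \<in> cells T D. \<forall>C' \<in> cells T D.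
        C \<noteq> C' \<and> s \<subseteq> closure C \<inter> closure C' \<longrightarrow> (s \<in> G \<longleftrightarrow> c C \<noteq> c C'))"

lemma consistent_iff:
  assumes "C1 \<in> cells T D" "C2 \<in> cells T D" "C1 \<noteq> C2" "s \<subseteq> closure C1" "s \<subseteq> closure C2"
    and "\<And>C. C \<in> cells T D \<Longrightarrow> s \<subseteq> closure C \<Longrightarrow> C = C1 \<or> C = C2"
  shows "consistent G c s \<longleftrightarrow> (s \<in> G \<longleftrightarrow> c C1 \<noteq> c C2)"
proof
  assume "consistent G c s"
  then show "s \<in> G \<longleftrightarrow> c C1 \<noteq> c C2" unfolding consistent_def using assms(1-5) by blast
next
  assume h: "s \<in> G \<longleftrightarrow> c C1 \<noteq> c C2"
  show "consistent G c s" unfolding consistent_def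
  proof (intro ballI impI)
    fix C C' assume C: "C \<in> cells T D" "C' \<in> cells T D" "C \<noteq> C' \<and> s \<subseteq> closure C \<inter> closure C'"
    then have "C = C1 \<and> C' = C2 \<or> C = C2 \<and> C' = C1" using assms(6)[of C] assms(6)[of C'] by blast
    then show "s \<in> G \<longleftrightarrow> c C \<noteq> c C'" using h by metis
  qed
qed

lemma quad_subset_closure:
  assumes "v \<in> N" "\<sigma> \<in> {-1, 0, 1}" "\<tau> \<in> {-1, 0, 1}" "\<sigma>' \<in> {-1, 0, 1}" "\<tau>' \<in> {-1, 0, 1}"
  shows "quad v \<sigma>' \<tau>' \<subseteq> closure (quad v \<sigma> \<tau>) \<longleftrightarrow> (\<sigma>' = 0 \<or> \<sigma>' = \<sigma>) \<and> (\<tau>' = 0 \<or> \<tau>' = \<tau>)"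
  using quad_closure_iff[OF assms(1-3)] quad_nonempty[OF assms(1,4,5)] by blast

text \<open>A cell that borders the segment touches the node, so it is one of the four there, and
  the lower line separates the segment from two of them.\<close>

lemma consistent_up:
  assumes v: "v \<in> N" "\<tau> \<in> {-1, 1}"
  shows "consistent G c (quad v 0 \<tau>) \<longleftrightarrow> (quad v 0 \<tau> \<in> G \<longleftrightarrow> c (quad v 1 \<tau>) \<noteq> c (quad v (-1) \<tau>))"
proof (rule consistent_iff)
  show "quad v 1 \<tau> \<in> cells T D" "quad v (-1) \<tau> \<in> cells T D" using quad_cell v by auto
  show "quad v 1 \<tau> \<noteq> quad v (-1) \<tau>" using quad_eq_iff[OF v(1), of 1 \<tau> "-1" \<tau>] v by auto
  have t: "\<tau> \<in> {-1, 0, 1}" using v(2) by auto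
  show "quad v 0 \<tau> \<subseteq> closure (quad v 1 \<tau>)" "quad v 0 \<tau> \<subseteq> closure (quad v (-1) \<tau>)"
    using quad_subset_closure[OF v(1) _ t _ t, of 1 0] quad_subset_closure[OF v(1) _ t _ t, of "-1" 0] by simp_all
  fix C assume C: "C \<in> cells T D" "quad v 0 \<tau> \<subseteq> closure C"
  then have "closure (quad v 0 \<tau>) \<subseteq> closure C" using closure_minimal by blast
  then have "v \<in> closure C" using node_in_closure_quad[OF v(1), of 0 \<tau>] v(2) by auto
  then have "C \<in> {quad v 1 1, quad v 1 (-1), quad v (-1) 1, quad v (-1) (-1)}" using cell_at_node v C by blast
  then show "C = quad v 1 \<tau> \<or> C = quad v (-1) \<tau>"
    using C(2) v(2) quad_subset_closure[OF v(1), of _ "-\<tau>" 0 \<tau>] by auto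
qed

lemma consistent_lo:
  assumes v: "v \<in> N" "\<sigma> \<in> {-1, 1}"
  shows "consistent G c (quad v \<sigma> 0) \<longleftrightarrow> (quad v \<sigma> 0 \<in> G \<longleftrightarrow> c (quad v \<sigma> 1) \<noteq> c (quad v \<sigma> (-1)))"
proof (rule consistent_iff)
  show "quad v \<sigma> 1 \<in> cells T D" "quad v \<sigma> (-1) \<in> cells T D" using quad_cell v by auto
  show "quad v \<sigma> 1 \<noteq> quad v \<sigma> (-1)" using quad_eq_iff[OF v(1), of \<sigma> 1 \<sigma> "-1"] v by auto
  have t: "\<sigma> \<in> {-1, 0, 1}" using v(2) by auto
  show "quad v \<sigma> 0 \<subseteq> closure (quad v \<sigma> 1)" "quad v \<sigma> 0 \<subseteq> closure (quad v \<sigma> (-1))"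
    using quad_subset_closure[OF v(1) t _ t, of 1 0] quad_subset_closure[OF v(1) t _ t, of "-1" 0] by simp_all
  fix C assume C: "C \<in> cells T D" "quad v \<sigma> 0 \<subseteq> closure C"
  then have "closure (quad v \<sigma> 0) \<subseteq> closure C" using closure_minimal by blast
  then have "v \<in> closure C" using node_in_closure_quad[OF v(1), of \<sigma> 0] v(2) by auto
  then have "C \<in> {quad v 1 1, quad v 1 (-1), quad v (-1) 1, quad v (-1) (-1)}" using cell_at_node v C by blast
  then show "C = quad v \<sigma> 1 \<or> C = quad v \<sigma> (-1)"
    using C(2) v(2) quad_subset_closure[OF v(1), of "-\<sigma>" _ \<sigma> 0] by auto
qed

lemma consistent_half:
  assumes v: "v \<in> B"
  shows "consistent G c (half v 0) \<longleftrightarrow> (half v 0 \<in> G \<longleftrightarrow> c (half v 1) \<noteq> c (half v (-1)))"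
proof (rule consistent_iff)
  show "half v 1 \<in> cells T D" "half v (-1) \<in> cells T D" using half_cell v by auto
  show "half v 1 \<noteq> half v (-1)" using half_eq_iff[OF v, of 1] by auto
  show "half v 0 \<subseteq> closure (half v 1)" "half v 0 \<subseteq> closure (half v (-1))"
    using half_closure_iff[OF v] by auto
  fix C assume C: "C \<in> cells T D" "half v 0 \<subseteq> closure C"
  then have "closure (half v 0) \<subseteq> closure C" using closure_minimal by blast
  then have "v \<in> closure C" using entry_in_closure_half[OF v, of 0] by auto
  then show "C = half v 1 \<or> C = half v (-1)" using cell_at_entry v C by blast
qed

lemma quads_distinct:
  assumes "v \<in> N" shows "distinct [quad v 0 1, quad v 0 (-1), quad v 1 0, quad v (-1) 0]"
  using quad_eq_iff[OF assms] by auto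

lemma degree_node:
  assumes "v \<in> N" "G \<subseteq> segments T D"
  shows "degree G v = of_bool (quad v 0 1 \<in> G) + of_bool (quad v 0 (-1) \<in> G) + of_bool (quad v 1 0 \<in> G) + of_bool (quad v (-1) 0 \<in> G)"
proof -
  have "{s \<in> G. v \<in> closure s} = G \<inter> {quad v 0 1, quad v 0 (-1), quad v 1 0, quad v (-1) 0}"
    using seg_at_node[OF assms(1)] node_in_closure_quad[OF assms(1)] assms(2) by auto
  then show ?thesis unfolding degree_def using card_Int_four[OF quads_distinct[OF assms(1)], of G] by simp
qed

lemma node_consistent:
  assumes "v \<in> N" "\<forall>s\<in>segments T D. consistent G c s"
  shows "quad v 0 1 \<in> G \<longleftrightarrow> c (quad v 1 1) \<noteq> c (quad v (-1) 1)"
    "quad v 0 (-1) \<in> G \<longleftrightarrow> c (quad v 1 (-1)) \<noteq> c (quad v (-1) (-1))"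
    "quad v 1 0 \<in> G \<longleftrightarrow> c (quad v 1 1) \<noteq> c (quad v 1 (-1))"
    "quad v (-1) 0 \<in> G \<longleftrightarrow> c (quad v (-1) 1) \<noteq> c (quad v (-1) (-1))"
  using consistent_up[OF assms(1), of 1 G c] consistent_up[OF assms(1), of "-1" G c]
    consistent_lo[OF assms(1), of 1 G c] consistent_lo[OF assms(1), of "-1" G c]
    assms(2) quad_seg_up(1)[OF assms(1)] quad_seg_lo(1)[OF assms(1)] by auto

text \<open>Argued from the signs directly because the point may be an exit, where
  \<open>half\<close> is of no help: both segments lie on the only line through the point, so they
  have the same local signs.\<close>

lemma seg_at_frontier_unique:
  assumes "v \<in> frontier D" "s \<in> segments T D" "s' \<in> segments T D" "v \<in> closure s" "v \<in> closure s'"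
  shows "s = s'"
proof -
  have vD: "v \<in> closure D" using assms(1) by (simp add: frontier_def)
  obtain q l where q: "q \<in> D" "s = face q" "zeros q = {l}" "l \<in> L" using segE[OF assms(2)] by metis
  obtain q' l' where q': "q' \<in> D" "s' = face q'" "zeros q' = {l'}" "l' \<in> L" using segE[OF assms(3)] by metis
  have on: "hgt j v = 0" if "r \<in> D" "v \<in> closure (face r)" "zeros r = {j}" for r j
  proof -
    have j: "j \<in> L" "hgt j r = 0" using that(3) unfolding zeros_def by blast+
    then have "hgt j v = 0 \<or> sgn (hgt j v) = sgn (hgt j r)" using closure_face[OF that(1)] that(2) by blast
    then show ?thesis using j(2) by (metis sgn_zero_iff)
  qed
  have c: "v \<in> closure (face q)" "v \<in> closure (face q')" using assms(4,5) q(2) q'(2) by simp_all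
  have hl: "hgt l v = 0" "hgt l' v = 0" using on q q' c by blast+
  have only: "m = l \<and> m = l'" if "m \<in> L" "hgt m v = 0" for m
    using frontier_single_line[OF assms(1)] that hl q(4) q'(4) on_L L_sub by blast
  have "face q = locface v (\<lambda>m. sgn (hgt m q))" using in_closure_face_iff[OF q(1) vD] c(1) by blast
  also have "\<dots> = locface v (\<lambda>m. sgn (hgt m q'))"
  proof (rule locface_cong)
    fix m assume "m \<in> L" "hgt m v = 0"
    then have "m \<in> zeros q" "m \<in> zeros q'" using only q(3) q'(3) by blast+
    then show "sgn (hgt m q) = sgn (hgt m q')" unfolding zeros_def by simp
  qed
  also have "\<dots> = face q'" using in_closure_face_iff[OF q'(1) vD] c(2) by blast
  finally show ?thesis using q(2) q'(2) by simp
qed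

lemma degree_frontier:
  assumes "v \<in> frontier D" "G \<subseteq> segments T D" shows "degree G v \<in> {0, 1}"
proof -
  let ?S = "{s \<in> G. v \<in> closure s}"
  have "\<forall>s\<in>?S. \<forall>s'\<in>?S. s = s'" using seg_at_frontier_unique[OF assms(1)] assms(2) by blast
  then have u: "s = s'" if "s \<in> ?S" "s' \<in> ?S" for s s' using that by blast
  show ?thesis
  proof (cases "?S = {}")
    case True
    then have "degree G v = 0" unfolding degree_def by (simp only: card.empty)
    then show ?thesis by simp
  next
    case False
    then obtain s where s: "s \<in> ?S" by (meson equals0I)
    have "x \<in> ?S \<longleftrightarrow> x \<in> {s}" for x
    proof
      assume "x \<in> ?S"
      then show "x \<in> {s}" using u[of x s] s by (simp only: singleton_iff)
    next
      assume "x \<in> {s}"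
      then show "x \<in> ?S" using s by (simp only: singleton_iff)
    qed
    then have "?S = {s}" by (rule set_eqI)
    then show ?thesis unfolding degree_def by simp
  qed
qed

text \<open>The degree conditions follow from the colours: going around a node, the colour cannot
  change exactly once, and at a frontier point only one segment can end.\<close>

lemma configs_iff:
  "(G, c) \<in> configs T D k \<longleftrightarrow>
     G \<subseteq> segments T D \<and> c \<in> cells T D \<rightarrow>\<^sub>E {1..k} \<and> (\<forall>s\<in>segments T D. consistent G c s)"
proof -
  have e: "(G, c) \<in> configs T D k \<longleftrightarrow> G \<subseteq> segments T D \<and>
     (\<forall>v \<in> nodes T \<inter> D. degree G v \<in> {0, 2, 3, 4}) \<and> (\<forall>v \<in> frontier D. degree G v \<in> {0, 1}) \<and>
     c \<in> cells T D \<rightarrow>\<^sub>E {1..k} \<and> (\<forall>s\<in>segments T D. consistent G c s)"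
    unfolding configs_def consistent_def mem_Collect_eq prod.case ..
  have "degree G v \<in> {0, 2, 3, 4}"
    if "G \<subseteq> segments T D" "\<forall>s\<in>segments T D. consistent G c s" "v \<in> nodes T \<inter> D" for v
  proof -
    have v: "v \<in> N" using that(3) unfolding N_def .
    have "degree G v \<noteq> 1" "degree G v \<le> 4"
      unfolding degree_node[OF v that(1)] node_consistent[OF v that(2)] by (auto simp: of_bool_def)
    then show ?thesis by auto
  qed
  then show ?thesis unfolding e using degree_frontier by blast
qed

lemma finite_segments: "finite (segments T D)"
proof -
  have "segments T D \<subseteq> (\<Union>v\<in>sites. oseg v ` lines_at v)" using seg_is_oseg by blast
  then show ?thesis using finite_sites finite_lines_at by (meson finite_UN_I finite_imageI finite_subset)
qed

lemma finite_cells: "finite (cells T D)"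
proof -
  have "cells T D \<subseteq> insert init (fcell ` sites)"
  proof
    fix C assume C: "C \<in> cells T D"
    show "C \<in> insert init (fcell ` sites)"
    proof (cases "C = init")
      case False
      then have s: "leftmost C \<in> sites" using cell_start C by blast
      have "begins_at T D C (leftmost C)" using C False unfolding begins_at_def by simp
      then have "C = fcell (leftmost C)" using begins_at_iff[OF s] by simp
      then show ?thesis using s by blast
    qed simp
  qed
  then show ?thesis using finite_sites by (meson finite_imageI finite_insert finite_subset)
qed

lemma finite_configs: "finite (configs T D k)"
proof -
  have "configs T D k \<subseteq> Pow (segments T D) \<times> (cells T D \<rightarrow>\<^sub>E {1..k})"
  proof (rule subsetI)
    fix x assume x: "x \<in> configs T D k"
    obtain G c where e: "x = (G, c)" by (cases x)
    show "x \<in> Pow (segments T D) \<times> (cells T D \<rightarrow>\<^sub>E {1..k})" using x unfolding e configs_iff by blast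
  qed
  then show ?thesis using finite_segments finite_cells
    by (meson finite_PiE finite_Pow_iff finite_SigmaI finite_atLeastAtMost finite_subset)
qed

lemma early_cell:
  assumes "C \<in> cells T D" "C \<noteq> init"
  shows "leftmost C \<in> sites" "fcell (leftmost C) = C"
proof -
  show s: "leftmost C \<in> sites" using cell_start assms by blast
  have "begins_at T D C (leftmost C)" using assms unfolding begins_at_def by simp
  then show "fcell (leftmost C) = C" using begins_at_iff[OF s] by simp
qed

end

section \<open>One-step probabilities compared with local Gibbs weights\<close>

context field_setting begin

text \<open>\<open>leave\<close> records the set of departing lines in its result, so only one
  intermediate value contributes.\<close>

lemma pmf_bind_leave:
  "pmf (p \<bind> leave k u l a b X) (M, i) = pmf p M * pmf (leave k u l a b X M) (M, i)"
proof -
  have "pmf (p \<bind> leave k u l a b X) (M, i) = measure_pmf.expectation p (\<lambda>M'. pmf (leave k u l a b X M') (M, i))"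
    by (simp add: pmf_bind)
  also have "\<dots> = (\<Sum>M'\<in>{M}. pmf (leave k u l a b X M') (M, i) * pmf p M')"
  proof (rule integral_measure_pmf_real)
    fix M' assume "pmf (leave k u l a b X M') (M, i) \<noteq> 0"
    then have "(M, i) \<in> set_pmf (leave k u l a b X M')" by (simp add: set_pmf_iff)
    from set_pmf_leave[OF this] show "M' \<in> {M}" by simp
  qed simp
  finally show ?thesis by simp
qed

lemma pmf_leave_both:
  "pmf (leave k u l a b X {u, l}) ({u, l}, i) = pmf (new_colour k X) i"
proof -
  have "inj (Pair {u, l} :: nat \<Rightarrow> _)" by (auto intro: injI)
  then show ?thesis unfolding leave_def by (simp add: pmf_map_inj')
qed

lemma pmf_leave_other:
  "M \<noteq> {u, l} \<Longrightarrow> pmf (leave k u l a b X M) (M', i) = of_bool (M' = M \<and> i = (if M = {u} then b else a))"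
  unfolding leave_def by (auto simp: pmf_return indicator_def)

lemma pmf_leave_both_other: "M \<noteq> {u, l} \<Longrightarrow> pmf (leave k u l a b X {u, l}) (M, i) = 0"
  using set_pmf_leave[of "(M, i)" u l a b X "{u, l}"] by (auto simp: pmf_eq_0_set_pmf)

lemma pmf_new_colour1:
  assumes "w \<in> {1..k}" shows "pmf (new_colour k {w}) i = of_bool (i \<in> {1..k} \<and> i \<noteq> w) / K"
proof -
  have c: "card ({1..k} - {w}) = k - 1" using assms by simp
  then have "{1..k} - {w} \<noteq> {}" using k2 by (metis card.empty diff_is_0_eq not_numeral_le_zero le_trans one_le_numeral numeral_le_one_iff semiring_norm(69))
  then show ?thesis unfolding new_colour_def using c k2 by (simp add: pmf_of_set indicator_def of_nat_diff)
qed

text \<open>With two colours there would be nothing to choose from and \<open>pmf_of_set\<close>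
  would be unspecified. Where the rules exclude two different colours they carry a coefficient
  \<open>k - 2\<close>, which vanishes in that case.\<close>

lemma pmf_new_colour2:
  assumes "a \<in> {1..k}" "b \<in> {1..k}" "a \<noteq> b" "3 \<le> k"
  shows "pmf (new_colour k {a, b}) i = of_bool (i \<in> {1..k} \<and> i \<noteq> a \<and> i \<noteq> b) / (real k - 2)"
proof -
  have c: "card ({1..k} - {a, b}) = k - 2" using assms by (subst card_Diff_subset) auto
  then have "{1..k} - {a, b} \<noteq> {}" using assms(4) by (metis card.empty diff_is_0_eq not_less_eq_eq numeral_2_eq_2 numeral_3_eq_3)
  then show ?thesis unfolding new_colour_def using c assms(4) by (simp add: pmf_of_set indicator_def of_nat_diff)
qed

lemma three_colours:
  assumes "a \<in> {1..k}" "b \<in> {1..k}" "i \<in> {1..k}" "a \<noteq> b" "i \<noteq> a" "i \<noteq> b" shows "3 \<le> k"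
proof -
  have "card {a, b, i} \<le> card {1..k}" using assms by (intro card_mono) auto
  moreover have "card {a, b, i} = 3" using assms by simp
  ultimately show ?thesis by simp
qed

lemma doubleton_facts:
  assumes "u \<noteq> l"
  shows "{u, l} \<noteq> {u}" "{u, l} \<noteq> {l}" "{u} \<noteq> {l}" "{u, l} \<noteq> {}" "{u} \<noteq> {u, l}" "{l} \<noteq> {u, l}" "{l} \<noteq> {u}" "{} \<noteq> {u, l}"
    "{l, u} = {u, l}"
  using assms by auto

lemma pmf_collision_same:
  assumes "u \<noteq> l"
  shows "pmf (collision k \<alpha> u l a a) {} = \<alpha>" "pmf (collision k \<alpha> u l a a) {u, l} = aX"
    "pmf (collision k \<alpha> u l a a) {u} = 0" "pmf (collision k \<alpha> u l a a) {l} = 0"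
  unfolding collision_def using doubleton_facts[OF assms] by (simp_all add: pmf_pmf_of_list[OF collision_wf(1)])

lemma pmf_collision_diff:
  assumes "u \<noteq> l" "a \<noteq> b"
  shows "pmf (collision k \<alpha> u l a b) {} = 0" "pmf (collision k \<alpha> u l a b) {u, l} = (real k - 2) * aX / K"
    "pmf (collision k \<alpha> u l a b) {u} = aT" "pmf (collision k \<alpha> u l a b) {l} = aT"
  unfolding collision_def using doubleton_facts[OF assms(1)] assms(2) by (simp_all add: pmf_pmf_of_list[OF collision_wf(2)])

lemma pmf_passage:
  assumes "m \<noteq> m'" "m' \<in> T"
  shows "pmf (passage \<pi> k \<alpha> m m') {} = 0"
    "pmf (passage \<pi> k \<alpha> m m') {m'} = \<alpha> * \<pi> m' / K"
    "pmf (passage \<pi> k \<alpha> m m') {m, m'} = (real k - 2) * aT * \<pi> m' / K"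
    "pmf (passage \<pi> k \<alpha> m m') {m} = 1 - \<epsilon> * \<pi> m'"
  unfolding passage_def using doubleton_facts[OF assms(1)] by (simp_all add: pmf_pmf_of_list[OF passage_wf[OF assms(2)]])

definition birth_prob :: "point set \<Rightarrow> point set \<Rightarrow> real" where
  "birth_prob u l = \<alpha> * \<pi> u * \<pi> l / K"

lemma birth_prob_bounds: assumes "u \<in> T" "l \<in> T" shows "0 \<le> birth_prob u l" "birth_prob u l < 1"
proof -
  show "0 \<le> birth_prob u l" unfolding birth_prob_def using aV K_pos pi_bounds(1)[OF assms(1)] pi_bounds(1)[OF assms(2)] by simp
  have "\<alpha> * \<pi> u \<le> 1 * \<pi> u" using aV pi_bounds(1)[OF assms(1)] by (intro mult_right_mono) auto
  then have "\<alpha> * \<pi> u < 1" using pi_bounds(2)[OF assms(1)] by linarith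
  moreover have "0 \<le> \<alpha> * \<pi> u" using aV pi_bounds(1)[OF assms(1)] by simp
  ultimately have "\<alpha> * \<pi> u * \<pi> l < 1 * 1"
    using pi_bounds[OF assms(2)] by (intro mult_strict_mono) auto
  then show "birth_prob u l < 1" unfolding birth_prob_def using K_pos by (simp add: divide_less_eq)
qed

text \<open>The law at a node stripped of geometry: arrivals \<open>iu\<close>, \<open>il\<close>,
  departures \<open>ou\<close>, \<open>ol\<close>, and the colours \<open>a\<close> above,
  \<open>b\<close> below, \<open>w\<close> before and \<open>f\<close> after the node. The
  comparison with the Gibbs weight becomes a finite case check.\<close>

definition node_prob ::
  "point set \<Rightarrow> point set \<Rightarrow> bool \<Rightarrow> bool \<Rightarrow> bool \<Rightarrow> bool \<Rightarrow> nat \<Rightarrow> nat \<Rightarrow> nat \<Rightarrow> nat \<Rightarrow> real" where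
  "node_prob u l iu il ou ol a b w f =
    (let M = (if ou then {u} else {}) \<union> (if ol then {l} else {}) in
      if iu \<and> il then pmf (collision k \<alpha> u l a b) M * pmf (leave k u l a b {a, b} M) (M, f)
      else if iu then pmf (passage \<pi> k \<alpha> u l) M * pmf (leave k u l a b {w, b} M) (M, f)
      else if il then pmf (passage \<pi> k \<alpha> l u) M * pmf (leave k u l a b {a, w} M) (M, f)
      else birth_prob u l * pmf (leave k u l a b {w} {u, l}) (M, f)
        + (1 - birth_prob u l) * pmf (leave k u l a b {w} {}) (M, f))"

lemma pmf_bind_bernoulli:
  assumes "0 \<le> p" "p \<le> 1"
  shows "pmf (bernoulli_pmf p \<bind> f) x = p * pmf (f True) x + (1 - p) * pmf (f False) x"
  using assms by (simp add: pmf_bind)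

lemma pmf_node_outcome:
  assumes v: "v \<in> N" and G: "G \<subseteq> segments T D"
  shows "pmf (outcome_law (G, c) v) (outcome (G, c) v) =
    node_prob (up v) (lo v) (quad v 0 (-1) \<in> G) (quad v 1 0 \<in> G) (quad v 0 1 \<in> G) (quad v (-1) 0 \<in> G)
      (c (quad v 1 1)) (c (quad v (-1) (-1))) (c (quad v 1 (-1))) (c (quad v (-1) 1))"
proof -
  note ul = node_up_lo[OF v]
  have n: "v \<in> nodes T" using v unfolding N_def by simp
  have M: "{l \<in> lines_at v. oseg v l \<in> G} =
      (if quad v 0 1 \<in> G then {up v} else {}) \<union> (if quad v (-1) 0 \<in> G then {lo v} else {})"
    using v ul(6) unfolding lines_at_def oseg_def by auto
  have o: "outcome (G, c) v = ((if quad v 0 1 \<in> G then {up v} else {}) \<union> (if quad v (-1) 0 \<in> G then {lo v} else {}),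
      c (quad v (-1) 1))"
    unfolding outcome_def using M fcell_node[OF v] by simp
  have q: "0 \<le> birth_prob (up v) (lo v)" "birth_prob (up v) (lo v) \<le> 1"
    using birth_prob_bounds[OF ul(7,8)] by auto
  have s: "outcome_law (G, c) v = bernoulli_pmf (birth_prob (up v) (lo v)) \<bind> (\<lambda>birth.
          if quad v 0 (-1) \<in> G \<and> quad v 1 0 \<in> G then
            collision k \<alpha> (up v) (lo v) (c (quad v 1 1)) (c (quad v (-1) (-1))) \<bind> 
              leave k (up v) (lo v) (c (quad v 1 1)) (c (quad v (-1) (-1))) {c (quad v 1 1), c (quad v (-1) (-1))}
          else if quad v 0 (-1) \<in> G then
            passage \<pi> k \<alpha> (up v) (lo v) \<bind>
              leave k (up v) (lo v) (c (quad v 1 1)) (c (quad v (-1) (-1))) {c (quad v 1 (-1)), c (quad v (-1) (-1))}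
          else if quad v 1 0 \<in> G then
            passage \<pi> k \<alpha> (lo v) (up v) \<bind>
              leave k (up v) (lo v) (c (quad v 1 1)) (c (quad v (-1) (-1))) {c (quad v 1 1), c (quad v 1 (-1))}
          else
            leave k (up v) (lo v) (c (quad v 1 1)) (c (quad v (-1) (-1))) {c (quad v 1 (-1))} 
              (if birth then {up v, lo v} else {}))"
    unfolding site_outcome_def if_P[OF n] node_outcome_def prod.case Let_def
      hit_along_up[OF v G] hit_along_lo[OF v G] cell_above_node[OF v] cell_below_node[OF v] cell_before_node[OF v]
      birth_prob_def ..
  show ?thesis unfolding s o pmf_bind_bernoulli[OF q] node_prob_def Let_def
    by (cases "quad v 0 (-1) \<in> G"; cases "quad v 1 0 \<in> G")
      (simp_all only: if_True if_False simp_thms pmf_bind_leave mult.commute flip: distrib_right, simp_all)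
qed

lemma node_prob_simps:
  assumes "u \<noteq> l" "u \<in> T" "l \<in> T"
  shows "node_prob u l True True ou ol a b w f = 
     (if a = b then if ou \<and> ol then aX * pmf (new_colour k {a, b}) f else if ou \<or> ol then 0 else \<alpha> * of_bool (f = a)
      else if ou \<and> ol then (real k - 2) * aX / K * pmf (new_colour k {a, b}) f
        else if ou then aT * of_bool (f = b) else if ol then aT * of_bool (f = a) else 0)"
    "node_prob u l True False ou ol a b w f =
     (if ou \<and> ol then (real k - 2) * aT * \<pi> l / K * pmf (new_colour k {w, b}) f
      else if ou then (1 - \<epsilon> * \<pi> l) * of_bool (f = b)
      else if ol then \<alpha> * \<pi> l / K * of_bool (f = a) else 0)"
    "node_prob u l False True ou ol a b w f =
     (if ou \<and> ol then (real k - 2) * aT * \<pi> u / K * pmf (new_colour k {a, w}) f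
      else if ol then (1 - \<epsilon> * \<pi> u) * of_bool (f = a)
      else if ou then \<alpha> * \<pi> u / K * of_bool (f = b) else 0)"
    "node_prob u l False False ou ol a b w f =
     (if ou \<and> ol then birth_prob u l * pmf (new_colour k {w}) f
      else if ou \<or> ol then 0 else (1 - birth_prob u l) * of_bool (f = a))"
proof -
  note d = doubleton_facts[OF assms(1)] assms(1) assms(1)[symmetric]
  note pc = pmf_collision_same[OF assms(1)] pmf_collision_diff[OF assms(1)]
    pmf_passage[OF assms(1,3)] pmf_passage[OF assms(1)[symmetric] assms(2), unfolded d(9)]
  note pl = pmf_leave_both pmf_leave_both_other pmf_leave_other
  have U: "{u} \<union> {l} = {u, l}" by auto
  show "node_prob u l True True ou ol a b w f = 
     (if a = b then if ou \<and> ol then aX * pmf (new_colour k {a, b}) f else if ou \<or> ol then 0 else \<alpha> * of_bool (f = a)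
      else if ou \<and> ol then (real k - 2) * aX / K * pmf (new_colour k {a, b}) f
        else if ou then aT * of_bool (f = b) else if ol then aT * of_bool (f = a) else 0)"
    by (cases ou; cases ol; cases "a = b") (simp_all add: node_prob_def Let_def U pc pl d)
  show "node_prob u l True False ou ol a b w f =
     (if ou \<and> ol then (real k - 2) * aT * \<pi> l / K * pmf (new_colour k {w, b}) f
      else if ou then (1 - \<epsilon> * \<pi> l) * of_bool (f = b)
      else if ol then \<alpha> * \<pi> l / K * of_bool (f = a) else 0)"
    by (cases ou; cases ol) (simp_all add: node_prob_def Let_def U pc pl d)
  show "node_prob u l False True ou ol a b w f =
     (if ou \<and> ol then (real k - 2) * aT * \<pi> u / K * pmf (new_colour k {a, w}) f
      else if ol then (1 - \<epsilon> * \<pi> u) * of_bool (f = a)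
      else if ou then \<alpha> * \<pi> u / K * of_bool (f = b) else 0)"
    by (cases ou; cases ol) (simp_all add: node_prob_def Let_def U pc pl d)
  show "node_prob u l False False ou ol a b w f =
     (if ou \<and> ol then birth_prob u l * pmf (new_colour k {w}) f
      else if ou \<or> ol then 0 else (1 - birth_prob u l) * of_bool (f = a))"
    by (cases ou; cases ol) (simp_all add: node_prob_def Let_def U pl d)
qed

lemma new_colour1_nonzero: "w \<in> {1..k} \<Longrightarrow> pmf (new_colour k {w}) i \<noteq> 0 \<Longrightarrow> i \<in> {1..k} \<and> i \<noteq> w"
  by (auto simp: pmf_new_colour1)

lemma new_colour2_nonzero:
  assumes "a \<in> {1..k}" "b \<in> {1..k}" "(real k - 2) * x * pmf (new_colour k {a, b}) i \<noteq> 0" "a \<noteq> b"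
  shows "i \<in> {1..k} \<and> i \<noteq> a \<and> i \<noteq> b"
proof -
  have "real k \<noteq> 2" using assms(3) by auto
  then have "3 \<le> k" using k2 by (cases "k = 2") auto
  then show ?thesis using assms by (auto simp: pmf_new_colour2)
qed

text \<open>The rules never produce an improper colouring: two departing particles bound a colour
  different from both neighbours, a single one leaves the new cell with the colour of the side it is
  not cut off from, and a number of departures that does not fit the colours has probability
  0.\<close>

lemma node_prob_nonzero:
  assumes "u \<noteq> l" "u \<in> T" "l \<in> T" and abw: "a \<in> {1..k}" "b \<in> {1..k}" "w \<in> {1..k}"
    and "iu \<longleftrightarrow> w \<noteq> b" "il \<longleftrightarrow> a \<noteq> w" and nz: "node_prob u l iu il ou ol a b w f \<noteq> 0"
  shows "f \<in> {1..k} \<and> (ou \<longleftrightarrow> a \<noteq> f) \<and> (ol \<longleftrightarrow> f \<noteq> b)"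
proof -
  note s = node_prob_simps[OF assms(1-3)]
  consider "iu" "il" "a = b" | "iu" "il" "a \<noteq> b" | "iu" "\<not> il" | "\<not> iu" "il" | "\<not> iu" "\<not> il" by blast
  then show ?thesis
  proof cases
    case 1
    then have n: "node_prob u l True True ou ol a b w f \<noteq> 0" using nz by simp
    have both: "f \<in> {1..k} \<and> f \<noteq> a" if "ou" "ol"
      by (rule new_colour1_nonzero[OF abw(1)]) (use n that 1(3) in \<open>simp add: s(1)\<close>)
    have "ou = ol" "\<not> ou \<Longrightarrow> f = a" using n 1(3) unfolding s(1) by (cases ou; cases ol; simp split: if_splits)+
    then show ?thesis using both 1(3) abw(1) by metis
  next
    case 2
    then have n: "node_prob u l True True ou ol a b w f \<noteq> 0" using nz by simp
    have both: "f \<in> {1..k} \<and> f \<noteq> a \<and> f \<noteq> b" if "ou" "ol"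
      by (rule new_colour2_nonzero[OF abw(1,2) _ 2(3), of "aX / K"]) (use n that 2(3) in \<open>simp add: s(1)\<close>)
    have "ou \<or> ol" "\<not> ol \<Longrightarrow> f = b" "\<not> ou \<Longrightarrow> f = a" using n 2(3) unfolding s(1) by (cases ou; cases ol; simp split: if_splits)+
    then show ?thesis using both 2(3) abw(1,2) by metis
  next
    case 3
    then have n: "node_prob u l True False ou ol a b w f \<noteq> 0" using nz by simp
    have w: "w \<noteq> b" "a = w" using 3 assms(7,8) by auto
    have both: "f \<in> {1..k} \<and> f \<noteq> w \<and> f \<noteq> b" if "ou" "ol"
      by (rule new_colour2_nonzero[OF abw(3,2) _ w(1), of "aT * \<pi> l / K"]) (use n that in \<open>simp add: s(2)\<close>)
    have "ou \<or> ol" "\<not> ol \<Longrightarrow> f = b" "\<not> ou \<Longrightarrow> f = a" using n unfolding s(2) by (cases ou; cases ol; simp split: if_splits)+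
    then show ?thesis using both w abw(1,2) by metis
  next
    case 4
    then have n: "node_prob u l False True ou ol a b w f \<noteq> 0" using nz by simp
    have w: "w = b" "a \<noteq> w" using 4 assms(7,8) by auto
    have both: "f \<in> {1..k} \<and> f \<noteq> a \<and> f \<noteq> w" if "ou" "ol"
      by (rule new_colour2_nonzero[OF abw(1,3) _ w(2), of "aT * \<pi> u / K"]) (use n that in \<open>simp add: s(3)\<close>)
    have "ou \<or> ol" "\<not> ol \<Longrightarrow> f = b" "\<not> ou \<Longrightarrow> f = a" using n unfolding s(3) by (cases ou; cases ol; simp split: if_splits)+
    then show ?thesis using both w abw(1,2) by metis
  next
    case 5
    then have n: "node_prob u l False False ou ol a b w f \<noteq> 0" using nz by simp
    have w: "w = b" "a = w" using 5 assms(7,8) by auto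
    have both: "f \<in> {1..k} \<and> f \<noteq> w" if "ou" "ol"
      by (rule new_colour1_nonzero[OF abw(3)]) (use n that in \<open>simp add: s(4)\<close>)
    have "ou = ol" "\<not> ou \<Longrightarrow> f = a" using n unfolding s(4) by (cases ou; cases ol; simp split: if_splits)+
    then show ?thesis using both w abw(1) by metis
  qed
qed

text \<open>
  The share of a node in the Gibbs weight. Here \<open>iu\<close>, \<open>il\<close> say that the graph contains the segments that
  arrive along \<open>u\<close>, \<open>l\<close>, and \<open>ou\<close>, \<open>ol\<close> that it contains those that leave.
\<close>

definition node_factor :: "point set \<Rightarrow> point set \<Rightarrow> bool \<Rightarrow> bool \<Rightarrow> bool \<Rightarrow> bool \<Rightarrow> real" where
  "node_factor u l iu il ou ol =
    (let d = (of_bool ou + of_bool iu + of_bool il + of_bool ol :: nat);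
         straight = (iu \<and> ou \<and> \<not> il \<and> \<not> ol \<or> il \<and> ol \<and> \<not> iu \<and> \<not> ou) in
     (if d = 2 \<and> \<not> straight then \<alpha> else 1) * (if d = 3 then K * aT else 1) * (if d = 4 then K * aX else 1) *
     (if straight then 1 else (1 / K) ^ (of_bool ou + of_bool ol)) *
     (if straight then 1 - \<epsilon> * \<pi> (if iu then l else u) else 1) *
     (if d = 0 then 1 else 1 / (1 - birth_prob u l)) *
     ((if ou \<and> \<not> iu then \<pi> u else 1) * (if ol \<and> \<not> il then \<pi> l else 1)))"

text \<open>The heart of the matter, with K = k - 1. Death \<alpha>, turn \<alpha>\<pi>/K and birth
  with colour \<alpha>\<pi>\<pi>'/K^2 are V-vertices with 0, 1, 2 departing edges; one survivor
  \<open>aT\<close> and split \<open>aT\<close>\<pi>/K are \<open>K * aT\<close> over K and K^2; a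
  crossing is \<open>K * aX\<close> over K^2, whether or not \<open>a = b\<close>. The term with
  \<open>birth_prob\<close> cancels except at an empty node, where it is the probability of no
  birth.\<close>

lemma node_prob_consistent:
  assumes "u \<noteq> l" "u \<in> T" "l \<in> T" and abw: "a \<in> {1..k}" "b \<in> {1..k}" "w \<in> {1..k}" "f \<in> {1..k}"
    and io: "iu \<longleftrightarrow> w \<noteq> b" "il \<longleftrightarrow> a \<noteq> w" "ou \<longleftrightarrow> a \<noteq> f" "ol \<longleftrightarrow> f \<noteq> b"
  shows "node_prob u l iu il ou ol a b w f = (1 - birth_prob u l) * node_factor u l iu il ou ol"
proof -
  note s = node_prob_simps[OF assms(1-3)]
  have q: "1 - birth_prob u l \<noteq> 0" "birth_prob u l \<noteq> 1" using birth_prob_bounds[OF assms(2,3)] by auto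
  have K: "K \<noteq> 0" "K \<noteq> 0 \<and> real k \<noteq> 1" using K_pos by auto
  have n1: "pmf (new_colour k {w}) f = 1 / K" if "f \<noteq> w" using pmf_new_colour1 abw that by simp
  have n1': "pmf (new_colour k {b}) f = 1 / K" if "f \<noteq> b" using pmf_new_colour1 abw that by simp
  \<comment> \<open>The coefficient \<open>k - 2\<close> of the rule cancels against the uniform
    choice among \<open>k - 2\<close> colours; three different colours are present, so this is no
    division by 0.\<close>
  have n2: "(real k - 2) * x * pmf (new_colour k {a', b'}) f = x"
    if "a' \<in> {1..k}" "b' \<in> {1..k}" "a' \<noteq> b'" "f \<noteq> a'" "f \<noteq> b'" for a' b' x
  proof -
    have "3 \<le> k" using three_colours[of a' b' f] that abw by blast
    then show ?thesis using pmf_new_colour2[of a' b' f] that abw by simp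
  qed
  consider "iu" "il" "a = b" | "iu" "il" "a \<noteq> b" | "iu" "\<not> il" | "\<not> iu" "il" | "\<not> iu" "\<not> il" by blast
  then show ?thesis
  proof cases
    case 1
    then have e: "iu = True" "il = True" by auto
    show ?thesis unfolding e s(1) io(3,4) node_factor_def Let_def using q K 1(3) n1'
      by (cases "a = f"; cases "f = b"; simp add: power2_eq_square; simp add: field_simps)
  next
    case 2
    then have e: "iu = True" "il = True" by auto
    have "a \<noteq> f \<Longrightarrow> f \<noteq> b \<Longrightarrow> (real k - 2) * (aX / K) * pmf (new_colour k {a, b}) f = aX / K"
      using 2(3) abw by (intro n2) auto
    then have "a \<noteq> f \<Longrightarrow> f \<noteq> b \<Longrightarrow> (real k - 2) * aX / K * pmf (new_colour k {a, b}) f = aX / K" by simp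
    then show ?thesis unfolding e s(1) io(3,4) node_factor_def Let_def using q K 2(3)
      by (cases "a = f"; cases "f = b"; simp add: power2_eq_square; simp add: field_simps)
  next
    case 3
    then have e: "iu = True" "il = False" by auto
    have w: "w \<noteq> b" "a = w" using 3 io(1,2) by auto
    have "a \<noteq> f \<Longrightarrow> f \<noteq> b \<Longrightarrow> (real k - 2) * (aT * \<pi> l / K) * pmf (new_colour k {w, b}) f = aT * \<pi> l / K"
      using w abw by (intro n2) auto
    then have "a \<noteq> f \<Longrightarrow> f \<noteq> b \<Longrightarrow> (real k - 2) * aT * \<pi> l / K * pmf (new_colour k {w, b}) f = aT * \<pi> l / K" by (simp add: mult.assoc)
    then show ?thesis unfolding e s(2) io(3,4) node_factor_def Let_def using q K w
      by (cases "a = f"; cases "f = b"; simp add: power2_eq_square; simp add: field_simps)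
  next
    case 4
    then have e: "iu = False" "il = True" by auto
    have w: "w = b" "a \<noteq> w" using 4 io(1,2) by auto
    have "a \<noteq> f \<Longrightarrow> f \<noteq> b \<Longrightarrow> (real k - 2) * (aT * \<pi> u / K) * pmf (new_colour k {a, w}) f = aT * \<pi> u / K"
      using w abw by (intro n2) auto
    then have "a \<noteq> f \<Longrightarrow> f \<noteq> b \<Longrightarrow> (real k - 2) * aT * \<pi> u / K * pmf (new_colour k {a, w}) f = aT * \<pi> u / K" by (simp add: mult.assoc)
    then show ?thesis unfolding e s(3) io(3,4) node_factor_def Let_def using q K w
      by (cases "a = f"; cases "f = b"; simp add: power2_eq_square; simp add: field_simps)
  next
    case 5
    then have e: "iu = False" "il = False" by auto
    have w: "w = b" "a = w" using 5 io(1,2) by auto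
    \<comment> \<open>A birth in Gibbs terms: two edges and two primary edges start. One factor
      \<open>1 / K\<close> comes from the birth probability, the other from the choice of the
      colour.\<close>
    have "birth_prob u l * (1 / K) = \<alpha> * (1 / K * (1 / K)) * (\<pi> u * \<pi> l)"
      unfolding birth_prob_def by (simp add: field_simps)
    then show ?thesis unfolding e s(4) io(3,4) node_factor_def Let_def using q K w n1
      by (cases "a = f"; cases "f = b"; simp add: power2_eq_square; simp add: field_simps)
  qed
qed

lemma entry_cells:
  assumes "v \<in> B"
  shows "\<exists>\<sigma>\<in>{-1, 1}. fcell v = half v \<sigma> \<and> cell_before_entry T D v = half v (- \<sigma>) \<and>
     (half v (- \<sigma>) = init \<or> fst (leftmost (half v (- \<sigma>))) < fst v)"
proof -
  have s: "v \<in> sites" using assms unfolding sites_def by blast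
  show ?thesis using begins_at_entry[OF assms] begins_at_iff[OF s] by metis
qed

lemma pmf_entry_outcome:
  assumes v: "v \<in> B"
  shows "pmf (outcome_law (G, c) v) (outcome (G, c) v) =
    (if half v 0 \<in> G then \<pi> (lin v) / (1 + \<pi> (lin v)) * pmf (new_colour k {c (cell_before_entry T D v)}) (c (fcell v))
     else of_bool (c (fcell v) = c (cell_before_entry T D v)) / (1 + \<pi> (lin v)))"
proof -
  have n: "v \<notin> nodes T" "v \<notin> N" using entry_not_node[OF v] entry_not_N[OF v] by auto
  have lT: "lin v \<in> T" using entry(1)[OF v] L_sub by blast
  let ?p = "\<pi> (lin v) / (1 + \<pi> (lin v))"
  have p: "0 \<le> ?p" "?p \<le> 1" using pi_bounds[OF lT] by auto
  have p1: "1 - ?p = 1 / (1 + \<pi> (lin v))" using pi_bounds[OF lT] by (simp add: field_simps)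
  have o: "outcome (G, c) v = (if half v 0 \<in> G then {lin v} else {}, c (fcell v))"
    unfolding outcome_def lines_at_def oseg_def using n by auto
  have s: "outcome_law (G, c) v = bernoulli_pmf ?p \<bind> (\<lambda>birth.
     if birth then map_pmf (Pair {lin v}) (new_colour k {c (cell_before_entry T D v)})
     else return_pmf ({}, c (cell_before_entry T D v)))"
    unfolding site_outcome_def if_not_P[OF n(1)] entry_outcome_def prod.case Let_def lin_def ..
  have i: "inj (Pair {lin v} :: nat \<Rightarrow> _)" by (auto intro: injI)
  have z: "pmf (map_pmf (Pair {lin v}) (new_colour k X)) ({}, i) = 0" for X i
    by (auto simp: pmf_eq_0_set_pmf)
  show ?thesis unfolding s o pmf_bind_bernoulli[OF p] p1
    by (cases "half v 0 \<in> G") (auto simp: pmf_map_inj'[OF i] z pmf_return indicator_def)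
qed

definition site_factor :: "point set set \<Rightarrow> point \<Rightarrow> real" where
  "site_factor G v =
    (if v \<in> N then node_factor (up v) (lo v) (quad v 0 (-1) \<in> G) (quad v 1 0 \<in> G) (quad v 0 1 \<in> G) (quad v (-1) 0 \<in> G)
     else if half v 0 \<in> G then \<pi> (lin v) / K else 1)"

text \<open>In both cases the probability that no birth is attempted; at an entry point it is 1 -
  \<pi>/(1 + \<pi>).\<close>

definition site_const :: "point \<Rightarrow> real" where
  "site_const v = (if v \<in> N then 1 - birth_prob (up v) (lo v) else 1 / (1 + \<pi> (lin v)))"

lemma site_const_pos: assumes "v \<in> sites" shows "0 < site_const v"
  using assms
proof (cases rule: site_cases)
  case 1
  then show ?thesis using birth_prob_bounds(2)[OF node_up_lo(7,8)[OF 1]] unfolding site_const_def by simp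
next
  case 2
  then have "lin v \<in> T" using entry(1) L_sub by blast
  from pi_bounds(1)[OF this] show ?thesis using 2 unfolding site_const_def by simp
qed

lemma pmf_site_consistent:
  assumes v: "v \<in> sites" and cf: "(G, c) \<in> configs T D k"
  shows "pmf (outcome_law (G, c) v) (outcome (G, c) v) = site_const v * site_factor G v"
proof -
  have G: "G \<subseteq> segments T D" and col: "\<And>C. C \<in> cells T D \<Longrightarrow> c C \<in> {1..k}"
    and co: "\<forall>s\<in>segments T D. consistent G c s"
    using cf unfolding configs_iff by (auto simp: PiE_iff)
  from v show ?thesis
  proof (cases rule: site_cases)
    case 1
    note ul = node_up_lo[OF 1]
    show ?thesis unfolding pmf_node_outcome[OF 1 G]
    proof (subst node_prob_consistent)
      show "c (quad v 1 1) \<in> {1..k}" "c (quad v (-1) (-1)) \<in> {1..k}" "c (quad v 1 (-1)) \<in> {1..k}" "c (quad v (-1) 1) \<in> {1..k}"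
        using quad_cell[OF 1] by (intro col, simp)+
    qed (use ul node_consistent[OF 1 co] 1 in \<open>auto simp: site_factor_def site_const_def\<close>)
  next
    case 2
    obtain \<sigma> where s: "\<sigma> \<in> {-1, 1}" "fcell v = half v \<sigma>" "cell_before_entry T D v = half v (- \<sigma>)"
      using entry_cells[OF 2(1)] by blast
    have "half v 0 \<in> G \<longleftrightarrow> c (half v 1) \<noteq> c (half v (-1))"
      using consistent_half[OF 2(1)] co half_seg(1)[OF 2(1)] by blast
    then have h: "half v 0 \<in> G \<longleftrightarrow> c (fcell v) \<noteq> c (cell_before_entry T D v)" using s by auto
    have m: "- \<sigma> \<in> {-1, 1}" using s(1) by auto
    have c: "c (half v \<sigma>) \<in> {1..k}" "c (half v (- \<sigma>)) \<in> {1..k}"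
      by (rule col[OF half_cell[OF 2(1) s(1)]], rule col[OF half_cell[OF 2(1) m]])
    have "\<pi> (lin v) / (1 + \<pi> (lin v)) * (1 / K) = 1 / (1 + \<pi> (lin v)) * (\<pi> (lin v) / K)" by simp
    then show ?thesis unfolding pmf_entry_outcome[OF 2(1)] site_const_def site_factor_def if_not_P[OF 2(2)]
      using h pmf_new_colour1[OF c(2), of "c (half v \<sigma>)"] c(1) unfolding s(2,3) by (cases "half v 0 \<in> G") simp_all
  qed
qed

text \<open>Induction on the number of strictly earlier sites: the three known cells and the two
  arriving segments at a node belong to earlier sites or to the initial cell, so they are already
  consistent, and \<open>node_prob_nonzero\<close> passes this on to what departs.\<close>

lemma support_consistent:
  assumes G: "G \<subseteq> segments T D" and init: "c init \<in> {1..k}"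
    and nz: "\<And>v. v \<in> sites \<Longrightarrow> pmf (outcome_law (G, c) v) (outcome (G, c) v) \<noteq> 0"
    and v: "v \<in> sites"
  shows "c (fcell v) \<in> {1..k} \<and> (\<forall>l\<in>lines_at v. consistent G c (oseg v l))"
  using v
proof (induction v rule: measure_induct_rule[of "\<lambda>v. card {w \<in> sites. fst w < fst v}"])
  case (less v)
  have IH: "c (fcell w) \<in> {1..k} \<and> (\<forall>l\<in>lines_at w. consistent G c (oseg w l))"
    if "w \<in> sites" "fst w < fst v" for w
  proof (rule less.IH)
    have "{x \<in> sites. fst x < fst w} \<subset> {x \<in> sites. fst x < fst v}" using that by force
    then show "card {x \<in> sites. fst x < fst w} < card {x \<in> sites. fst x < fst v}"
      using finite_sites by (intro psubset_card_mono) auto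
  qed (rule that)
  have col: "c C \<in> {1..k}" if "C \<in> cells T D" "C = init \<or> fst (leftmost C) < fst v" for C
    using IH[of "leftmost C"] early_cell[of C] that init by (cases "C = init") auto
  have co: "consistent G c s" if s: "s \<in> segments T D" "q \<in> s" "fst q < fst v" for s q
  proof -
    obtain w l where w: "w \<in> sites" "l \<in> lines_at w" "s = oseg w l" using seg_is_oseg[OF s(1)] by blast
    then have "fst w < fst v" using stime_less[OF s(1,2)] stime_oseg s(3) by fastforce
    then show ?thesis using IH w by blast
  qed
  from less.prems show ?case
  proof (cases rule: site_cases)
    case 1
    note ul = node_up_lo[OF 1]
    obtain q1 q2 where q: "q1 \<in> quad v 0 (-1)" "q2 \<in> quad v 1 0"
      using quad_nonempty[OF 1, of 0 "-1"] quad_nonempty[OF 1, of 1 0] by auto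
    have "consistent G c (quad v 0 (-1))" 
      using co[OF quad_seg_up(1)[OF 1] q(1)] quad_fst(2)[OF 1 q(1)] by simp
    then have iu: "quad v 0 (-1) \<in> G \<longleftrightarrow> c (quad v 1 (-1)) \<noteq> c (quad v (-1) (-1))" using consistent_up[OF 1, of "-1"] by simp
    have "consistent G c (quad v 1 0)" 
      using co[OF quad_seg_lo(1)[OF 1] q(2)] quad_fst(2)[OF 1 q(2)] by simp
    then have il: "quad v 1 0 \<in> G \<longleftrightarrow> c (quad v 1 1) \<noteq> c (quad v 1 (-1))" using consistent_lo[OF 1, of 1] by simp
    have cs: "c (quad v 1 1) \<in> {1..k}" "c (quad v (-1) (-1)) \<in> {1..k}" "c (quad v 1 (-1)) \<in> {1..k}"
      using col[OF quad_cell[OF 1]] leftmost_AB[OF 1] leftmost_W[OF 1] by auto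
    have r: "c (quad v (-1) 1) \<in> {1..k} \<and> (quad v 0 1 \<in> G \<longleftrightarrow> c (quad v 1 1) \<noteq> c (quad v (-1) 1)) \<and>
       (quad v (-1) 0 \<in> G \<longleftrightarrow> c (quad v (-1) 1) \<noteq> c (quad v (-1) (-1)))"
      by (rule node_prob_nonzero[OF ul(6,7,8) cs iu il]) (use nz[OF less.prems] pmf_node_outcome[OF 1 G] in simp)
    then have "consistent G c (quad v 0 1)" "consistent G c (quad v (-1) 0)"
      using consistent_up[OF 1, of 1] consistent_lo[OF 1, of "-1"] by auto
    then show ?thesis using r 1 fcell_node[OF 1] unfolding lines_at_def oseg_def by auto
  next
    case 2
    obtain \<sigma> where s: "\<sigma> \<in> {-1, 1}" "fcell v = half v \<sigma>" "cell_before_entry T D v = half v (- \<sigma>)"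
      "half v (- \<sigma>) = init \<or> fst (leftmost (half v (- \<sigma>))) < fst v"
      using entry_cells[OF 2(1)] by blast
    have m: "- \<sigma> \<in> {-1, 1}" using s(1) by auto
    have w: "c (half v (- \<sigma>)) \<in> {1..k}" by (rule col[OF half_cell[OF 2(1) m] s(4)])
    have nz': "(if half v 0 \<in> G then \<pi> (lin v) / (1 + \<pi> (lin v)) * pmf (new_colour k {c (half v (- \<sigma>))}) (c (half v \<sigma>))
     else of_bool (c (half v \<sigma>) = c (half v (- \<sigma>))) / (1 + \<pi> (lin v))) \<noteq> 0"
      using nz[OF less.prems] unfolding pmf_entry_outcome[OF 2(1)] s by simp
    have "c (half v \<sigma>) \<in> {1..k} \<and> (half v 0 \<in> G \<longleftrightarrow> c (half v \<sigma>) \<noteq> c (half v (- \<sigma>)))"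
      using nz' w new_colour1_nonzero[OF w, of "c (half v \<sigma>)"] by (cases "half v 0 \<in> G") auto
    moreover then have "consistent G c (half v 0)" using consistent_half[OF 2(1), of G c] s(1) by auto
    ultimately show ?thesis using 2 s(2) unfolding lines_at_def oseg_def by auto
  qed
qed

lemma support_configs:
  assumes "pmf (dynamics) (G, c) \<noteq> 0" shows "(G, c) \<in> configs T D k"
proof -
  have a: "G \<subseteq> segments T D" "\<And>C. C \<notin> cells T D \<Longrightarrow> c C = undefined" "c init \<in> {1..k}"
    and p: "(\<Prod>v\<in>sites. pmf (outcome_law (G, c) v) (outcome (G, c) v)) \<noteq> 0"
    using assms unfolding pmf_dynamics by (auto split: if_splits)
  have nz: "pmf (outcome_law (G, c) v) (outcome (G, c) v) \<noteq> 0" if "v \<in> sites" for v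
    using p that finite_sites by simp
  note sc = support_consistent[OF a(1,3) nz]
  have "c C \<in> {1..k}" if "C \<in> cells T D" for C
    using sc[of "leftmost C"] early_cell[OF that] a(3) by (cases "C = init") auto
  moreover have "consistent G c s" if "s \<in> segments T D" for s
    using seg_is_oseg[OF that] sc by blast
  ultimately show ?thesis unfolding configs_iff using a by (auto simp: PiE_iff extensional_def)
qed

lemma pmf_dynamics_configs:
  assumes "(G, c) \<in> configs T D k"
  shows "pmf (dynamics) (G, c) = (\<Prod>v\<in>sites. site_const v) / k * (\<Prod>v\<in>sites. site_factor G v)"
proof -
  have a: "G \<subseteq> segments T D" "\<And>C. C \<notin> cells T D \<Longrightarrow> c C = undefined" "c init \<in> {1..k}"
    using assms initial_cell_in unfolding configs_iff by (auto simp: PiE_iff extensional_def)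
  have "(\<Prod>v\<in>sites. pmf (outcome_law (G, c) v) (outcome (G, c) v))
     = (\<Prod>v\<in>sites. site_const v * site_factor G v)"
    by (rule prod.cong) (use pmf_site_consistent assms in auto)
  then show ?thesis unfolding pmf_dynamics using a by (simp add: prod.distrib)
qed

end

section \<open>Edges and primary edges\<close>

context tessellated_window begin

definition iseg :: "point \<Rightarrow> point set \<Rightarrow> point set" where
  "iseg v l = (if l = up v then quad v 0 (-1) else quad v 1 0)"

lemma iseg_props:
  assumes "v \<in> N" "l \<in> lines_at v"
  shows "iseg v l \<in> segments T D" "iseg v l \<subseteq> l" "v \<in> closure (iseg v l)" "\<And>q. q \<in> iseg v l \<Longrightarrow> fst q < fst v"
proof -
  note sg = quad_seg_up[OF assms(1), of "-1"] quad_seg_lo[OF assms(1), of 1]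
  have cl: "v \<in> closure (quad v 0 (-1))" "v \<in> closure (quad v 1 0)" using node_in_closure_quad[OF assms(1)] by auto
  have f: "\<forall>q\<in>quad v 0 (-1). fst q < fst v" "\<forall>q\<in>quad v 1 0. fst q < fst v" using quad_fst(2)[OF assms(1)] by auto
  have "l = up v \<or> l = lo v" using assms unfolding lines_at_def by simp
  then have "iseg v l \<in> segments T D \<and> iseg v l \<subseteq> l \<and> v \<in> closure (iseg v l) \<and> (\<forall>q\<in>iseg v l. fst q < fst v)"
    using sg cl f node_up_lo(6)[OF assms(1)] unfolding iseg_def by auto
  then show "iseg v l \<in> segments T D" "iseg v l \<subseteq> l" "v \<in> closure (iseg v l)" "\<And>q. q \<in> iseg v l \<Longrightarrow> fst q < fst v"
    by blast+
qed

lemma convex_seg: "s \<in> segments T D \<Longrightarrow> convex s"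
proof -
  assume a: "s \<in> segments T D"
  show "convex s" by (rule segE[OF a]) (simp only: convex_face)
qed

lemma connected_seg: "s \<in> segments T D \<Longrightarrow> connected s"
  using convex_seg convex_connected by blast

lemma connected_insert_closure:
  assumes "connected s" "x \<in> closure s" shows "connected (insert x s)"
  by (rule connected_intermediate_closure[OF assms(1)]) (use assms(2) closure_subset in auto)

lemma seg_zeros: "s \<in> segments T D \<Longrightarrow> m \<in> T \<Longrightarrow> s \<subseteq> m \<Longrightarrow> x \<in> s \<Longrightarrow> x \<in> D \<and> zeros x = {m}"
proof -
  assume a: "s \<in> segments T D" "m \<in> T" "s \<subseteq> m" "x \<in> s"
  obtain q l where q: "q \<in> s" "q \<in> D" "s = face q" "zeros q = {l}" "l \<in> L" by (rule segE[OF a(1)])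
  have "x \<in> face q" using a(4) unfolding q(3) .
  then have x: "x \<in> D" "zeros x = {l}" using face_sub zeros_face q(4) by blast+
  then have "m \<in> zeros x" using zeros_eq a by blast
  then show ?thesis using x by blast
qed

text \<open>On its line a segment gains only nodes and frontier points in the closure, so the
  segments of a line do not overlap even after closing them, except at these points.\<close>

lemma closure_seg_mem:
  assumes "s \<in> segments T D" "x \<in> closure s" "x \<in> D" "zeros x = {m}" "s \<subseteq> m" "m \<in> T"
  shows "x \<in> s"
proof -
  obtain q where q: "q \<in> s" using seg_nonempty[OF assms(1)] by blast
  then have qD: "q \<in> D" "zeros q = {m}" using seg_zeros assms by blast+
  have s: "s = face q" using segE[OF assms(1)] face_eq q by metis
  have xc: "x \<in> closure (face q)" using assms(2) by (rule subst[OF s])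
  have "sgn (hgt j x) = sgn (hgt j q)" if "j \<in> L" for j
  proof (cases "j = m")
    case True
    then have "hgt j x = 0" "hgt j q = 0" using assms(4) qD(2) unfolding zeros_def by blast+
    then show ?thesis by simp
  next
    case False
    then have "hgt j x \<noteq> 0" using assms(4) that unfolding zeros_def by blast
    moreover have "hgt j x = 0 \<or> sgn (hgt j x) = sgn (hgt j q)" using xc closure_face[OF qD(1)] that by blast
    ultimately show ?thesis by blast
  qed
  then show ?thesis unfolding s face_def using assms(3) by blast
qed

lemma segs_meet_eq:
  assumes "s \<in> segments T D" "s' \<in> segments T D" "x \<in> s" "x \<in> s'" shows "s = s'"
  using segE[OF assms(1)] segE[OF assms(2)] face_eq assms(3,4) by metis

text \<open>Time is a coordinate on a line that is not vertical, so connected subsets are intervals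
  in time.\<close>

lemma line_order_convex:
  assumes "m \<in> T" "connected K" "K \<subseteq> m" "p \<in> K" "q \<in> K" "r \<in> m" "fst p \<le> fst r" "fst r \<le> fst q"
  shows "r \<in> K"
proof -
  have "connected (fst ` K)" using assms(2) by (intro connected_continuous_image continuous_intros)
  then have "fst r \<in> fst ` K" using connectedD_interval[of "fst ` K" "fst p" "fst q" "fst r"] assms by auto
  then obtain r' where "r' \<in> K" "fst r' = fst r" by auto
  then show ?thesis using line_inj[OF assms(1), of r' r] assms by blast
qed

text \<open>Otherwise the later site would lie inside the segment, but an open segment contains
  neither nodes nor frontier points.\<close>

lemma seg_before:
  assumes "v \<in> sites" "m \<in> lines_at v" "w \<in> sites" "w \<in> m" "fst v < fst w" "y \<in> oseg v m"
  shows "fst y < fst w"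
proof (rule ccontr)
  assume "\<not> fst y < fst w"
  note o = oseg_props[OF assms(1,2)]
  have "connected (insert v (oseg v m))" by (rule connected_insert_closure[OF connected_seg[OF o(1)] o(3)])
  then have "w \<in> insert v (oseg v m)"
    by (rule line_order_convex[OF o(6), of _ v y]) (use o(2,7) assms \<open>\<not> fst y < fst w\<close> in auto)
  then have "w \<in> oseg v m" using assms(5) by auto
  then have w: "w \<in> D" "zeros w = {m}" using seg_zeros[OF o(1,6,2)] by blast+
  from assms(3) show False
  proof (cases rule: site_cases)
    case 1
    have "{m} = {up w, lo w}" using w zeros_eq[OF w(1)] node_lines_eq[OF 1] by simp
    then show False using node_up_lo(6)[OF 1] by (metis doubleton_eq_iff insert_absorb2)
  next
    case 2
    then show False using entry(5) w(1) by blast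
  qed
qed

text \<open>A base point for components. The starting site cannot serve, since an edge does not
  contain a vertex or frontier point at which it starts.\<close>

definition pt :: "point set \<Rightarrow> point" where "pt s = (SOME x. x \<in> s)"

lemma pt_in: "s \<in> segments T D \<Longrightarrow> pt s \<in> s"
  unfolding pt_def using seg_nonempty some_in_eq by blast

lemma oseg_of_line:
  assumes "s \<in> segments T D" "s \<subseteq> m" "m \<in> T"
  shows "\<exists>v\<in>sites. m \<in> lines_at v \<and> s = oseg v m"
proof -
  obtain v l where v: "v \<in> sites" "l \<in> lines_at v" "s = oseg v l" using seg_is_oseg[OF assms(1)] by blast
  have "l = m" by (rule seg_line_unique[OF assms(1) _ assms(3) _ assms(2)]) (use v oseg_props in auto)
  then show ?thesis using v by blast
qed

lemma seg_in_component:
  assumes "s \<in> segments T D" "s \<subseteq> P" shows "s \<subseteq> connected_component_set P (pt s)"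
  using connected_component_maximal[OF pt_in connected_seg] assms by blast

lemma component_pt:
  assumes "s \<in> segments T D" "s \<subseteq> K" "K \<in> components P" shows "K = connected_component_set P (pt s)"
proof -
  obtain x where x: "x \<in> P" "K = connected_component_set P x" using assms(3) by (auto simp: components_def)
  have "pt s \<in> connected_component_set P x" using pt_in[OF assms(1)] assms(2) x(2) by blast
  then show ?thesis using x(2) connected_component_eq by metis
qed

text \<open>A connected set stays connected when a point of its closure is added, so a component
  contains both or neither.\<close>

lemma component_absorbs:
  assumes "K \<in> components P" "s \<in> segments T D" "s \<subseteq> P" "x \<in> closure s" "x \<in> P"
  shows "x \<in> K \<longleftrightarrow> s \<subseteq> K"
proof
  have c: "connected (insert x s)" "insert x s \<subseteq> P"
    using connected_insert_closure[OF connected_seg] assms by blast+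
  {
    assume "x \<in> K"
    then have "insert x s \<subseteq> K" using components_maximal[OF assms(1) c] by blast
    then show "s \<subseteq> K" by blast
  }
  {
    assume "s \<subseteq> K"
    then have "insert x s \<subseteq> K" using components_maximal[OF assms(1) c] seg_nonempty[OF assms(2)] by blast
    then show "x \<in> K" by blast
  }
qed

end

text \<open>The parts \<open>P m\<close> of a graph on the lines \<open>m\<close>, where \<open>J v m\<close> says that the segment that leaves \<open>v\<close> along
  \<open>m\<close> is joined within \<open>P m\<close> to the one before it. The components are then counted by their
  first segments.\<close>

locale line_parts = tessellated_window T D for T D +
  fixes G :: "point set set" and P :: "point set \<Rightarrow> point set" and J :: "point \<Rightarrow> point set \<Rightarrow> bool"
  assumes G_seg: "G \<subseteq> segments T D"
    and P_line: "\<And>m. m \<in> T \<Longrightarrow> P m \<subseteq> m"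
    and seg_P: "\<And>m s. m \<in> T \<Longrightarrow> s \<in> G \<Longrightarrow> s \<subseteq> m \<Longrightarrow> s \<subseteq> P m"
    and P_closure: "\<And>m x. m \<in> T \<Longrightarrow> x \<in> P m \<Longrightarrow> \<exists>s\<in>G. s \<subseteq> m \<and> x \<in> closure s"
    and joined: "\<And>m v. v \<in> sites \<Longrightarrow> m \<in> lines_at v \<Longrightarrow> oseg v m \<in> G \<Longrightarrow> J v m \<Longrightarrow>
      v \<in> P m \<and> (\<exists>s\<in>G. s \<subseteq> m \<and> v \<in> closure s \<and> (\<forall>q\<in>s. fst q < fst v))"
    and separated: "\<And>m v y. v \<in> sites \<Longrightarrow> m \<in> lines_at v \<Longrightarrow> oseg v m \<in> G \<Longrightarrow> \<not> J v m \<Longrightarrow>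
      y \<in> P m \<Longrightarrow> fst y < fst v \<Longrightarrow> \<exists>z\<in>m - P m. fst y < fst z \<and> fst z \<le> fst v"
begin

definition starts :: "(point \<times> point set) set" where
  "starts = (SIGMA v:sites. {m \<in> lines_at v. oseg v m \<in> G \<and> \<not> J v m})"

definition comp_of :: "point \<times> point set \<Rightarrow> point set" where
  "comp_of = (\<lambda>(v, m). connected_component_set (P m) (pt (oseg v m)))"

lemma startsD:
  assumes "(v, m) \<in> starts"
  shows "v \<in> sites" "m \<in> lines_at v" "oseg v m \<in> G" "\<not> J v m" "m \<in> T" "oseg v m \<subseteq> P m"
    "oseg v m \<subseteq> comp_of (v, m)" "comp_of (v, m) \<in> components (P m)" "comp_of (v, m) \<subseteq> m"
proof -
  show s: "v \<in> sites" "m \<in> lines_at v" "oseg v m \<in> G" "\<not> J v m" using assms unfolding starts_def by auto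
  note o = oseg_props[OF s(1,2)]
  show "m \<in> T" by (rule o(6))
  show p: "oseg v m \<subseteq> P m" using seg_P[OF o(6) s(3) o(2)] .
  show "oseg v m \<subseteq> comp_of (v, m)" unfolding comp_of_def prod.case by (rule seg_in_component[OF o(1) p])
  show c: "comp_of (v, m) \<in> components (P m)" unfolding comp_of_def prod.case
    using pt_in[OF o(1)] p by (auto simp: components_def)
  show "comp_of (v, m) \<subseteq> m" using in_components_subset[OF c] P_line[OF o(6)] by blast
qed

text \<open>Take the earliest segment of the component. Were it joined to one before it, the
  connecting site and hence that earlier segment would be in the same component.\<close>

lemma component_start:
  assumes "m \<in> T" "K \<in> components (P m)" shows "\<exists>v. (v, m) \<in> starts \<and> K = comp_of (v, m)"
proof -
  let ?S = "{s \<in> G. s \<subseteq> m \<and> s \<subseteq> K}"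
  have "K \<noteq> {}" "K \<subseteq> P m" using assms(2) in_components_nonempty in_components_subset by blast+
  then obtain x where x: "x \<in> K" "x \<in> P m" by blast
  obtain s0 where s0: "s0 \<in> G" "s0 \<subseteq> m" "x \<in> closure s0" using P_closure[OF assms(1) x(2)] by blast
  have "s0 \<subseteq> K"
    using component_absorbs[OF assms(2) _ seg_P[OF assms(1) s0(1,2)] s0(3) x(2)] G_seg s0(1) x(1) by blast
  then have ne: "?S \<noteq> {}" using s0 by blast
  have fin: "finite ?S" using finite_subset[OF G_seg finite_segments] by simp
  obtain s where s: "s \<in> ?S" "\<And>s'. s' \<in> ?S \<Longrightarrow> stime s \<le> stime s'"
    using ex_is_arg_min_if_finite[OF fin ne, of stime] unfolding is_arg_min_linorder by blast
  have sg: "s \<in> segments T D" "s \<subseteq> m" "s \<in> G" "s \<subseteq> K" using s(1) G_seg by auto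
  obtain v where v: "v \<in> sites" "m \<in> lines_at v" "s = oseg v m" using oseg_of_line[OF sg(1,2) assms(1)] by blast
  have "\<not> J v m"
  proof
    assume "J v m"
    then obtain s' where s': "v \<in> P m" "s' \<in> G" "s' \<subseteq> m" "v \<in> closure s'" "\<forall>q\<in>s'. fst q < fst v"
      using joined[OF v(1,2)] v(3) sg(3) by blast
    have vs: "v \<in> closure s" using oseg_props(3)[OF v(1,2)] v(3) by simp
    have "v \<in> K" using component_absorbs[OF assms(2) sg(1) seg_P[OF assms(1) sg(3,2)] vs s'(1)] sg(4) by blast
    then have "s' \<subseteq> K"
      using component_absorbs[OF assms(2) _ seg_P[OF assms(1) s'(2,3)] s'(4,1)] G_seg s'(2) by blast
    then have le: "stime s \<le> stime s'" using s(2) s' by blast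
    have sg': "s' \<in> segments T D" using G_seg s'(2) by blast
    have "stime s' < fst v" using stime_less[OF sg' pt_in[OF sg']] s'(5) pt_in[OF sg'] by fastforce
    then show False using le stime_oseg[OF v(1,2)] v(3) by simp
  qed
  then have st: "(v, m) \<in> starts" unfolding starts_def using v sg(3) by blast
  have "K = connected_component_set (P m) (pt s)" by (rule component_pt[OF sg(1,4) assms(2)])
  then show ?thesis using st v(3) unfolding comp_of_def by (intro exI[of _ v]) simp
qed

lemma comp_of_line:
  assumes "(v, m) \<in> starts" "l \<in> T" "comp_of (v, m) \<subseteq> l" shows "l = m"
proof (rule seg_line_unique[of "oseg v m"])
  note s = startsD[OF assms(1)]
  show "oseg v m \<in> segments T D" "m \<in> T" "oseg v m \<subseteq> m" using oseg_props[OF s(1,2)] by blast+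
  show "l \<in> T" "oseg v m \<subseteq> l" using assms s(7) by blast+
qed

lemma line_of_comp: assumes "(v, m) \<in> starts" shows "line_of T (comp_of (v, m)) = m"
  unfolding line_of_def using comp_of_line[OF assms] startsD(5,9)[OF assms] by (intro the_equality) blast+

text \<open>No component starts twice: between a point of the first starting segment and the later
  start there is a gap \<open>z\<close> in \<open>P m\<close>, while a connected part of the line
  reaching beyond that start would contain it.\<close>

lemma starts_not_less:
  assumes "(v, m) \<in> starts" "(w, m) \<in> starts" "comp_of (v, m) = comp_of (w, m)" "fst v < fst w" shows False
proof -
  note s = startsD[OF assms(1)] and t = startsD[OF assms(2)]
  note o = oseg_props[OF s(1,2)] and p = oseg_props[OF t(1,2)]
  let ?K = "comp_of (v, m)" and ?y = "pt (oseg v m)" and ?q = "pt (oseg w m)"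
  have y: "?y \<in> oseg v m" "?y \<in> ?K" "?y \<in> P m" using pt_in[OF o(1)] s(6,7) by blast+
  have q: "?q \<in> oseg w m" "?q \<in> ?K" using pt_in[OF p(1)] t(7) assms(3) by blast+
  have "fst ?y < fst w" by (rule seg_before[OF s(1,2) t(1) p(7) assms(4) y(1)])
  then obtain z where z: "z \<in> m - P m" "fst ?y < fst z" "fst z \<le> fst w" using separated[OF t(1-4) y(3)] by blast
  have "fst w < fst ?q" using p(4) q(1) by blast
  then have "z \<in> ?K"
    by (intro line_order_convex[OF s(5) in_components_connected[OF s(8)] s(9) y(2) q(2)]) (use z in auto)
  then show False using z(1) in_components_subset[OF s(8)] by blast
qed

lemma bij_comp_of: "bij_betw comp_of starts (\<Union>m\<in>T. components (P m))"
proof (rule bij_betw_imageI)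
  show "inj_on comp_of starts"
  proof (rule inj_onI)
    fix x y assume xy: "x \<in> starts" "y \<in> starts" "comp_of x = comp_of y"
    obtain v m w j where e: "x = (v, m)" "y = (w, j)" by (cases x, cases y)
    note s = startsD[OF xy(1)[unfolded e]] and t = startsD[OF xy(2)[unfolded e]]
    have "j = m" using comp_of_line[OF xy(1)[unfolded e] t(5)] t(9) xy(3) e by simp
    moreover then have "\<not> fst v < fst w" "\<not> fst w < fst v"
      using starts_not_less[of v m w] starts_not_less[of w m v] xy e by auto
    moreover have "v \<in> m" "w \<in> j" using oseg_props(7) s(1,2) t(1,2) by blast+
    ultimately show "x = y" using line_inj[OF s(5), of v w] e by auto
  qed
  show "comp_of ` starts = (\<Union>m\<in>T. components (P m))"
  proof (intro equalityI subsetI)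
    fix K assume "K \<in> comp_of ` starts"
    then obtain v m where "(v, m) \<in> starts" "K = comp_of (v, m)" by auto
    then show "K \<in> (\<Union>m\<in>T. components (P m))" using startsD(5,8) by blast
  next
    fix K assume "K \<in> (\<Union>m\<in>T. components (P m))"
    then show "K \<in> comp_of ` starts" using component_start by blast
  qed
qed

end

section \<open>Nodes passed straight, and their effect on edges and primary edges\<close>

context tessellated_window begin

definition str_up :: "point set set \<Rightarrow> point \<Rightarrow> bool" where
  "str_up G v \<longleftrightarrow> quad v 0 (-1) \<in> G \<and> quad v 0 1 \<in> G \<and> quad v 1 0 \<notin> G \<and> quad v (-1) 0 \<notin> G"

definition str_lo :: "point set set \<Rightarrow> point \<Rightarrow> bool" where
  "str_lo G v \<longleftrightarrow> quad v 1 0 \<in> G \<and> quad v (-1) 0 \<in> G \<and> quad v 0 (-1) \<notin> G \<and> quad v 0 1 \<notin> G"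

text \<open>The graph runs through the node on one line and misses the other line there: the node
  lies inside an edge and is no vertex.\<close>

definition straight :: "point set set \<Rightarrow> point \<Rightarrow> bool" where
  "straight G v \<longleftrightarrow> str_up G v \<or> str_lo G v"

definition along :: "point set set \<Rightarrow> point \<Rightarrow> point set" where
  "along G v = (if str_up G v then up v else lo v)"

definition across :: "point set set \<Rightarrow> point \<Rightarrow> point set" where
  "across G v = (if str_up G v then lo v else up v)"

lemma V_vertices_eq:
  assumes G: "G \<subseteq> segments T D"
  shows "V_vertices T D G = {v \<in> N. degree G v = 2 \<and> \<not> straight G v}"
proof -
  have "(\<exists>l\<in>T. \<forall>s\<in>G. v \<in> closure s \<longrightarrow> s \<subseteq> l) \<longleftrightarrow> straight G v" if v: "v \<in> N" and d: "degree G v = 2" for v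
  proof
    note ul = node_up_lo[OF v] and su = quad_seg_up[OF v] and sl = quad_seg_lo[OF v]
    have cl: "v \<in> closure (quad v 0 1)" "v \<in> closure (quad v 0 (-1))" "v \<in> closure (quad v 1 0)" "v \<in> closure (quad v (-1) 0)"
      using node_in_closure_quad[OF v] by auto
    {
      assume "\<exists>l\<in>T. \<forall>s\<in>G. v \<in> closure s \<longrightarrow> s \<subseteq> l"
      then obtain l where l: "l \<in> T" "\<forall>s\<in>G. v \<in> closure s \<longrightarrow> s \<subseteq> l" by blast
      have u: "l = up v" if "quad v 0 \<tau> \<in> G" "\<tau> \<in> {-1, 1}" for \<tau>
        using seg_line_unique[OF su(1)[OF that(2)] l(1) ul(7) _ su(2)[OF that(2)]] l(2) that cl by auto
      have w: "l = lo v" if "quad v \<sigma> 0 \<in> G" "\<sigma> \<in> {-1, 1}" for \<sigma>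
        using seg_line_unique[OF sl(1)[OF that(2)] l(1) ul(8) _ sl(2)[OF that(2)]] l(2) that cl by auto
      show "straight G v"
        using d u[of 1] u[of "-1"] w[of 1] w[of "-1"] ul(6) unfolding degree_node[OF v G] straight_def str_up_def str_lo_def
        by (auto simp: of_bool_def split: if_splits)
    }
    {
      assume "straight G v"
      moreover have "s \<in> {quad v 0 1, quad v 0 (-1), quad v 1 0, quad v (-1) 0}" if "s \<in> G" "v \<in> closure s" for s
        using seg_at_node[OF v] that G by blast
      ultimately have "(\<forall>s\<in>G. v \<in> closure s \<longrightarrow> s \<subseteq> up v) \<or> (\<forall>s\<in>G. v \<in> closure s \<longrightarrow> s \<subseteq> lo v)"
        using su(2) sl(2) unfolding straight_def str_up_def str_lo_def by blast
      then show "\<exists>l\<in>T. \<forall>s\<in>G. v \<in> closure s \<longrightarrow> s \<subseteq> l" using ul(7,8) by blast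
    }
  qed
  then show ?thesis unfolding V_vertices_def N_def by blast
qed

lemma straight_degree: assumes "v \<in> N" "G \<subseteq> segments T D" "straight G v" shows "degree G v = 2"
  using assms(3) unfolding degree_node[OF assms(1,2)] straight_def str_up_def str_lo_def by auto

text \<open>Two segments at a node are either collinear, hence passed straight, or form a V-vertex;
  degree 1 is excluded, so nothing else lies between the graph's nodes and its vertices.\<close>

lemma interior_vertices_eq:
  assumes G: "G \<subseteq> segments T D" and d: "\<forall>v\<in>N. degree G v \<in> {0, 2, 3, 4}"
  shows "interior_vertices T D G = {v \<in> N. degree G v \<noteq> 0 \<and> \<not> straight G v}"
proof (rule set_eqI)
  fix v
  show "v \<in> interior_vertices T D G \<longleftrightarrow> v \<in> {v \<in> N. degree G v \<noteq> 0 \<and> \<not> straight G v}"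
    using d[rule_format, of v] straight_degree[OF _ G, of v]
    unfolding interior_vertices_def V_vertices_eq[OF G] T_vertices_def X_vertices_def N_def[symmetric] by auto
qed

lemma degree_pos:
  assumes "v \<in> N" "G \<subseteq> segments T D" shows "degree G v \<noteq> 0 \<longleftrightarrow> (\<exists>s\<in>G. v \<in> closure s)"
proof -
  have "finite {s \<in> G. v \<in> closure s}" using finite_subset[OF assms(2) finite_segments] by simp
  then show ?thesis unfolding degree_def by auto
qed

lemma straight_oseg:
  assumes "v \<in> N" "m \<in> lines_at v" "oseg v m \<in> G" "straight G v"
  shows "iseg v m \<in> G" "m = along G v"
proof -
  have m: "m = up v \<or> m = lo v" using assms(1,2) unfolding lines_at_def by simp
  from m have "iseg v m \<in> G \<and> m = along G v"
  proof
    assume "m = up v"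
    then show ?thesis using assms(1,3,4)
      unfolding oseg_def iseg_def straight_def str_up_def str_lo_def along_def by (simp, blast?)
  next
    assume "m = lo v"
    then show ?thesis using assms(1,3,4) node_up_lo(6)[OF assms(1), symmetric]
      unfolding oseg_def iseg_def straight_def str_up_def str_lo_def along_def by (simp, blast?)
  qed
  then show "iseg v m \<in> G" "m = along G v" by blast+
qed

text \<open>A primary edge is broken only where the arriving segment on the same line is missing; T-
  and X-vertices caused by the other line do not matter.\<close>

lemma line_parts_primary:
  assumes G: "G \<subseteq> segments T D"
  shows "line_parts T D G (part_on_line G) (\<lambda>v m. v \<in> N \<and> iseg v m \<in> G)"
proof unfold_locales
  show "G \<subseteq> segments T D" by fact
  show "part_on_line G m \<subseteq> m" if "m \<in> T" for m
    unfolding part_on_line_def using closure_on_line[OF that] by blast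
  show "s \<subseteq> part_on_line G m" if "m \<in> T" "s \<in> G" "s \<subseteq> m" for m s
    unfolding part_on_line_def using closure_subset that by blast
  show "\<exists>s\<in>G. s \<subseteq> m \<and> x \<in> closure s" if "m \<in> T" "x \<in> part_on_line G m" for m x
    using that unfolding part_on_line_def by blast
  show "v \<in> part_on_line G m \<and> (\<exists>s\<in>G. s \<subseteq> m \<and> v \<in> closure s \<and> (\<forall>q\<in>s. fst q < fst v))"
    if "v \<in> sites" "m \<in> lines_at v" "oseg v m \<in> G" "v \<in> N \<and> iseg v m \<in> G" for m v
    using iseg_props[of v m] that unfolding part_on_line_def by blast
  fix m v y
  assume v: "v \<in> sites" "m \<in> lines_at v" "oseg v m \<in> G" "\<not> (v \<in> N \<and> iseg v m \<in> G)"
    and y: "y \<in> part_on_line G m" "fst y < fst v"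
  obtain s where s: "s \<in> G" "s \<subseteq> m" "y \<in> closure s" using y(1) unfolding part_on_line_def by blast
  have sg: "s \<in> segments T D" using s(1) G by blast
  note o = oseg_props[OF v(1,2)]
  from v(1) show "\<exists>z\<in>m - part_on_line G m. fst y < fst z \<and> fst z \<le> fst v"
  proof (cases rule: site_cases)
    case 1
    note i = iseg_props[OF 1 v(2)]
    \<comment> \<open>The missing segment supplies the gap: it reaches up to \<open>v\<close>, so
      some of its points come after \<open>y\<close>, and no other segment of this line has them in
      its closure.\<close>
    have "\<exists>z\<in>iseg v m. fst y < fst z"
    proof (rule ccontr)
      assume "\<not> (\<exists>z\<in>iseg v m. fst y < fst z)"
      then have "iseg v m \<subseteq> {z. fst z \<le> fst y}" by auto
      moreover have "closed {z::point. fst z \<le> fst y}" by (intro closed_Collect_le continuous_intros)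
      ultimately have "closure (iseg v m) \<subseteq> {z. fst z \<le> fst y}" by (rule closure_minimal)
      then show False using i(3) y(2) by auto
    qed
    then obtain z where z: "z \<in> iseg v m" "fst y < fst z" by blast
    have zD: "z \<in> D" "zeros z = {m}" using seg_zeros[OF i(1) o(6) i(2) z(1)] by blast+
    have "z \<notin> part_on_line G m"
    proof
      assume "z \<in> part_on_line G m"
      then obtain r where r: "r \<in> G" "r \<subseteq> m" "z \<in> closure r" unfolding part_on_line_def by blast
      have rs: "r \<in> segments T D" using r(1) G by blast
      have "z \<in> r" by (rule closure_seg_mem[OF rs r(3) zD r(2) o(6)])
      then have "r = iseg v m" using segs_meet_eq[OF rs i(1) _ z(1)] by blast
      then show False using v(4) 1 r(1) by blast
    qed
    then show ?thesis using z i(2) i(4)[OF z(1)] by (intro bexI[of _ z]) auto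
  next
    case 2
    have m: "m = lin v" using v(2) 2 unfolding lines_at_def by simp
    \<comment> \<open>Nothing of the line inside the window precedes its entry point, so the
      hypothesis on \<open>y\<close> is contradictory.\<close>
    have "fst v \<le> fst y"
    proof (rule closure_fst_ge[OF _ s(3)])
      fix q assume q: "q \<in> s"
      have "q \<in> D" "q \<in> lin v" using seg_zeros[OF sg o(6) s(2) q] s(2) q m by blast+
      then show "fst v \<le> fst q" using entry(7)[OF 2(1)] by (simp add: less_imp_le)
    qed
    then show ?thesis using y(2) by simp
  qed
qed

definition edge_part :: "point set set \<Rightarrow> point set \<Rightarrow> point set" where
  "edge_part G m = part_on_line G m \<inter> D - interior_vertices T D G"

text \<open>Edges break at every vertex. The separating point is the site itself, which as a vertex
  or frontier point is not in \<open>edge_part\<close>.\<close>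

lemma line_parts_edges:
  assumes G: "G \<subseteq> segments T D" and d: "\<forall>v\<in>N. degree G v \<in> {0, 2, 3, 4}"
  shows "line_parts T D G (edge_part G) (\<lambda>v m. v \<in> N \<and> straight G v)"
proof unfold_locales
  note iv = interior_vertices_eq[OF G d]
  show "G \<subseteq> segments T D" by fact
  show "edge_part G m \<subseteq> m" if "m \<in> T" for m
    unfolding edge_part_def part_on_line_def using closure_on_line[OF that] by blast
  show "s \<subseteq> edge_part G m" if m: "m \<in> T" "s \<in> G" "s \<subseteq> m" for m s
  proof
    fix x assume x: "x \<in> s"
    have "x \<in> D" "zeros x = {m}" using seg_zeros[OF _ m(1,3) x] G m(2) by blast+
    moreover have "x \<notin> N"
    proof
      assume n: "x \<in> N"
      have "{m} = {up x, lo x}" using \<open>zeros x = {m}\<close> zeros_eq[OF \<open>x \<in> D\<close>] node_lines_eq[OF n] by simp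
      then show False using node_up_lo(6)[OF n] by (metis doubleton_eq_iff insert_absorb2)
    qed
    moreover have "x \<in> part_on_line G m" unfolding part_on_line_def using closure_subset m x by blast
    ultimately show "x \<in> edge_part G m" unfolding edge_part_def iv by blast
  qed
  show "\<exists>s\<in>G. s \<subseteq> m \<and> x \<in> closure s" if "m \<in> T" "x \<in> edge_part G m" for m x
    using that unfolding edge_part_def part_on_line_def by blast
  show "v \<in> edge_part G m \<and> (\<exists>s\<in>G. s \<subseteq> m \<and> v \<in> closure s \<and> (\<forall>q\<in>s. fst q < fst v))"
    if v: "v \<in> sites" "m \<in> lines_at v" "oseg v m \<in> G" "v \<in> N \<and> straight G v" for m v
  proof -
    have n: "v \<in> N" "straight G v" using v(4) by blast+
    have i: "iseg v m \<in> G" using straight_oseg(1)[OF n(1) v(2,3) n(2)] .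
    note ip = iseg_props[OF n(1) v(2)]
    have "v \<in> part_on_line G m" unfolding part_on_line_def using ip(2,3) i by blast
    then have "v \<in> edge_part G m" unfolding edge_part_def iv using n node_D[OF n(1)] by blast
    then show ?thesis using i ip by blast
  qed
  show "\<exists>z\<in>m - edge_part G m. fst y < fst z \<and> fst z \<le> fst v"
    if v: "v \<in> sites" "m \<in> lines_at v" "oseg v m \<in> G" "\<not> (v \<in> N \<and> straight G v)" "y \<in> edge_part G m" "fst y < fst v" for m v y
  proof -
    note o = oseg_props[OF v(1,2)]
    have "v \<notin> edge_part G m"
      using v(1)
    proof (cases rule: site_cases)
      case 1
      then have "degree G v \<noteq> 0" using degree_pos[OF 1 G] o(3) v(3) by blast
      then show ?thesis unfolding edge_part_def iv using 1 v(4) by blast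
    next
      case 2
      then show ?thesis unfolding edge_part_def using entry(5)[OF 2(1)] by blast
    qed
    then show ?thesis using o(7) v(6) by (intro bexI[of _ v]) auto
  qed
qed

lemma edges_eq: "edges T D G = (\<Union>m\<in>T. components (edge_part G m))"
  unfolding edges_def edge_part_def ..

lemma primary_edges_eq: "primary_edges T G = (\<Union>m\<in>T. components (part_on_line G m))"
  unfolding primary_edges_def ..

lemma straight_along:
  assumes "v \<in> N" "straight G v" 
  shows "along G v \<in> lines_at v" "across G v \<in> lines_at v" "along G v \<noteq> across G v" "oseg v (along G v) \<in> G" "iseg v (along G v) \<in> G"
    "along G v \<in> T" "across G v \<in> T" "v \<in> along G v" "v \<in> across G v"
proof -
  note ul = node_up_lo[OF assms(1)]
  show "along G v \<in> lines_at v" "across G v \<in> lines_at v" "along G v \<noteq> across G v" "oseg v (along G v) \<in> G" "iseg v (along G v) \<in> G"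
    "along G v \<in> T" "across G v \<in> T" "v \<in> along G v" "v \<in> across G v"
    using ul assms unfolding along_def across_def lines_at_def oseg_def iseg_def straight_def str_up_def str_lo_def by auto
qed

text \<open>Turns the double sum over edges and lines crossing them into a sum over nodes. A
  straight node belongs to one open edge and has one other line; that pair determines it as the
  intersection of two lines.\<close>

lemma bij_crossings:
  assumes G: "G \<subseteq> segments T D" and d: "\<forall>v\<in>N. degree G v \<in> {0, 2, 3, 4}"
  shows "bij_betw (\<lambda>v. (connected_component_set (edge_part G (along G v)) v, across G v))
    {v \<in> N. straight G v} (SIGMA e:edges T D G. crossing_lines T e)"
proof -
  interpret line_parts T D G "edge_part G" "\<lambda>v m. v \<in> N \<and> straight G v" by (rule line_parts_edges[OF assms])
  note iv = interior_vertices_eq[OF G d]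
  let ?e = "\<lambda>v. connected_component_set (edge_part G (along G v)) v"
  have A: "v \<in> ?e v \<and> ?e v \<in> components (edge_part G (along G v)) \<and> iseg v (along G v) \<subseteq> ?e v"
    if v: "v \<in> N" "straight G v" for v
  proof -
    note sa = straight_along[OF v] and ip = iseg_props[OF v(1) straight_along(1)[OF v]]
    have "v \<in> part_on_line G (along G v)" unfolding part_on_line_def using ip sa by blast
    then have vP: "v \<in> edge_part G (along G v)" unfolding edge_part_def iv using v node_D by blast
    then have c: "v \<in> ?e v" "?e v \<in> components (edge_part G (along G v))"
      by (auto simp: components_def connected_component_refl)
    have "iseg v (along G v) \<subseteq> ?e v"
      using component_absorbs[OF c(2) ip(1) seg_P[OF sa(6,5) ip(2)] ip(3) vP] c(1) by blast
    then show ?thesis using c by blast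
  qed
  have sub: "K \<subseteq> m" if "m \<in> T" "K \<in> components (edge_part G m)" for K m
    using in_components_subset[OF that(2)] P_line[OF that(1)] by blast
  have uniq: "l = along G v" if v: "v \<in> N" "straight G v" "?e v \<subseteq> l" "l \<in> T" for v l
    using seg_line_unique[OF iseg_props(1)[OF v(1) straight_along(1)[OF v(1,2)]] v(4) straight_along(6)[OF v(1,2)] _
        iseg_props(2)[OF v(1) straight_along(1)[OF v(1,2)]]] A[OF v(1,2)] v(3) by blast
  show ?thesis
  proof (rule bij_betw_imageI)
    show "inj_on (\<lambda>v. (?e v, across G v)) {v \<in> N. straight G v}"
    proof (rule inj_onI)
      fix v w assume vw: "v \<in> {v \<in> N. straight G v}" "w \<in> {v \<in> N. straight G v}" "(?e v, across G v) = (?e w, across G w)"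
      then have v: "v \<in> N" "straight G v" and w: "w \<in> N" "straight G w" and e: "?e v = ?e w" "across G v = across G w" by auto
      note sv = straight_along[OF v] and sw = straight_along[OF w]
      have "?e w \<subseteq> along G w" using A[OF w] sub[OF sw(6)] by blast
      then have al: "along G w = along G v" using uniq[OF v _ sw(6)] e(1) by simp
      have "w \<in> along G v" "w \<in> across G v" using sw(8,9) unfolding al e(2) .
      then show "v = w" by (rule meet_unique[OF sv(6,7,3,8,9)])
    qed
    show "(\<lambda>v. (?e v, across G v)) ` {v \<in> N. straight G v} = (SIGMA e:edges T D G. crossing_lines T e)"
    proof (intro equalityI subsetI)
      fix x assume "x \<in> (\<lambda>v. (?e v, across G v)) ` {v \<in> N. straight G v}"
      then obtain v where v: "v \<in> N" "straight G v" "x = (?e v, across G v)" by blast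
      note sv = straight_along[OF v(1,2)] and a = A[OF v(1,2)]
      have "?e v \<in> edges T D G" unfolding edges_eq using a sv(6) by blast
      moreover have "across G v \<in> crossing_lines T (?e v)" unfolding crossing_lines_def
        using sv(7,9) a uniq[OF v(1,2) _ sv(7)] sv(3) by blast
      ultimately show "x \<in> (SIGMA e:edges T D G. crossing_lines T e)" using v(3) by blast
    next
      fix x assume "x \<in> (SIGMA e:edges T D G. crossing_lines T e)"
      then obtain e l where x: "x = (e, l)" "e \<in> edges T D G" "l \<in> crossing_lines T e" by blast
      obtain m where m: "m \<in> T" "e \<in> components (edge_part G m)" using x(2) unfolding edges_eq by blast
      obtain p where p: "p \<in> l" "p \<in> e" "l \<in> T" "\<not> e \<subseteq> l" using x(3) unfolding crossing_lines_def by blast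
      have em: "e \<subseteq> m" "e \<subseteq> edge_part G m" using sub[OF m] in_components_subset[OF m(2)] by blast+
      have pP: "p \<in> edge_part G m" "p \<in> m" using p(2) em by blast+
      have lm: "l \<noteq> m" using p(4) em(1) by blast
      \<comment> \<open>Another line meets the open edge in a node, and since an open edge contains
        no vertices this node is passed straight.\<close>
      have pN: "p \<in> N" unfolding N_def using nodesI[OF p(3) m(1) lm p(1) pP(2)] pP(1) unfolding edge_part_def by blast
      obtain s where s: "s \<in> G" "s \<subseteq> m" "p \<in> closure s" using P_closure[OF m(1) pP(1)] by blast
      have sg: "s \<in> segments T D" using G s(1) by blast
      have "degree G p \<noteq> 0" using degree_pos[OF pN G] s by blast
      then have st: "straight G p" using pP(1) pN unfolding edge_part_def iv by blast
      note sp = straight_along[OF pN st]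
      have "s \<subseteq> along G p"
        using seg_at_node[OF pN sg s(3)] s(1) st quad_seg_up(2)[OF pN] quad_seg_lo(2)[OF pN]
        unfolding straight_def str_up_def str_lo_def along_def by auto
      then have ma: "m = along G p" using seg_line_unique[OF sg m(1) sp(6) s(2)] by blast
      have "l = along G p \<or> l = across G p" using node_lines[OF sp(6,7,3,8,9) p(3,1)] .
      then have la: "l = across G p" using lm ma by blast
      obtain y where "y \<in> edge_part G m" "e = connected_component_set (edge_part G m) y" using m(2) by (auto simp: components_def)
      then have "e = connected_component_set (edge_part G m) p" using connected_component_eq p(2) by metis
      then have "x = (?e p, across G p)" using x(1) ma la by simp
      then show "x \<in> (\<lambda>v. (?e v, across G v)) ` {v \<in> N. straight G v}" using pN st by blast
    qed
  qed
qed

end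

section \<open>The Gibbs weight as a product over the sites\<close>

text \<open>A vanishing coefficient costs infinite energy only if a vertex of that kind occurs;
  otherwise the convention on \<open>0 * \<infinity>\<close> leaves 0. In
  \<open>exp_mult_log\<close> this corresponds to \<open>0 ^ 0 = 1\<close>.\<close>

lemma elog_mult:
  "ereal (real n) * elog x = (if x = 0 \<and> n > 0 then - \<infinity> else ereal (n * (if x = 0 then 0 else ln x)))"
  unfolding elog_def by auto

lemma exp_mult_log: 
  "0 \<le> x \<Longrightarrow> \<not> (x = 0 \<and> n > 0) \<Longrightarrow> exp (real n * (if x = 0 then 0 else ln x)) = x ^ n"
  by (cases "n = 0") (auto simp: exp_of_nat_mult)

lemma prod_power_card: "finite A \<Longrightarrow> (\<Prod>v\<in>A. if Q v then x else 1) = (x::real) ^ card {v \<in> A. Q v}"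
  using prod.inter_filter[of A "\<lambda>_. x" Q] by simp

context field_setting begin

lemma boltzmann_Phi:
  defines "nV \<equiv> \<lambda>G. card (V_vertices T D G)" and "nT \<equiv> \<lambda>G. card (T_vertices T D G)"
    and "nX \<equiv> \<lambda>G. card (X_vertices T D G)" and "nE \<equiv> \<lambda>G. card (edges T D G)"
    and "S1 \<equiv> \<lambda>G. \<Sum>e \<in> edges T D G. \<Sum>l \<in> crossing_lines T e. ln (1 - \<epsilon> * \<pi> l)"
    and "S2 \<equiv> \<lambda>G. \<Sum>v \<in> nodes_on T G. ln (1 - \<alpha> / K * (\<Prod>l \<in> {l\<in>T. v \<in> l}. \<pi> l))"
  shows "boltzmann (energy (G, c)) =
     \<alpha> ^ nV G * (K * aT) ^ nT G * (K * aX) ^ nX G * (1 / K) ^ nE G * exp (S1 G) * exp (- S2 G)"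
proof -
  have KT: "K * aT > 0" using K_pos aT_pos by simp
  have KX: "K * aX \<ge> 0" using K_pos aX_bounds by simp
  have Phi: "energy (G, c) =
     - (ereal (nV G) * elog \<alpha>) - ereal (nT G) * elog (K * aT) - ereal (nX G) * elog (K * aX)
     + ereal (nE G * ln K) - ereal (S1 G) + ereal (S2 G)"
    unfolding Phi_def assms prod.case ..
  have T: "ereal (nT G) * elog (K * aT) = ereal (nT G * ln (K * aT))"
    unfolding elog_def if_not_P[OF less_imp_neq[OF KT, symmetric]] by simp
  have eT: "exp (nT G * ln (K * aT)) = (K * aT) ^ nT G" using KT by (simp only: exp_of_nat_mult exp_ln)
  have eE: "exp (- (nE G * ln K)) = (1 / K) ^ nE G"
    using K_pos by (simp add: exp_minus exp_of_nat_mult power_divide inverse_eq_divide)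
  show ?thesis
  \<comment> \<open>Exactly the configurations of infinite energy come first; there one of the
    powers on the right is a positive power of 0. In the other case all terms are real and the
    exponential splits.\<close>
  proof (cases "\<alpha> = 0 \<and> nV G > 0 \<or> K * aX = 0 \<and> nX G > 0")
    case True
    have "energy (G, c) = \<infinity>" unfolding Phi elog_mult[of "nV G"] elog_mult[of "nX G"] T using True by auto
    moreover have "\<alpha> ^ nV G * (K * aT) ^ nT G * (K * aX) ^ nX G = 0" using True by auto
    ultimately show ?thesis unfolding boltzmann_def by simp
  next
    case False
    then have v: "\<not> (\<alpha> = 0 \<and> nV G > 0)" and x: "\<not> (K * aX = 0 \<and> nX G > 0)" by blast+
    let ?lv = "nV G * (if \<alpha> = 0 then 0 else ln \<alpha>)" and ?lx = "nX G * (if K * aX = 0 then 0 else ln (K * aX))"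
    have "energy (G, c) = ereal (- ?lv - nT G * ln (K * aT) - ?lx + nE G * ln K - S1 G + S2 G)"
      unfolding Phi elog_mult[of "nV G"] elog_mult[of "nX G"] T if_not_P[OF v] if_not_P[OF x] by simp
    then have "boltzmann (energy (G, c)) = exp (?lv + nT G * ln (K * aT) + ?lx + - (nE G * ln K) + S1 G + - S2 G)"
      unfolding boltzmann_def by (simp add: algebra_simps)
    also have "\<dots> = exp ?lv * exp (nT G * ln (K * aT)) * exp ?lx * exp (- (nE G * ln K)) * exp (S1 G) * exp (- S2 G)"
      by (simp only: exp_add)
    finally show ?thesis unfolding exp_mult_log[OF aV(1) v] exp_mult_log[OF KX x] eT eE .
  qed
qed

lemma N_B_disjoint: "N \<inter> B = {}" using entry_not_N by blast

lemma prod_sites: "(\<Prod>v\<in>sites. f v) = (\<Prod>v\<in>N. f v) * (\<Prod>v\<in>B. f v)" for f :: "point \<Rightarrow> real"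
  unfolding sites_def by (rule prod.union_disjoint[OF finite_N finite_B N_B_disjoint])

definition edge_starts :: "point set set \<Rightarrow> point \<Rightarrow> nat" where
  "edge_starts G v = card {m \<in> lines_at v. oseg v m \<in> G \<and> \<not> (v \<in> N \<and> straight G v)}"

definition primary_weight :: "point set set \<Rightarrow> point \<Rightarrow> real" where
  "primary_weight G v = (\<Prod>m \<in> {m \<in> lines_at v. oseg v m \<in> G \<and> \<not> (v \<in> N \<and> iseg v m \<in> G)}. \<pi> m)"

lemma out_lines_node:
  assumes "v \<in> N"
  shows "{m \<in> lines_at v. oseg v m \<in> G \<and> R m} =
    (if quad v 0 1 \<in> G \<and> R (up v) then {up v} else {}) \<union> (if quad v (-1) 0 \<in> G \<and> R (lo v) then {lo v} else {})"
proof -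
  have "oseg v (up v) = quad v 0 1" "oseg v (lo v) = quad v (-1) 0"
    using assms node_up_lo(6)[OF assms] unfolding oseg_def by auto
  moreover have "lines_at v = {up v, lo v}" using assms unfolding lines_at_def by simp
  ultimately show ?thesis by auto
qed

lemma out_lines_entry:
  assumes "v \<in> B"
  shows "{m \<in> lines_at v. oseg v m \<in> G \<and> \<not> (v \<in> N \<and> R m)} = (if half v 0 \<in> G then {lin v} else {})"
  using entry_not_N[OF assms] unfolding oseg_def lines_at_def by auto

text \<open>At an entry point nothing arrives, so a departing segment starts both an edge and a
  primary edge.\<close>

lemma site_factor_entry:
  assumes "v \<in> B" shows "site_factor G v = (1 / K) ^ edge_starts G v * primary_weight G v"
  using entry_not_N[OF assms]
  unfolding site_factor_def edge_starts_def primary_weight_def out_lines_entry[OF assms] by simp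

lemma site_factor_node:
  assumes "v \<in> N" "G \<subseteq> segments T D"
  shows "site_factor G v =
    (if degree G v = 2 \<and> \<not> straight G v then \<alpha> else 1) * (if degree G v = 3 then K * aT else 1) *
    (if degree G v = 4 then K * aX else 1) * (1 / K) ^ edge_starts G v *
    (if straight G v then 1 - \<epsilon> * \<pi> (across G v) else 1) *
    (if degree G v \<noteq> 0 then 1 / (1 - birth_prob (up v) (lo v)) else 1) * primary_weight G v"
proof -
  note ul = node_up_lo(6)[OF assms(1)]
  have i: "iseg v (up v) = quad v 0 (-1)" "iseg v (lo v) = quad v 1 0" using ul unfolding iseg_def by auto
  have st: "straight G v \<longleftrightarrow> (quad v 0 (-1) \<in> G \<and> quad v 0 1 \<in> G \<and> \<not> quad v 1 0 \<in> G \<and> \<not> quad v (-1) 0 \<in> G \<or>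
      quad v 1 0 \<in> G \<and> quad v (-1) 0 \<in> G \<and> \<not> quad v 0 (-1) \<in> G \<and> \<not> quad v 0 1 \<in> G)"
    unfolding straight_def str_up_def str_lo_def by blast
  have es: "edge_starts G v = (if straight G v then 0 else of_bool (quad v 0 1 \<in> G) + of_bool (quad v (-1) 0 \<in> G))"
    unfolding edge_starts_def out_lines_node[OF assms(1)] using assms(1) ul by auto
  have pw: "primary_weight G v = (if quad v 0 1 \<in> G \<and> \<not> quad v 0 (-1) \<in> G then \<pi> (up v) else 1) *
      (if quad v (-1) 0 \<in> G \<and> \<not> quad v 1 0 \<in> G then \<pi> (lo v) else 1)"
    unfolding primary_weight_def out_lines_node[OF assms(1)] i using assms(1) ul by auto
  have ac: "straight G v \<Longrightarrow> across G v = (if quad v 0 (-1) \<in> G then lo v else up v)"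
    unfolding across_def straight_def str_up_def str_lo_def by auto
  show ?thesis
    unfolding site_factor_def if_P[OF assms(1)] node_factor_def Let_def degree_node[OF assms, symmetric] st[symmetric] es pw
    using ac by simp
qed

text \<open>Every ingredient of the Gibbs weight is rewritten as a product over nodes or sites:
  vertices by their degree, edges and primary edges by \<open>bij_comp_of\<close>, crossings by
  \<open>bij_crossings\<close>.\<close>

lemma weight_eq:
  assumes cf: "(G, c) \<in> configs T D k"
  shows "boltzmann (energy (G, c)) * (\<Prod>e \<in> primary_edges T G. \<pi> (line_of T e)) = (\<Prod>v\<in>sites. site_factor G v)"
proof -
  have G: "G \<subseteq> segments T D" using cf unfolding configs_iff by blast
  have d: "\<forall>v\<in>N. degree G v \<in> {0, 2, 3, 4}" using cf unfolding configs_def mem_Collect_eq prod.case N_def by (elim conjE)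
  interpret E: line_parts T D G "edge_part G" "\<lambda>v m. v \<in> N \<and> straight G v" by (rule line_parts_edges[OF G d])
  interpret P: line_parts T D G "part_on_line G" "\<lambda>v m. v \<in> N \<and> iseg v m \<in> G" by (rule line_parts_primary[OF G])
  note fin = finite_N
  have nV: "\<alpha> ^ card (V_vertices T D G) = (\<Prod>v\<in>N. if degree G v = 2 \<and> \<not> straight G v then \<alpha> else 1)"
    unfolding V_vertices_eq[OF G] by (rule prod_power_card[OF fin, symmetric])
  have nT: "(K * aT) ^ card (T_vertices T D G) = (\<Prod>v\<in>N. if degree G v = 3 then K * aT else 1)"
    unfolding T_vertices_def N_def[symmetric] by (rule prod_power_card[OF fin, symmetric])
  have nX: "(K * aX) ^ card (X_vertices T D G) = (\<Prod>v\<in>N. if degree G v = 4 then K * aX else 1)"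
    unfolding X_vertices_def N_def[symmetric] by (rule prod_power_card[OF fin, symmetric])
  have finE: "finite E.starts" unfolding E.starts_def using finite_sites finite_lines_at by auto
  have "card (edges T D G) = card E.starts" unfolding edges_eq using bij_betw_same_card[OF E.bij_comp_of] by simp
  also have "\<dots> = (\<Sum>v\<in>sites. edge_starts G v)"
    unfolding E.starts_def edge_starts_def by (rule card_SigmaI) (use finite_sites finite_lines_at in auto)
  finally have nE: "(1 / K) ^ card (edges T D G) = (\<Prod>v\<in>sites. (1 / K) ^ edge_starts G v)"
    by (simp only: power_sum)
  have finEd: "finite (edges T D G)" unfolding edges_eq using bij_betw_finite[OF E.bij_comp_of] finE by simp
  have crT: "crossing_lines T e \<subseteq> T" for e unfolding crossing_lines_def by blast
  have crfin: "finite (crossing_lines T e)" if "e \<in> edges T D G" for e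
  proof -
    have "e \<subseteq> D" using that in_components_subset unfolding edges_eq edge_part_def by blast
    then have "crossing_lines T e \<subseteq> L" unfolding crossing_lines_def L_def by blast
    then show ?thesis using L_fin finite_subset by blast
  qed
  have "(\<Sum>e \<in> edges T D G. \<Sum>l \<in> crossing_lines T e. ln (1 - \<epsilon> * \<pi> l)) =
     (\<Sum>x \<in> (SIGMA e:edges T D G. crossing_lines T e). ln (1 - \<epsilon> * \<pi> (snd x)))"
    using finEd crfin by (subst sum.Sigma) (auto simp: case_prod_unfold)
  also have "\<dots> = (\<Sum>v \<in> {v \<in> N. straight G v}. ln (1 - \<epsilon> * \<pi> (across G v)))"
    by (subst sum.reindex_bij_betw[OF bij_crossings[OF G d], symmetric]) simp
  finally have "exp (\<Sum>e \<in> edges T D G. \<Sum>l \<in> crossing_lines T e. ln (1 - \<epsilon> * \<pi> l)) =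
     (\<Prod>v \<in> {v \<in> N. straight G v}. exp (ln (1 - \<epsilon> * \<pi> (across G v))))"
    using fin by (simp add: exp_sum)
  also have "\<dots> = (\<Prod>v \<in> {v \<in> N. straight G v}. 1 - \<epsilon> * \<pi> (across G v))"
    using eps_pi(1)[OF straight_along(7)] by (intro prod.cong) auto
  also have "\<dots> = (\<Prod>v\<in>N. if straight G v then 1 - \<epsilon> * \<pi> (across G v) else 1)"
    by (rule prod.inter_filter[OF fin])
  finally have S1: "exp (\<Sum>e \<in> edges T D G. \<Sum>l \<in> crossing_lines T e. ln (1 - \<epsilon> * \<pi> l)) =
     (\<Prod>v\<in>N. if straight G v then 1 - \<epsilon> * \<pi> (across G v) else 1)" .
  \<comment> \<open>\<open>nodes_on\<close> looks at nodes of the whole plane; the closed graph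
    stays in the closed window, whose frontier contains no nodes.\<close>
  have on: "nodes_on T G = {v \<in> N. degree G v \<noteq> 0}"
  proof -
    have "v \<in> nodes_on T G \<longleftrightarrow> v \<in> N \<and> degree G v \<noteq> 0" for v
    proof -
      have "v \<in> D" if v: "v \<in> nodes T" "v \<in> closure s" "s \<in> G" for s
      proof -
        have "s \<in> segments T D" using G v(3) by blast
        then have "s \<subseteq> D" unfolding segments_eq using face_sub by blast
        then have "v \<in> closure D" using closure_mono v(2) by blast
        then show ?thesis using closure_D_cases D_props(5) v(1) by blast
      qed
      then have "v \<in> nodes_on T G \<longleftrightarrow> v \<in> N \<and> (\<exists>s\<in>G. v \<in> closure s)"
        unfolding nodes_on_def N_def by blast
      then show ?thesis using degree_pos[OF _ G] by blast
    qed
    then show ?thesis by blast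
  qed
  have bp: "\<alpha> / K * (\<Prod>l \<in> {l\<in>T. v \<in> l}. \<pi> l) = birth_prob (up v) (lo v)" if "v \<in> N" for v
    unfolding node_lines_eq[OF that] birth_prob_def using node_up_lo(6)[OF that] by simp
  have "exp (- (\<Sum>v \<in> nodes_on T G. ln (1 - \<alpha> / K * (\<Prod>l \<in> {l\<in>T. v \<in> l}. \<pi> l)))) =
     (\<Prod>v \<in> {v \<in> N. degree G v \<noteq> 0}. exp (- ln (1 - \<alpha> / K * (\<Prod>l \<in> {l\<in>T. v \<in> l}. \<pi> l))))"
    unfolding on sum_negf[symmetric] using fin by (simp add: exp_sum)
  also have "\<dots> = (\<Prod>v \<in> {v \<in> N. degree G v \<noteq> 0}. 1 / (1 - birth_prob (up v) (lo v)))"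
  proof (rule prod.cong[OF refl])
    fix v assume "v \<in> {v \<in> N. degree G v \<noteq> 0}"
    then have v: "v \<in> N" by blast
    have "0 < 1 - birth_prob (up v) (lo v)" using birth_prob_bounds(2)[OF node_up_lo(7,8)[OF v]] by simp
    then show "exp (- ln (1 - \<alpha> / K * (\<Prod>l \<in> {l\<in>T. v \<in> l}. \<pi> l))) = 1 / (1 - birth_prob (up v) (lo v))"
      unfolding bp[OF v] by (simp add: exp_minus inverse_eq_divide)
  qed
  also have "\<dots> = (\<Prod>v\<in>N. if degree G v \<noteq> 0 then 1 / (1 - birth_prob (up v) (lo v)) else 1)"
    by (rule prod.inter_filter[OF fin])
  finally have S2: "exp (- (\<Sum>v \<in> nodes_on T G. ln (1 - \<alpha> / K * (\<Prod>l \<in> {l\<in>T. v \<in> l}. \<pi> l)))) =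
     (\<Prod>v\<in>N. if degree G v \<noteq> 0 then 1 / (1 - birth_prob (up v) (lo v)) else 1)" .
  have "(\<Prod>e \<in> primary_edges T G. \<pi> (line_of T e)) = (\<Prod>x \<in> P.starts. \<pi> (line_of T (P.comp_of x)))"
    unfolding primary_edges_eq by (rule prod.reindex_bij_betw[OF P.bij_comp_of, symmetric])
  also have "\<dots> = (\<Prod>(v, m) \<in> P.starts. \<pi> m)"
    using P.line_of_comp by (intro prod.cong) auto
  also have "\<dots> = (\<Prod>v\<in>sites. primary_weight G v)"
    unfolding P.starts_def primary_weight_def
    by (rule prod.Sigma[symmetric]) (use finite_sites finite_lines_at in auto)
  finally have pr: "(\<Prod>e \<in> primary_edges T G. \<pi> (line_of T e)) = (\<Prod>v\<in>sites. primary_weight G v)" .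
  have "(\<Prod>v\<in>sites. site_factor G v) = (\<Prod>v\<in>N. site_factor G v) * (\<Prod>v\<in>B. (1 / K) ^ edge_starts G v * primary_weight G v)"
    unfolding prod_sites using site_factor_entry by (simp cong: prod.cong)
  also have "(\<Prod>v\<in>N. site_factor G v) = 
     (\<Prod>v\<in>N. (if degree G v = 2 \<and> \<not> straight G v then \<alpha> else 1) * (if degree G v = 3 then K * aT else 1) *
    (if degree G v = 4 then K * aX else 1) * (1 / K) ^ edge_starts G v *
    (if straight G v then 1 - \<epsilon> * \<pi> (across G v) else 1) *
    (if degree G v \<noteq> 0 then 1 / (1 - birth_prob (up v) (lo v)) else 1) * primary_weight G v)"
    by (rule prod.cong[OF refl site_factor_node[OF _ G]])
  finally show ?thesis
    unfolding boltzmann_Phi nV nT nX nE S1 S2 pr prod_sites prod.distrib by (simp only: mult_ac)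
qed

theorem field_eq_dynamics:
  "polygonal_field T \<pi> D k (energy) = dynamics"
proof -
  let ?S = "configs T D k" and ?p = "dynamics"
  let ?w = "\<lambda>\<gamma>. boltzmann (energy \<gamma>) * (\<Prod>e \<in> primary_edges T (fst \<gamma>). \<pi> (line_of T e))"
  define Z where "Z = (\<Prod>v\<in>sites. site_const v) / k"
  have Z: "0 < Z" unfolding Z_def using site_const_pos k2 by (auto intro!: divide_pos_pos prod_pos)
  have pw: "pmf ?p \<gamma> = Z * ?w \<gamma>" if "\<gamma> \<in> ?S" for \<gamma>
  proof -
    obtain G c where e: "\<gamma> = (G, c)" by (cases \<gamma>)
    show ?thesis using that unfolding e Z_def fst_conv
      by (simp only: pmf_dynamics_configs weight_eq)
  qed
  have sub: "set_pmf ?p \<subseteq> ?S"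
  proof
    fix \<gamma> assume a: "\<gamma> \<in> set_pmf ?p"
    obtain G c where e: "\<gamma> = (G, c)" by (cases \<gamma>)
    show "\<gamma> \<in> ?S" using a support_configs[of G c] unfolding e by (simp add: set_pmf_iff)
  qed
  \<comment> \<open>The total mass of the dynamics computes the partition function, which therefore
    is \<open>1 / Z\<close> and in particular positive.\<close>
  have "1 = (\<Sum>\<gamma>\<in>?S. pmf ?p \<gamma>)" using sum_pmf_eq_1[OF finite_configs sub] by simp
  also have "\<dots> = Z * sum ?w ?S" unfolding sum_distrib_left by (rule sum.cong[OF refl pw])
  finally have sw: "sum ?w ?S = 1 / Z" using Z by (simp add: field_simps)
  \<comment> \<open>Nonnegativity of the Gibbs weights is read off from the probabilities to which
    they are proportional.\<close>
  have w0: "0 \<le> ?w \<gamma>" if "\<gamma> \<in> ?S" for \<gamma>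
    using pw[OF that] Z pmf_nonneg[of ?p \<gamma>] by (metis zero_le_mult_iff not_less)
  have pn: "pmf (normalised_pmf ?S ?w) \<gamma> = (if \<gamma> \<in> ?S then ?w \<gamma> / sum ?w ?S else 0)" for \<gamma>
  proof (rule pmf_normalised_pmf[OF finite_configs w0])
    show "0 < sum ?w ?S" unfolding sw using Z by simp
  qed
  show ?thesis unfolding polygonal_field_def
  proof (rule pmf_eqI)
    fix \<gamma>
    show "pmf (normalised_pmf ?S ?w) \<gamma> = pmf ?p \<gamma>"
    proof (cases "\<gamma> \<in> ?S")
      case True
      show ?thesis unfolding pn if_P[OF True] sw pw[OF True] using Z by simp
    next
      case False
      then have "pmf ?p \<gamma> = 0" using sub by (auto simp: pmf_eq_0_set_pmf)
      then show ?thesis unfolding pn if_not_P[OF False] by simp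
    qed
  qed
qed

end

theorem theorem2:
  fixes T :: "(real \<times> real) set set"
    and \<pi> :: "(real \<times> real) set \<Rightarrow> real"
    and D :: "(real \<times> real) set"
    and k :: nat
    and \<alpha>\<^sub>V :: real
  assumes "regular_tessellation T"
    and "\<forall>l\<in>T. 0 < \<pi> l \<and> \<pi> l < 1"
    and "window T D"
    and "no_spatial_direction T D"
    and "2 \<le> k"
    and "0 \<le> \<alpha>\<^sub>V" and "\<alpha>\<^sub>V \<le> 1"
  shows "polygonal_field T \<pi> D k (Phi T \<pi> D k \<alpha>\<^sub>V) = particle_dynamics T \<pi> D k \<alpha>\<^sub>V"
proof -
  interpret field_setting T D \<pi> k \<alpha>\<^sub>V
    using assms by unfold_locales blast+
  show ?thesis by (rule field_eq_dynamics)
qed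

end
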